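(* Let $G$ be a finite simple graph with at least one edge, and suppose $\mathcal{N}(G)$ is given. (1) Let $A=(a_i)_{i=1}^k$ be a sequence with $a_i\in[2,v(G)]$ for all $i$. Then $con(A\rightarrow G)$ and the number $ham(G)$ of hamiltonian cycles of $G$ are reconstructible from $\mathcal{N}(G)$. (2) If $A=(A_i)_{i=1}^l$ where each $A_i$ is a finite sequence in $[2,v(G)]$, and $B=(b_i)_{i=1}^l$ is a sequence in $[2,v(G)]$, then $Q_m(A,B\rightarrow G)$ and $T_m(A,B\rightarrow G)$ are reconstructible from $\mathcal{N}(G)$ for each $m\le v(G)$. (3) The number of spanning trees of $G$, the number of cycles of length $i$ in $G$ for $3\le i\le v(G)$, the number of unicyclic subgraphs of $G$ containing a cycle of length $i$ for each $i\in[3,v(G)]$, and the characteristic polynomial $P(G;\lambda)$ are all reconstructible from $\mathcal{N}(G)$.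
   Context: All graphs are finite and simple; $v(G)$ is the number of vertices; $[a,b]$ is the set of integers from $a$ to $b$. $\binom{G}{F}$ is the number of induced subgraphs of $G$ isomorphic to $F$. $\Lambda(G)=\{\Lambda_1,\dots,\Lambda_I\}$ is the set of distinct isomorphism types of induced subgraphs of $G$ having at least one edge (including $G$), and $\mathcal{N}(G)=(N_{ij})$ is the $I\times I$ matrix $N_{ij}=\binom{\Lambda_i}{\Lambda_j}$. It is unlabelled: the graphs $\Lambda_i$ are not given, so $\mathcal{N}(G)=\mathcal{N}(G')$ means equality up to applying one and the same permutation to rows and columns. A quantity attached to graphs is reconstructible from $\mathcal{N}(G)$ if it can be computed from $\mathcal{N}(G)$, i.e. it takes equal values on any two graphs $G,G'$ with at least one edge and $\mathcal{N}(G)=\mathcal{N}(G')$. $C_i$ denotes a cycle of length $i$ for $i\ge 3$, and by convention $C_2\cong K_2$ (a single edge counts as a cycle of length $2$). For $X\subseteq VG$, $G_X$ is the induced subgraph on $X$. For a sequence $A=(a_i)_{i=1}^k$ of integers $\ge 2$, $con(A\rightarrow G_X)$ is the number of $k$-tuples $(F_1,\dots,F_k)$ of subgraphs of $G_X$ with $F_j\cong C_{a_j}$ for all $j$, $\bigcup_j VF_j=X$, and $\bigcup_j F_j$ connected (so it is $0$ if some $a_j>|X|$). For lists $A=(A_i)_{i=1}^l$ of such sequences and $B=(b_i)_{i=1}^l$, $$Q_m(A,B\rightarrow G)=\sum_{S\subseteq VG,\ |S|=m}\ \prod_{i=1}^l\Bigl(\sum_{X\subseteq S,\ |X|=b_i}con(A_i\rightarrow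 G_X)\Bigr),$$ $$T_m(A,B\rightarrow G)=\sum_{(X_1,\dots,X_l)}\ \prod_{i=1}^l con(A_i\rightarrow G_{X_i}),$$ the last sum being over all $l$-tuples of subsets $X_j\subseteq VG$ with $|X_j|=b_j$ for all $j$ and $|\bigcup_j X_j|=m$. A unicyclic graph is a connected graph containing exactly one cycle (of length at least $3$). $P(G;\lambda)=\det(\lambda I-M)$ with $M$ the adjacency matrix of $G$. *)

theory Defs
  imports "Jordan_Normal_Form.Char_Poly"
begin

record 'a graph =
  verts :: "'a set"
  edges :: "'a set set"

definition simple_graph :: "'a graph \<Rightarrow> bool" where
  "simple_graph G \<longleftrightarrow> finite (verts G) \<and> (\<forall>e\<in>edges G. e \<subseteq> verts G \<and> card e = 2)"

definition v :: "'a graph \<Rightarrow> nat" where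
  "v G = card (verts G)"

definition is_subgraph :: "'a graph \<Rightarrow> 'a graph \<Rightarrow> bool" where
  "is_subgraph F G \<longleftrightarrow> simple_graph F \<and> verts F \<subseteq> verts G \<and> edges F \<subseteq> edges G"

definition induced :: "'a graph \<Rightarrow> 'a set \<Rightarrow> 'a graph" where
  "induced G X = \<lparr>verts = X, edges = {e \<in> edges G. e \<subseteq> X}\<rparr>"

definition isomorphic :: "'a graph \<Rightarrow> 'b graph \<Rightarrow> bool" (infix "\<simeq>" 50) where
  "G \<simeq> H \<longleftrightarrow> (\<exists>f. bij_betw f (verts G) (verts H) \<and> (\<lambda>e. f ` e) ` edges G = edges H)"

definition connected_graph :: "'a graph \<Rightarrow> bool" where
  "connected_graph G \<longleftrightarrow> verts G \<noteq> {} \<and>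
     (\<forall>x\<in>verts G. \<forall>y\<in>verts G. (x, y) \<in> {(a, b). {a, b} \<in> edges G}\<^sup>*)"

definition Union_graph :: "'a graph list \<Rightarrow> 'a graph" where
  "Union_graph Fs = \<lparr>verts = (\<Union>F\<in>set Fs. verts F), edges = (\<Union>F\<in>set Fs. edges F)\<rparr>"

text \<open>Only meant for \<open>i \<ge> 2\<close>. For \<open>i = 2\<close> both values of \<open>j\<close> give the same edge,
  so \<open>C 2\<close> is a single edge, which is the usual convention \<open>C\<^sub>2 \<cong> K\<^sub>2\<close>.\<close>

definition C :: "nat \<Rightarrow> nat graph" where
  "C i = \<lparr>verts = {..<i}, edges = {{j, Suc j mod i} | j. j < i}\<rparr>"

definition induced_count :: "'a graph \<Rightarrow> 'b graph \<Rightarrow> nat" where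
  "induced_count G F = card {X. X \<subseteq> verts G \<and> induced G X \<simeq> F}"

text \<open>\<open>L\<close> enumerates \<open>\<Lambda>(G)\<close>: it contains exactly one representative of each
  isomorphism type of induced subgraphs of \<open>G\<close> with at least one edge.\<close>

definition enumerates_types :: "'a graph list \<Rightarrow> 'a graph \<Rightarrow> bool" where
  "enumerates_types L G \<longleftrightarrow>
     (\<forall>H\<in>set L. \<exists>X\<subseteq>verts G. H = induced G X \<and> edges H \<noteq> {}) \<and>
     (\<forall>X\<subseteq>verts G. edges (induced G X) \<noteq> {} \<longrightarrow> (\<exists>!i. i < length L \<and> induced G X \<simeq> L ! i))"

definition N_matrix :: "'a graph list \<Rightarrow> nat mat" where
  "N_matrix L = mat (length L) (length L) (\<lambda>(i, j). induced_count (L ! i) (L ! j))"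

definition equal_up_to_permutation :: "nat mat \<Rightarrow> nat mat \<Rightarrow> bool" where
  "equal_up_to_permutation M M' \<longleftrightarrow>
     dim_row M = dim_row M' \<and> dim_col M = dim_col M' \<and>
     (\<exists>p. p permutes {..<dim_row M} \<and>
          (\<forall>i<dim_row M. \<forall>j<dim_col M. M $$ (i, j) = M' $$ (p i, p j)))"

text \<open>\<open>\<N>(G) = \<N>(G')\<close> as unlabelled matrices. The permutation makes the condition independent
  of the chosen enumerations.\<close>

definition same_N :: "'a graph \<Rightarrow> 'b graph \<Rightarrow> bool" where
  "same_N G G' \<longleftrightarrow> (\<exists>L L'. enumerates_types L G \<and> enumerates_types L' G' \<and>
     equal_up_to_permutation (N_matrix L) (N_matrix L'))"

definition con :: "nat list \<Rightarrow> 'a graph \<Rightarrow> nat" where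
  "con A G = card {Fs. length Fs = length A \<and>
     (\<forall>j<length A. is_subgraph (Fs ! j) G \<and> Fs ! j \<simeq> C (A ! j)) \<and>
     verts (Union_graph Fs) = verts G \<and> connected_graph (Union_graph Fs)}"

definition Q :: "nat \<Rightarrow> nat list list \<Rightarrow> nat list \<Rightarrow> 'a graph \<Rightarrow> nat" where
  "Q m A B G = (\<Sum>S | S \<subseteq> verts G \<and> card S = m. \<Prod>i<length A.
     \<Sum>X | X \<subseteq> S \<and> card X = B ! i. con (A ! i) (induced G X))"

definition T :: "nat \<Rightarrow> nat list list \<Rightarrow> nat list \<Rightarrow> 'a graph \<Rightarrow> nat" where
  "T m A B G =
     (\<Sum>Xs | length Xs = length B \<and> (\<forall>j<length B. Xs ! j \<subseteq> verts G \<and> card (Xs ! j) = B ! j) \<and>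
            card (\<Union>(set Xs)) = m.
        \<Prod>i<length A. con (A ! i) (induced G (Xs ! i)))"

definition cycle_subgraphs :: "nat \<Rightarrow> 'a graph \<Rightarrow> 'a graph set" where
  "cycle_subgraphs i G = {F. is_subgraph F G \<and> F \<simeq> C i}"

definition ham :: "'a graph \<Rightarrow> nat" where
  "ham G = card {F \<in> cycle_subgraphs (v G) G. verts F = verts G}"

text \<open>In trees and unicyclic graphs only cycles of length at least 3 count.\<close>

definition tree :: "'a graph \<Rightarrow> bool" where
  "tree G \<longleftrightarrow> connected_graph G \<and> (\<forall>i\<ge>3. cycle_subgraphs i G = {})"

definition unicyclic :: "'a graph \<Rightarrow> bool" where
  "unicyclic G \<longleftrightarrow> connected_graph G \<and> (\<exists>!F. \<exists>i\<ge>3. F \<in> cycle_subgraphs i G)"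

definition num_spanning_trees :: "'a graph \<Rightarrow> nat" where
  "num_spanning_trees G = card {H. is_subgraph H G \<and> verts H = verts G \<and> tree H}"

definition num_cycles :: "nat \<Rightarrow> 'a graph \<Rightarrow> nat" where
  "num_cycles i G = card (cycle_subgraphs i G)"

definition num_unicyclic :: "nat \<Rightarrow> 'a graph \<Rightarrow> nat" where
  "num_unicyclic i G = card {U. is_subgraph U G \<and> unicyclic U \<and> cycle_subgraphs i U \<noteq> {}}"

definition adjacency_matrix :: "'a graph \<Rightarrow> 'a list \<Rightarrow> int mat" where
  "adjacency_matrix G vs =
     mat (length vs) (length vs) (\<lambda>(i, j). if {vs ! i, vs ! j} \<in> edges G then 1 else 0)"

text \<open>The vertex order is arbitrary; see \<open>characteristic_polynomial_eq\<close> below.\<close>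

definition characteristic_polynomial :: "'a graph \<Rightarrow> int poly" where
  "characteristic_polynomial G =
     char_poly (adjacency_matrix G (SOME vs. distinct vs \<and> set vs = verts G))"

lemma det_permute_rows_cols:
  fixes M :: "'a :: comm_ring_1 mat"
  assumes M: "M \<in> carrier_mat n n" and p: "p permutes {0..<n}"
  shows "det (mat n n (\<lambda>(i, j). M $$ (p i, p j))) = det M"
proof -
  define R where "R = mat n n (\<lambda>(i, j). M $$ (p i, j))"
  have pn: "p i < n" if "i < n" for i
    using permutes_in_image[OF p, of i] that by simp
  have RT: "R\<^sup>T \<in> carrier_mat n n" and R: "R \<in> carrier_mat n n" by (auto simp: R_def)
  have "mat n n (\<lambda>(i, j). M $$ (p i, p j)) = (mat n n (\<lambda>(i, j). R\<^sup>T $$ (p i, j)))\<^sup>T"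
    by (rule eq_matI) (auto simp: R_def pn)
  then have "det (mat n n (\<lambda>(i, j). M $$ (p i, p j))) = det (mat n n (\<lambda>(i, j). R\<^sup>T $$ (p i, j)))"
    using det_transpose[of "mat n n (\<lambda>(i, j). R\<^sup>T $$ (p i, j))" n] by simp
  also have "\<dots> = signof p * det R"
    using det_permute_rows[OF RT p] det_transpose[OF R] by simp
  also have "\<dots> = signof p * (signof p * det M)"
    unfolding R_def using det_permute_rows[OF M p] by simp
  also have "\<dots> = det M" by (simp add: sign_def)
  finally show ?thesis .
qed

lemma char_poly_adjacency_matrix_cong:
  assumes "distinct vs" "distinct ws" "set vs = set ws"
  shows "char_poly (adjacency_matrix G vs) = char_poly (adjacency_matrix G ws)"
proof -
  define n where "n = length ws"
  have "mset vs = mset ws" using assms by (simp add: set_eq_iff_mset_eq_distinct)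
  then obtain p where p: "p permutes {..<n}" and vs: "permute_list p ws = vs"
    unfolding n_def by (rule mset_eq_permutation)
  have lv: "length vs = n" using vs by (auto simp: n_def)
  have nth: "vs ! i = ws ! p i" if "i < n" for i
    using permute_list_nth[OF p[unfolded n_def], of i] that vs by (simp add: n_def)
  have pn: "p i < n" if "i < n" for i
    using permutes_in_image[OF p, of i] that by simp
  have inj: "p i = p j \<longleftrightarrow> i = j" for i j
    using permutes_inj[OF p] by (auto dest: injD)
  let ?M = "char_poly_matrix (adjacency_matrix G ws)"
  have M: "?M \<in> carrier_mat n n" by (auto simp: adjacency_matrix_def n_def)
  have "char_poly_matrix (adjacency_matrix G vs) = mat n n (\<lambda>(i, j). ?M $$ (p i, p j))"
    by (rule eq_matI)
      (auto simp: char_poly_matrix_def adjacency_matrix_def lv nth pn inj n_def[symmetric])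
  then show ?thesis
    using det_permute_rows_cols[OF M] p by (simp add: char_poly_def lessThan_atLeast0)
qed

lemma characteristic_polynomial_eq:
  assumes "distinct vs" "set vs = verts G"
  shows "characteristic_polynomial G = char_poly (adjacency_matrix G vs)"
proof -
  define ws where "ws = (SOME vs. distinct vs \<and> set vs = verts G)"
  have "distinct ws \<and> set ws = verts G"
    unfolding ws_def by (rule someI[of _ vs]) (use assms in simp)
  then show ?thesis
    using char_poly_adjacency_matrix_cong[of ws vs G] assms
    by (simp add: characteristic_polynomial_def ws_def[symmetric])
qed

end

theory Submission
  imports Defs "HOL-Combinatorics.Orbits"
begin

text \<open>If \<open>\<N>(G) = \<N>(G')\<close>, the induced subgraphs of \<open>G\<close> and \<open>G'\<close> can be matched hereditarily: there is a
  relation \<open>R\<close> with \<open>R G G'\<close> such that the induced subgraphs of \<open>R\<close>-related graphs correspond bijectively,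
  with the same orders and again \<open>R\<close>-related. Sums over induced subgraphs therefore transfer
  between related graphs, and by Moebius inversion so do the summands, as soon as the sums are known.

  Products of cycle counts are sums of numbers of covering tuples of cycles over induced subgraphs
  (Kocay's lemma). Splitting a covering tuple at one connected component expresses \<open>con\<close> of sequences
  without entry \<open>v G\<close> by smaller induced subgraphs. Taking one cycle and many edges, \<open>con\<close> counts pairs
  of a cycle and a connected spanning subgraph with \<open>m\<close> edges containing it. For \<open>m = v G\<close> each such
  subgraph has exactly one cycle, so the hamiltonian cycles are what remains after subtracting the
  shorter ones; this closes the induction on the order.

  For the characteristic polynomial, the Leibniz expansion is split at the permutation cycle
  through a root, which involves hamiltonian cycles of induced subgraphs and their complements.\<close>

text \<open>The obstacle is circularity: Kocay's lemma for a sequence with an entry n presupposes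
  the number of n-cycles, the very thing wanted at order n. Edges break the circle. For n >= 3 the
  edges and all cycles shorter than n are already known at order n, so the connected spanning
  subgraphs with n edges can be counted as pairs with an edge, without mention of n-cycles. The
  induction starts at order 2, where only the presence of an edge matters. Chosen edges may repeat,
  so one count of tuples mixes subgraphs with various numbers of edges. The coefficients depend on
  sizes only, and the system is triangular with nonzero diagonal, hence solvable by cancellation.
  The matrix names neither orders nor edgeless vertex sets; both must be recovered before subsets
  can be matched. Only vertex sets are matched, not vertices, and complements need not be respected.
  So a root has no counterpart in the other graph: summing over all roots costs a factor
  \<open>v G\<close>, which cancels among integer polynomials. Sums over complementary pairs are
  rewritten as sums over pairs with a given union.\<close>

section \<open>Induced subgraphs of simple graphs\<close>

lemma simple_induced: "simple_graph G \<Longrightarrow> X \<subseteq> verts G \<Longrightarrow> simple_graph (induced G X)"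
  by (auto simp: simple_graph_def induced_def intro: finite_subset)

lemma verts_induced [simp]: "verts (induced G X) = X"
  by (simp add: induced_def)

lemma edges_induced: "edges (induced G X) = {e \<in> edges G. e \<subseteq> X}"
  by (simp add: induced_def)

lemma induced_induced: "Y \<subseteq> X \<Longrightarrow> induced (induced G X) Y = induced G Y"
  by (auto simp: induced_def)

lemma induced_verts: "simple_graph G \<Longrightarrow> induced G (verts G) = G"
  by (cases G) (auto simp: induced_def simple_graph_def)

lemma v_induced [simp]: "v (induced G X) = card X"
  by (simp add: v_def)

lemma simple_finite [simp]: "simple_graph G \<Longrightarrow> finite (verts G)"
  by (simp add: simple_graph_def)

lemma simple_finite_edges: "simple_graph G \<Longrightarrow> finite (edges G)"
  by (rule finite_subset[of _ "Pow (verts G)"]) (auto simp: simple_graph_def)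

lemma simple_edge_pair:
  assumes "simple_graph G" "e \<in> edges G"
  obtains x y where "e = {x, y}" "x \<noteq> y" "x \<in> verts G" "y \<in> verts G"
  using assms unfolding simple_graph_def card_2_iff by (metis insert_subset)

subsection \<open>Cycles\<close>

definition cycle_edges :: "nat \<Rightarrow> (nat \<Rightarrow> 'a) \<Rightarrow> 'a set set" where
  "cycle_edges i g = {{g j, g (Suc j mod i)} | j. j < i}"

lemma cycle_edges_image: "cycle_edges i g = (\<lambda>j. {g j, g (Suc j mod i)}) ` {..<i}"
  by (auto simp: cycle_edges_def)

text \<open>An isomorphism points from F to \<open>C i\<close>, while the later arguments want a
  parametrization g of F. The hypothesis keeps every edge inside \<open>verts F\<close>, where g
  undoes the isomorphism.\<close>

lemma iso_C_iff:
  "F \<simeq> C i \<longleftrightarrow> (\<exists>g. inj_on g {..<i} \<and> verts F = g ` {..<i} \<and> edges F = cycle_edges i g)"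
  if "\<Union>(edges F) \<subseteq> verts F"
proof
  assume "F \<simeq> C i"
  then obtain f where f: "bij_betw f (verts F) {..<i}" and e: "(\<lambda>e. f ` e) ` edges F = edges (C i)"
    by (auto simp: isomorphic_def C_def)
  define g where "g = inv_into (verts F) f"
  have g: "bij_betw g {..<i} (verts F)" using f by (simp add: g_def bij_betw_inv_into)
  have gf: "g (f x) = x" if "x \<in> verts F" for x
    using f that by (simp add: g_def bij_betw_inv_into_left)
  have "edges F = (\<lambda>e. g ` e) ` ((\<lambda>e. f ` e) ` edges F)"
  proof -
    have "g ` (f ` e) = e" if "e \<in> edges F" for e
      using gf that \<open>\<Union>(edges F) \<subseteq> verts F\<close> by (force simp: image_image)
    then show ?thesis by (simp add: image_image)
  qed
  also have "\<dots> = cycle_edges i g"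
  proof -
    have "edges (C i) = (\<lambda>j. {j, Suc j mod i}) ` {..<i}" by (auto simp: C_def)
    then show ?thesis unfolding e by (simp add: cycle_edges_image image_image)
  qed
  finally show "\<exists>g. inj_on g {..<i} \<and> verts F = g ` {..<i} \<and> edges F = cycle_edges i g"
    using g by (auto simp: bij_betw_def intro!: exI[of _ g])
next
  assume "\<exists>g. inj_on g {..<i} \<and> verts F = g ` {..<i} \<and> edges F = cycle_edges i g"
  then obtain g where g: "inj_on g {..<i}" "verts F = g ` {..<i}" "edges F = cycle_edges i g" by blast
  define f where "f = inv_into {..<i} g"
  have f: "bij_betw f (verts F) {..<i}"
    using g by (simp add: f_def bij_betw_inv_into bij_betw_def inj_on_inv_into)
  have fg: "f (g j) = j" if "j < i" for j
    using g that by (simp add: f_def)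
  have "f ` {g j, g (Suc j mod i)} = {j, Suc j mod i}" if "j < i" for j
    using that fg[of j] fg[of "Suc j mod i"] by simp
  then have "(\<lambda>e. f ` e) ` edges F = edges (C i)"
    unfolding g(3) cycle_edges_image image_image C_def by (auto simp: image_def)
  with f show "F \<simeq> C i" by (auto simp: isomorphic_def C_def)
qed

text \<open>Simplicity of F is inherited: the edges in \<open>cycle_edges i g\<close> lie in the
  image of g, and as edges of G they have two elements.\<close>

lemma cycle_subgraphs_iff:
  assumes "simple_graph G"
  shows "F \<in> cycle_subgraphs i G \<longleftrightarrow> verts F \<subseteq> verts G \<and> edges F \<subseteq> edges G \<and>
    (\<exists>g. inj_on g {..<i} \<and> verts F = g ` {..<i} \<and> edges F = cycle_edges i g)"
proof (cases "\<Union>(edges F) \<subseteq> verts F")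
  case True
  have "simple_graph F" if "verts F \<subseteq> verts G" "edges F \<subseteq> edges G"
    using that True assms finite_subset[of "verts F" "verts G"] unfolding simple_graph_def
    by (auto simp: Sup_le_iff)
  then show ?thesis
    unfolding cycle_subgraphs_def is_subgraph_def using iso_C_iff[OF True] by auto
next
  case False
  have "\<Union>(cycle_edges i g) \<subseteq> g ` {..<i}" for g :: "nat \<Rightarrow> 'a"
    by (auto simp: cycle_edges_def)
  moreover have "\<not> simple_graph F" using False by (auto simp: simple_graph_def)
  ultimately show ?thesis using False unfolding cycle_subgraphs_def is_subgraph_def by (metis (no_types, lifting) mem_Collect_eq)
qed

lemma cycle_subgraphsE:
  assumes "F \<in> cycle_subgraphs i G"
  obtains g where "inj_on g {..<i}" "verts F = g ` {..<i}" "edges F = cycle_edges i g"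
    "simple_graph F" "verts F \<subseteq> verts G" "edges F \<subseteq> edges G"
proof -
  have F: "simple_graph F" "verts F \<subseteq> verts G" "edges F \<subseteq> edges G" "F \<simeq> C i"
    using assms by (auto simp: cycle_subgraphs_def is_subgraph_def)
  then have "\<Union>(edges F) \<subseteq> verts F" by (auto simp: simple_graph_def)
  with F iso_C_iff[OF this, of i] that show ?thesis by blast
qed

lemma finite_subgraphs:
  assumes "simple_graph G" shows "finite {F. is_subgraph F G}"
proof (rule finite_subset)
  show "{F. is_subgraph F G} \<subseteq> (\<lambda>(V, E). \<lparr>verts = V, edges = E\<rparr>) ` (Pow (verts G) \<times> Pow (edges G))"
  proof
    fix F assume "F \<in> {F. is_subgraph F G}"
    then show "F \<in> (\<lambda>(V, E). \<lparr>verts = V, edges = E\<rparr>) ` (Pow (verts G) \<times> Pow (edges G))"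
      by (intro image_eqI[where x = "(verts F, edges F)"]) (auto simp: is_subgraph_def)
  qed
  show "finite ((\<lambda>(V, E). \<lparr>verts = V, edges = E\<rparr>) ` (Pow (verts G) \<times> Pow (edges G)))"
    using assms by (intro finite_imageI finite_cartesian_product) (auto simp: simple_finite_edges)
qed

lemma finite_cycle_subgraphs: "simple_graph G \<Longrightarrow> finite (cycle_subgraphs i G)"
  by (rule finite_subset[OF _ finite_subgraphs]) (auto simp: cycle_subgraphs_def)

lemma card_verts_cycle: "F \<in> cycle_subgraphs i G \<Longrightarrow> card (verts F) = i"
  by (erule cycle_subgraphsE) (simp add: card_image)

lemma cycle_subgraphs_induced:
  assumes "simple_graph G" "X \<subseteq> verts G"
  shows "cycle_subgraphs i (induced G X) = {F \<in> cycle_subgraphs i G. verts F \<subseteq> X}"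
proof -
  have "edges F \<subseteq> edges (induced G X) \<longleftrightarrow> edges F \<subseteq> edges G" if "simple_graph F" "verts F \<subseteq> X" for F
    using that by (auto simp: edges_induced simple_graph_def)
  then show ?thesis using assms by (auto simp: cycle_subgraphs_def is_subgraph_def)
qed

lemma cycle_subgraphs_empty: "simple_graph G \<Longrightarrow> v G < i \<Longrightarrow> cycle_subgraphs i G = {}"
  using card_verts_cycle card_mono[of "verts G"] unfolding v_def
  by (metis (no_types, lifting) cycle_subgraphsE equals0I linorder_not_less simple_finite)

text \<open>Two different indices with the same edge would traverse it in opposite directions, so
  that k + 2 = k modulo i. This excludes everything but i = 2, where indeed both indices give one
  edge.\<close>

lemma inj_on_cycle_edges:
  assumes "inj_on g {..<i}" "3 \<le> i"
  shows "inj_on (\<lambda>j. {g j, g (Suc j mod i)}) {..<i}"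
proof (rule inj_onI)
  fix j k assume jk: "j \<in> {..<i}" "k \<in> {..<i}" and eq: "{g j, g (Suc j mod i)} = {g k, g (Suc k mod i)}"
  have lt: "Suc j mod i < i" "Suc k mod i < i" using assms by auto
  from eq have "j = k \<or> (j = Suc k mod i \<and> Suc j mod i = k)"
    using jk lt inj_onD[OF assms(1)] by (auto simp: doubleton_eq_iff)
  moreover have "\<not> (j = Suc k mod i \<and> Suc j mod i = k)"
  proof (cases "Suc k < i")
    case True
    then show ?thesis using assms(2) jk by (cases "Suc j < i") (auto simp: mod_Suc split: if_splits)
  next
    case False
    then have "Suc k = i" using jk by auto
    then show ?thesis using assms(2) by auto
  qed
  ultimately show "j = k" by blast
qed

text \<open>The number of edges of \<open>C i\<close>; the exception is the single edge
  \<open>C 2\<close>.\<close>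

definition cycle_size :: "nat \<Rightarrow> nat" where
  "cycle_size i = (if i = 2 then 1 else i)"

lemma cycle_edges_2: "cycle_edges 2 g = {{g 0, g 1}}" and image_lessThan_2: "g ` {..<2} = {g 0, g 1}"
proof -
  have [simp]: "{..<2} = {0, 1 :: nat}" by auto
  show "cycle_edges 2 g = {{g 0, g 1}}" "g ` {..<2} = {g 0, g 1}"
    by (simp_all add: cycle_edges_image insert_commute)
qed

lemma card_edges_cycle:
  assumes "F \<in> cycle_subgraphs i G" "2 \<le> i" shows "card (edges F) = cycle_size i"
proof -
  obtain g where g: "inj_on g {..<i}" "edges F = cycle_edges i g"
    using assms(1) by (elim cycle_subgraphsE)
  show ?thesis
  proof (cases "i = 2")
    case True
    then show ?thesis using g by (simp add: cycle_size_def cycle_edges_2)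
  next
    case False
    then show ?thesis using assms(2) card_image[OF inj_on_cycle_edges[OF g(1)]] g
      by (simp add: cycle_size_def cycle_edges_image)
  qed
qed

lemma card_edges_cycle_ge_3:
  assumes "3 \<le> i" "F \<in> cycle_subgraphs i G" shows "card (edges F) = i"
  using card_edges_cycle[OF assms(2)] assms(1) by (simp add: cycle_size_def)

lemma Union_edges_cycle:
  assumes "F \<in> cycle_subgraphs i G" "2 \<le> i" shows "\<Union>(edges F) = verts F"
proof -
  obtain g where g: "verts F = g ` {..<i}" "edges F = cycle_edges i g"
    using assms(1) by (elim cycle_subgraphsE)
  then show ?thesis by (auto simp: cycle_edges_def)
qed

text \<open>With this, an entry 2 of a sequence means the choice of one edge.\<close>

lemma cycle_subgraphs_2:
  assumes "simple_graph G"
  shows "cycle_subgraphs 2 G = (\<lambda>e. \<lparr>verts = e, edges = {e}\<rparr>) ` edges G"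
proof (intro Set.set_eqI iffI)
  fix F assume "F \<in> cycle_subgraphs 2 G"
  then obtain g where g: "verts F = g ` {..<2}" "edges F = cycle_edges 2 g" "edges F \<subseteq> edges G"
    by (elim cycle_subgraphsE)
  note [simp] = cycle_edges_2 image_lessThan_2
  from g show "F \<in> (\<lambda>e. \<lparr>verts = e, edges = {e}\<rparr>) ` edges G"
    by (intro image_eqI[of _ _ "{g 0, g 1}"]) auto
next
  fix F assume "F \<in> (\<lambda>e. \<lparr>verts = e, edges = {e}\<rparr>) ` edges G"
  then obtain e where e: "e \<in> edges G" "F = \<lparr>verts = e, edges = {e}\<rparr>" by blast
  obtain x y where xy: "e = {x, y}" "x \<noteq> y" "x \<in> verts G" "y \<in> verts G"
    using simple_edge_pair[OF assms e(1)] .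
  define g where "g = (\<lambda>j::nat. if j = 0 then x else y)"
  have "inj_on g {..<2}" "g ` {..<2} = e" "cycle_edges 2 g = {e}"
    unfolding cycle_edges_2 image_lessThan_2 using xy by (auto simp: g_def inj_on_def)
  then show "F \<in> cycle_subgraphs 2 G"
    unfolding cycle_subgraphs_iff[OF assms] using e xy by auto
qed

subsection \<open>Connectedness\<close>

abbreviation adj :: "'a set set \<Rightarrow> ('a \<times> 'a) set" where
  "adj E \<equiv> {(a, b). {a, b} \<in> E}"

lemma sym_adj: "sym (adj E)"
  by (auto simp: sym_def insert_commute)

lemma adj_rtrancl_sym: "(x, y) \<in> (adj E)\<^sup>* \<Longrightarrow> (y, x) \<in> (adj E)\<^sup>*"
  using sym_rtrancl[OF sym_adj] by (rule symD)

lemma adj_rtrancl_mono: "(x, y) \<in> (adj E)\<^sup>* \<Longrightarrow> E \<subseteq> E' \<Longrightarrow> (x, y) \<in> (adj E')\<^sup>*"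
  by (rule subsetD[OF rtrancl_mono]) auto

lemma connectedI:
  assumes "r \<in> verts G" "\<And>x. x \<in> verts G \<Longrightarrow> (r, x) \<in> (adj (edges G))\<^sup>*"
  shows "connected_graph G"
  unfolding connected_graph_def
proof (intro conjI ballI)
  show "verts G \<noteq> {}" using assms(1) by auto
  fix x y assume "x \<in> verts G" "y \<in> verts G"
  then show "(x, y) \<in> (adj (edges G))\<^sup>*"
    using assms(2)[of y] adj_rtrancl_sym[OF assms(2)[of x]] by (simp add: rtrancl_trans[of x r _ y])
qed

lemma connectedD:
  "connected_graph G \<Longrightarrow> x \<in> verts G \<Longrightarrow> y \<in> verts G \<Longrightarrow> (x, y) \<in> (adj (edges G))\<^sup>*"
  by (simp add: connected_graph_def)

lemma connected_mono:
  assumes "connected_graph G" "verts H = verts G" "edges G \<subseteq> edges H"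
  shows "connected_graph H"
  using assms adj_rtrancl_mono[OF _ assms(3)] by (simp add: connected_graph_def)

lemma reach_segment:
  assumes "a \<le> b" "\<And>k. a \<le> k \<Longrightarrow> k < b \<Longrightarrow> {g k, g (Suc k)} \<in> E"
  shows "(g a, g b) \<in> (adj E)\<^sup>*"
  using assms
proof (induction b)
  case (Suc b)
  show ?case
  proof (cases "a = Suc b")
    case False
    then have "(g a, g b) \<in> (adj E)\<^sup>*" using Suc by auto
    moreover have "(g b, g (Suc b)) \<in> adj E" using Suc False by auto
    ultimately show ?thesis by (rule rtrancl_into_rtrancl)
  qed auto
qed auto

lemma connected_cycle:
  assumes "F \<in> cycle_subgraphs i G" "1 \<le> i" shows "connected_graph F"
proof -
  obtain g where g: "verts F = g ` {..<i}" "edges F = cycle_edges i g"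
    using assms(1) by (elim cycle_subgraphsE)
  have "(g 0, g b) \<in> (adj (edges F))\<^sup>*" if "b < i" for b
    by (rule reach_segment) (use that g in \<open>force simp: cycle_edges_def\<close>)+
  then show ?thesis using assms(2) g by (intro connectedI[of "g 0"]) auto
qed

text \<open>This lets tuples be counted by edges alone: once they exhaust the edges of a connected
  graph, the vertices are covered too. In order 1 the lone vertex lies on no edge.\<close>

lemma connected_Union_edges:
  assumes "connected_graph G" "simple_graph G" "2 \<le> v G"
  shows "\<Union>(edges G) = verts G"
proof
  show "\<Union>(edges G) \<subseteq> verts G" using assms by (auto simp: simple_graph_def)
  show "verts G \<subseteq> \<Union>(edges G)"
  proof
    fix x assume x: "x \<in> verts G"
    have "verts G \<noteq> {x}" using assms(3) by (auto simp: v_def)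
    then obtain y where y: "y \<in> verts G" "y \<noteq> x" using x by blast
    then have "(x, y) \<in> (adj (edges G))\<^sup>*" using assms x by (simp add: connected_graph_def)
    then show "x \<in> \<Union>(edges G)" using y by (cases rule: converse_rtranclE) auto
  qed
qed

text \<open>The tree grows vertex by vertex: while a vertex is missing, connectedness yields an edge
  leaving the current vertex set X, since otherwise X would be closed under adjacency.\<close>

lemma exists_spanning_tree:
  assumes "connected_graph G" "simple_graph G"
  shows "\<exists>T \<subseteq> edges G. connected_graph \<lparr>verts = verts G, edges = T\<rparr> \<and> Suc (card T) = v G"
proof -
  \<comment> \<open>The condition that T stays inside X ensures that the next edge, which has an end
    outside X, is not yet in T, so that the count goes up by one.\<close>
  have "\<exists>X \<subseteq> verts G. \<exists>T \<subseteq> edges G. card X = k \<and> \<Union>T \<subseteq> X \<and>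
      connected_graph \<lparr>verts = X, edges = T\<rparr> \<and> Suc (card T) = k"
    if "1 \<le> k" "k \<le> v G" for k
    using that
  proof (induction k rule: nat_induct_at_least)
    case base
    obtain r where "r \<in> verts G" using assms by (auto simp: connected_graph_def)
    then show ?case
      by (intro exI[of _ "{r}"] conjI exI[of _ "{}"]) (auto simp: connected_graph_def)
  next
    case (Suc k)
    then obtain X T where XT: "X \<subseteq> verts G" "T \<subseteq> edges G" "card X = k" "\<Union>T \<subseteq> X"
      "connected_graph \<lparr>verts = X, edges = T\<rparr>" "Suc (card T) = k" by auto
    have "X \<noteq> {}" "X \<noteq> verts G" using Suc XT by (auto simp: v_def)
    then obtain r y where ry: "r \<in> X" "y \<in> verts G - X" using XT(1) by auto
    have "\<exists>a b. {a, b} \<in> edges G \<and> a \<in> X \<and> b \<notin> X"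
    proof (rule ccontr)
      assume neg: "\<not> ?thesis"
      have "(r, y) \<in> (adj (edges G))\<^sup>*" using assms ry XT(1) by (auto simp: connected_graph_def)
      then have "y \<in> X" by (induction rule: rtrancl_induct) (use ry neg in auto)
      with ry show False by simp
    qed
    then obtain a b where ab: "{a, b} \<in> edges G" "a \<in> X" "b \<notin> X" by blast
    have b: "b \<in> verts G" using ab assms(2) by (auto simp: simple_graph_def)
    have finX: "finite X" "finite T"
      using XT assms(2) by (auto intro: finite_subset simp: simple_finite_edges)
    have "connected_graph \<lparr>verts = insert b X, edges = insert {a, b} T\<rparr>"
    proof (rule connectedI[of a])
      fix x assume "x \<in> verts \<lparr>verts = insert b X, edges = insert {a, b} T\<rparr>"
      then consider "x = b" | "x \<in> X" by auto
      then show "(a, x) \<in> (adj (edges \<lparr>verts = insert b X, edges = insert {a, b} T\<rparr>))\<^sup>*"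
      proof cases
        case 2
        then have "(a, x) \<in> (adj T)\<^sup>*" using XT(5) ab by (auto simp: connected_graph_def)
        then show ?thesis by (rule adj_rtrancl_mono) auto
      qed auto
    qed (use ab in auto)
    moreover have "{a, b} \<notin> T" using XT(4) ab(3) by auto
    ultimately show ?case
      using XT ab b finX by (intro exI[of _ "insert b X"] conjI exI[of _ "insert {a, b} T"]) auto
  qed
  from this[of "v G"] obtain X T where XT: "X \<subseteq> verts G" "T \<subseteq> edges G" "card X = v G"
      "connected_graph \<lparr>verts = X, edges = T\<rparr>" "Suc (card T) = v G"
    using assms by (auto simp: connected_graph_def v_def Suc_le_eq card_gt_0_iff)
  then have "X = verts G" using assms by (simp add: card_subset_eq v_def)
  with XT show ?thesis by auto
qed

lemma connected_card_edges:
  assumes "connected_graph G" "simple_graph G" shows "v G \<le> Suc (card (edges G))"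
  using exists_spanning_tree[OF assms] card_mono[OF simple_finite_edges[OF assms(2)]] by (metis Suc_le_mono)

section \<open>Edge deletion, trees and unicyclic graphs\<close>

definition delete_edge :: "'a graph \<Rightarrow> 'a set \<Rightarrow> 'a graph" where
  "delete_edge G e = \<lparr>verts = verts G, edges = edges G - {e}\<rparr>"

lemma delete_edge_simps [simp]:
  "verts (delete_edge G e) = verts G" "edges (delete_edge G e) = edges G - {e}" "v (delete_edge G e) = v G"
  by (simp_all add: delete_edge_def v_def)

lemma simple_delete_edge: "simple_graph G \<Longrightarrow> simple_graph (delete_edge G e)"
  by (auto simp: simple_graph_def)

lemma card_delete_edge:
  "simple_graph G \<Longrightarrow> e \<in> edges G \<Longrightarrow> Suc (card (edges (delete_edge G e))) = card (edges G)"
  by (metis card_Suc_Diff1 delete_edge_simps(2) simple_finite_edges)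

lemma cycle_subgraphs_delete_edge:
  "cycle_subgraphs i (delete_edge G e) = {F \<in> cycle_subgraphs i G. e \<notin> edges F}"
  by (auto simp: cycle_subgraphs_def is_subgraph_def)

text \<open>The rest of the cycle is a detour between the ends of the deleted edge.\<close>

lemma connected_delete_cycle_edge:
  assumes "connected_graph G" "F \<in> cycle_subgraphs i G" "3 \<le> i" "e \<in> edges F"
  shows "connected_graph (delete_edge G e)"
proof -
  obtain g where g: "inj_on g {..<i}" "edges F = cycle_edges i g" "edges F \<subseteq> edges G"
    using assms(2) by (elim cycle_subgraphsE)
  obtain j where j: "j < i" "e = {g j, g (Suc j mod i)}" using g assms(4) by (auto simp: cycle_edges_def)
  let ?E = "edges G - {e}"
  have edge: "{g k, g (Suc k mod i)} \<in> ?E" if "k < i" "k \<noteq> j" for k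
    using that j inj_onD[OF inj_on_cycle_edges[OF g(1) assms(3)], of k j] g(2,3)
    by (auto simp: cycle_edges_def)
  \<comment> \<open>Arcs of the cycle whose steps all avoid the index j of the deleted edge.\<close>
  have seg: "(g a, g b) \<in> (adj ?E)\<^sup>*" if "a \<le> b" "b < i" "j < a \<or> b \<le> j" for a b
  proof (rule reach_segment)
    fix k assume "a \<le> k" "k < b"
    then show "{g k, g (Suc k)} \<in> ?E" using edge[of k] that by auto
  qed fact
  \<comment> \<open>If the deleted edge is the closing one, the detour is the arc from 0 to j.
    Otherwise it runs from \<open>Suc j\<close> up to \<open>i - 1\<close>, over the closing edge to
    0, and on to j.\<close>
  have "(g j, g (Suc j mod i)) \<in> (adj ?E)\<^sup>*"
  proof (cases "Suc j < i")
    case False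
    then have "Suc j = i" using j by simp
    then show ?thesis using adj_rtrancl_sym[OF seg[of 0 j]] j(1) by auto
  next
    case True
    have "(g (i - 1), g 0) \<in> adj ?E" using edge[of "i - 1"] True assms(3) by auto
    moreover have "(g (Suc j), g (i - 1)) \<in> (adj ?E)\<^sup>*" using True by (intro seg) auto
    moreover have "(g 0, g j) \<in> (adj ?E)\<^sup>*" using True by (intro seg) auto
    ultimately have "(g (Suc j), g j) \<in> (adj ?E)\<^sup>*" by (meson rtrancl_into_rtrancl rtrancl_trans)
    then show ?thesis using adj_rtrancl_sym[of "g (Suc j)" "g j" ?E] True by simp
  qed
  note reach = this adj_rtrancl_sym[OF this]
  have e: "(a, b) \<in> (adj ?E)\<^sup>*" if "{a, b} = e" for a b
  proof -
    from that j have "a = g j \<and> b = g (Suc j mod i) \<or> a = g (Suc j mod i) \<and> b = g j"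
      by (simp add: doubleton_eq_iff)
    with reach show ?thesis by blast
  qed
  have "adj (edges G) \<subseteq> (adj ?E)\<^sup>*" using e by blast
  then have "(adj (edges G))\<^sup>* \<subseteq> (adj ?E)\<^sup>*" by (rule rtrancl_subset_rtrancl)
  then show ?thesis using assms(1) by (auto simp: connected_graph_def)
qed

text \<open>A shortest path joining the ends of a non-bridge closes up to a cycle.\<close>

lemma non_bridge_in_cycle:
  assumes "simple_graph G" "e \<in> edges G" "connected_graph (delete_edge G e)"
  shows "\<exists>i\<ge>3. \<exists>F \<in> cycle_subgraphs i G. e \<in> edges F"
proof -
  obtain x y where xy: "e = {x, y}" "x \<noteq> y" "x \<in> verts G" "y \<in> verts G"
    using simple_edge_pair[OF assms(1,2)] .
  let ?R = "adj (edges G - {e})"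
  have "(x, y) \<in> ?R\<^sup>*" using assms(3) xy by (auto simp: connected_graph_def)
  then have ex: "\<exists>n. (x, y) \<in> ?R ^^ n" by (simp add: rtrancl_power)
  define n where "n = (LEAST n. (x, y) \<in> ?R ^^ n)"
  have n: "(x, y) \<in> ?R ^^ n" unfolding n_def using ex by (rule LeastI_ex)
  have least: "n \<le> m" if "(x, y) \<in> ?R ^^ m" for m unfolding n_def using that by (rule Least_le)
  obtain g where g: "g 0 = x" "g n = y" "\<And>k. k < n \<Longrightarrow> (g k, g (Suc k)) \<in> ?R"
    using n unfolding relpow_fun_conv by blast
  have seg: "(g a, g b) \<in> ?R ^^ (b - a)" if "a \<le> b" "b \<le> n" for a b
    unfolding relpow_fun_conv using that g(3) by (intro exI[of _ "\<lambda>k. g (a + k)"]) auto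
  \<comment> \<open>A repeated vertex could be cut short, contradicting the minimality of n.\<close>
  have "g a \<noteq> g b" if "a < b" "b \<le> n" for a b
  proof
    assume eq: "g a = g b"
    have "(x, g a) \<in> ?R ^^ a" using seg[of 0 a] that g by simp
    moreover have "(g a, y) \<in> ?R ^^ (n - b)" using seg[of b n] that g eq by simp
    ultimately have "(x, y) \<in> ?R ^^ (a + (n - b))" unfolding relpow_add by blast
    from least[OF this] that show False by simp
  qed
  then have "a = b" if "a \<le> n" "b \<le> n" "g a = g b" for a b
    using that by (metis linorder_neqE_nat)
  then have inj: "inj_on g {..<Suc n}" by (intro inj_onI) (simp add: less_Suc_eq_le)
  \<comment> \<open>The path has n edges, so closing it with e gives a cycle of length
    \<open>Suc n\<close>. For n = 1 the path would consist of the deleted edge e itself.\<close>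
  have "n \<noteq> 0"
  proof
    assume "n = 0"
    then show False using g(1,2) xy(2) by simp
  qed
  moreover have "n \<noteq> 1" using g(3)[of 0] g xy by auto
  ultimately have n2: "3 \<le> Suc n" by simp
  have ce: "cycle_edges (Suc n) g = insert e ((\<lambda>k. {g k, g (Suc k)}) ` {..<n})"
    unfolding cycle_edges_image lessThan_Suc using g xy by (auto simp: insert_commute)
  have "cycle_edges (Suc n) g \<subseteq> edges G" unfolding ce using g(3) assms(2) by auto
  moreover have "g ` {..<Suc n} \<subseteq> \<Union>(cycle_edges (Suc n) g)" by (auto simp: cycle_edges_def)
  moreover have "\<Union>(edges G) \<subseteq> verts G" using assms(1) by (auto simp: simple_graph_def)
  ultimately have "cycle_edges (Suc n) g \<subseteq> edges G" "g ` {..<Suc n} \<subseteq> verts G"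
    by (simp, meson Union_mono subset_trans)
  then have "\<lparr>verts = g ` {..<Suc n}, edges = cycle_edges (Suc n) g\<rparr> \<in> cycle_subgraphs (Suc n) G"
    unfolding cycle_subgraphs_iff[OF assms(1)] using inj by auto
  with n2 show ?thesis using ce by (metis (no_types, lifting) graph.select_convs(2) insertI1)
qed

text \<open>Deleting an edge of a cycle would leave a connected graph with too few edges.\<close>

lemma tree_card_edges_no_cycle:
  assumes "connected_graph G" "simple_graph G" "Suc (card (edges G)) = v G" "3 \<le> i"
  shows "cycle_subgraphs i G = {}"
proof (rule ccontr)
  assume "cycle_subgraphs i G \<noteq> {}"
  then obtain F where F: "F \<in> cycle_subgraphs i G" by blast
  then have "card (edges F) \<noteq> 0" using card_edges_cycle_ge_3[OF assms(4) F] assms(4) by simp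
  then obtain e where e: "e \<in> edges F" by fastforce
  then have "e \<in> edges G" using F by (elim cycle_subgraphsE) auto
  then show False
    using connected_card_edges[OF connected_delete_cycle_edge[OF assms(1) F assms(4) e] simple_delete_edge[OF assms(2)]]
      card_delete_edge[OF assms(2), of e] assms(3) by simp
qed

text \<open>There are more edges than in a spanning tree, and any edge outside such a tree is no
  bridge.\<close>

lemma exists_non_bridge:
  assumes "connected_graph G" "simple_graph G" "v G \<le> card (edges G)"
  obtains e where "e \<in> edges G" "connected_graph (delete_edge G e)"
proof -
  obtain T where T: "T \<subseteq> edges G" "connected_graph \<lparr>verts = verts G, edges = T\<rparr>" "Suc (card T) = v G"
    using exists_spanning_tree[OF assms(1,2)] by blast
  then have "T \<noteq> edges G" using assms(3) by auto
  then obtain e where e: "e \<in> edges G" "e \<notin> T" using T by blast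
  have "connected_graph (delete_edge G e)"
    using T e by (intro connected_mono[OF T(2)]) auto
  with e that show ?thesis by blast
qed

text \<open>With \<open>v G\<close> or more edges some edge is no bridge and therefore lies on a
  cycle. The equivalence replaces acyclicity by an edge count, which is what the tuples of cycles
  can see.\<close>

lemma tree_iff:
  assumes "simple_graph G"
  shows "tree G \<longleftrightarrow> connected_graph G \<and> Suc (card (edges G)) = v G"
proof (intro iffI conjI)
  assume t: "tree G"
  then show conn: "connected_graph G" by (simp add: tree_def)
  have "card (edges G) < v G"
  proof (rule ccontr)
    assume "\<not> ?thesis"
    then obtain e where "e \<in> edges G" "connected_graph (delete_edge G e)"
      using exists_non_bridge[OF conn assms] by auto
    from non_bridge_in_cycle[OF assms this] t show False by (auto simp: tree_def)
  qed
  then show "Suc (card (edges G)) = v G" using connected_card_edges[OF conn assms] by simp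
next
  assume "connected_graph G \<and> Suc (card (edges G)) = v G"
  then show "tree G" using tree_card_edges_no_cycle[OF _ assms] by (auto simp: tree_def)
qed

text \<open>Deleting an edge of the only cycle leaves a tree. Conversely, with as many edges as
  vertices, deleting an edge of any cycle leaves a tree, so no second cycle survives: any two cycles
  contain each other's edges and coincide.\<close>

lemma unicyclic_iff:
  assumes "simple_graph G"
  shows "unicyclic G \<longleftrightarrow> connected_graph G \<and> card (edges G) = v G"
proof (intro iffI conjI)
  assume u: "unicyclic G"
  then show conn: "connected_graph G" by (simp add: unicyclic_def)
  obtain F i where F: "3 \<le> i" "F \<in> cycle_subgraphs i G"
    and uniq: "\<And>F' j. 3 \<le> j \<Longrightarrow> F' \<in> cycle_subgraphs j G \<Longrightarrow> F' = F"
    using u unfolding unicyclic_def by blast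
  have "card (edges F) \<noteq> 0" using card_edges_cycle_ge_3[OF F] F by simp
  then obtain e where e: "e \<in> edges F" by fastforce
  then have eG: "e \<in> edges G" using F by (elim cycle_subgraphsE) auto
  have "tree (delete_edge G e)"
    using connected_delete_cycle_edge[OF conn F(2,1) e] uniq e
    by (auto simp: tree_def cycle_subgraphs_delete_edge)
  then show "card (edges G) = v G"
    using tree_iff[OF simple_delete_edge[OF assms]] card_delete_edge[OF assms eG] by simp
next
  assume "connected_graph G \<and> card (edges G) = v G"
  then have conn: "connected_graph G" and card: "card (edges G) = v G" by auto
  have tree: "cycle_subgraphs j (delete_edge G e) = {}"
    if "e \<in> edges G" "connected_graph (delete_edge G e)" "3 \<le> j" for j e
    using that by (intro tree_card_edges_no_cycle) (auto simp: card_delete_edge card simple_delete_edge assms simp del: delete_edge_simps(2))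
  obtain e where e: "e \<in> edges G" "connected_graph (delete_edge G e)"
    using exists_non_bridge[OF conn assms] card by auto
  obtain F i where F: "3 \<le> i" "F \<in> cycle_subgraphs i G" using non_bridge_in_cycle[OF assms e] by blast
  have sub: "edges F1 \<subseteq> edges F2"
    if F12: "3 \<le> i1" "F1 \<in> cycle_subgraphs i1 G" "3 \<le> i2" "F2 \<in> cycle_subgraphs i2 G" for F1 F2 i1 i2
  proof
    fix h assume h: "h \<in> edges F1"
    then have "h \<in> edges G" using F12 by (elim cycle_subgraphsE) auto
    from tree[OF this connected_delete_cycle_edge[OF conn F12(2,1) h] F12(3)]
    show "h \<in> edges F2" using F12(4) by (auto simp: cycle_subgraphs_delete_edge)
  qed
  have "F' = F" if F': "3 \<le> j" "F' \<in> cycle_subgraphs j G" for F' j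
  proof -
    have "edges F' = edges F" using sub[OF F' F] sub[OF F F'] by simp
    moreover have "verts F' = verts F"
      using calculation Union_edges_cycle[OF F'(2)] Union_edges_cycle[OF F(2)] F F' by simp
    ultimately show ?thesis by simp
  qed
  with F conn show "unicyclic G" unfolding unicyclic_def by blast
qed

subsection \<open>Tuples of cycles\<close>

text \<open>Functions on an index set instead of lists, so that a tuple can be restricted to the
  indices of one connected component.\<close>

definition cycle_tuples :: "'i set \<Rightarrow> ('i \<Rightarrow> nat) \<Rightarrow> 'a graph \<Rightarrow> ('i \<Rightarrow> 'a graph) set" where
  "cycle_tuples I a G = (\<Pi>\<^sub>E j\<in>I. cycle_subgraphs (a j) G)"

definition union_on :: "'i set \<Rightarrow> ('i \<Rightarrow> 'a graph) \<Rightarrow> 'a graph" where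
  "union_on I F = \<lparr>verts = (\<Union>j\<in>I. verts (F j)), edges = (\<Union>j\<in>I. edges (F j))\<rparr>"

definition covering :: "'i set \<Rightarrow> ('i \<Rightarrow> nat) \<Rightarrow> 'a graph \<Rightarrow> ('i \<Rightarrow> 'a graph) set" where
  "covering I a G = {F \<in> cycle_tuples I a G. verts (union_on I F) = verts G}"

definition connecting :: "'i set \<Rightarrow> ('i \<Rightarrow> nat) \<Rightarrow> 'a graph \<Rightarrow> ('i \<Rightarrow> 'a graph) set" where
  "connecting I a G = {F \<in> covering I a G. connected_graph (union_on I F)}"

lemma union_on_simps [simp]:
  "verts (union_on I F) = (\<Union>j\<in>I. verts (F j))" "edges (union_on I F) = (\<Union>j\<in>I. edges (F j))"
  by (simp_all add: union_on_def)

lemma union_on_restrict [simp]: "union_on I (restrict F I) = union_on I F"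
  by (simp add: union_on_def)

lemma finite_cycle_tuples: "finite I \<Longrightarrow> simple_graph G \<Longrightarrow> finite (cycle_tuples I a G)"
  by (auto simp: cycle_tuples_def finite_cycle_subgraphs intro!: finite_PiE)

lemma finite_covering: "finite I \<Longrightarrow> simple_graph G \<Longrightarrow> finite (covering I a G)"
  by (simp add: covering_def finite_cycle_tuples)

lemma finite_connecting: "finite I \<Longrightarrow> simple_graph G \<Longrightarrow> finite (connecting I a G)"
  by (simp add: connecting_def finite_covering)

lemma Union_graph_eq: "Union_graph Fs = union_on {..<length Fs} (\<lambda>j. Fs ! j)"
proof -
  have "set Fs = (\<lambda>j. Fs ! j) ` {..<length Fs}" by (auto simp: set_conv_nth)
  then show ?thesis by (simp add: Union_graph_def union_on_def)
qed

lemma union_on_cong: "(\<And>j. j \<in> I \<Longrightarrow> F j = F' j) \<Longrightarrow> union_on I F = union_on I F'"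
  by (simp add: union_on_def)

lemma con_eq_card_connecting: "con A G = card (connecting {..<length A} (\<lambda>j. A ! j) G)"
proof -
  let ?n = "length A"
  let ?L = "{Fs. length Fs = length A \<and>
     (\<forall>j<length A. is_subgraph (Fs ! j) G \<and> Fs ! j \<simeq> C (A ! j)) \<and>
     verts (Union_graph Fs) = verts G \<and> connected_graph (Union_graph Fs)}"
  let ?R = "connecting {..<length A} (\<lambda>j. A ! j) G"
  have "bij_betw (\<lambda>Fs. restrict (\<lambda>j. Fs ! j) {..<?n}) ?L ?R"
  proof (rule bij_betw_byWitness[where f' = "\<lambda>F. map F [0..<?n]"])
    show "\<forall>Fs\<in>?L. map (restrict (\<lambda>j. Fs ! j) {..<?n}) [0..<?n] = Fs"
      by (auto intro!: nth_equalityI)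
    show "\<forall>F\<in>?R. restrict (\<lambda>j. map F [0..<?n] ! j) {..<?n} = F"
      by (auto simp: connecting_def covering_def cycle_tuples_def PiE_def extensional_def fun_eq_iff)
    show "(\<lambda>Fs. restrict (\<lambda>j. Fs ! j) {..<?n}) ` ?L \<subseteq> ?R"
      by (auto simp: connecting_def covering_def cycle_tuples_def cycle_subgraphs_def Union_graph_eq split: if_splits)
    have [simp]: "union_on {..<?n} ((!) (map F [0..<?n])) = union_on {..<?n} F" for F :: "nat \<Rightarrow> 'a graph"
      by (rule union_on_cong) simp
    show "(\<lambda>F. map F [0..<?n]) ` ?R \<subseteq> ?L"
      by (auto simp: connecting_def covering_def cycle_tuples_def cycle_subgraphs_def Union_graph_eq PiE_iff)
  qed
  then show ?thesis unfolding con_def by (rule bij_betw_same_card)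
qed

section \<open>Covering tuples: Kocay's lemma and the splitting at a component\<close>

lemma cycle_tuples_induced:
  assumes "simple_graph G" "X \<subseteq> verts G"
  shows "cycle_tuples I a (induced G X) = {F \<in> cycle_tuples I a G. (\<Union>j\<in>I. verts (F j)) \<subseteq> X}"
  unfolding cycle_tuples_def cycle_subgraphs_induced[OF assms] by (auto simp: PiE_iff extensional_def)

lemma covering_induced:
  assumes "simple_graph G" "X \<subseteq> verts G"
  shows "covering I a (induced G X) = {F \<in> cycle_tuples I a G. verts (union_on I F) = X}"
  unfolding covering_def cycle_tuples_induced[OF assms] by auto

text \<open>Kocay's lemma: all tuples of cycles are grouped by the vertex set that they
  cover.\<close>

lemma prod_num_cycles:
  assumes "simple_graph G" "finite I"
  shows "(\<Prod>j\<in>I. num_cycles (a j) G) = (\<Sum>X\<in>Pow (verts G). card (covering I a (induced G X)))"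
proof -
  have sub: "(\<lambda>F. verts (union_on I F)) ` cycle_tuples I a G \<subseteq> Pow (verts G)"
    by (auto simp: cycle_tuples_def PiE_iff cycle_subgraphs_def is_subgraph_def; blast)
  have "(\<Prod>j\<in>I. num_cycles (a j) G) = card (cycle_tuples I a G)"
    using assms by (simp add: cycle_tuples_def num_cycles_def card_PiE)
  also have "\<dots> = (\<Sum>X\<in>Pow (verts G). \<Sum>F\<in>{F \<in> cycle_tuples I a G. verts (union_on I F) = X}. 1)"
    by (subst sum.group[OF finite_cycle_tuples[OF assms(2,1)] _ sub]) (use assms in auto)
  also have "\<dots> = (\<Sum>X\<in>Pow (verts G). card (covering I a (induced G X)))"
    by (intro sum.cong refl) (simp add: covering_induced[OF assms(1)])
  finally show ?thesis .
qed

text \<open>A covering tuple is split at the connected component of its \<open>j0\<close>-th member: \<open>X\<close> is the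
  vertex set of that component and \<open>J\<close> the set of indices whose cycles lie in it.\<close>

definition splits_at :: "'i set \<Rightarrow> 'a set \<Rightarrow> ('i \<Rightarrow> 'a graph) \<Rightarrow> 'i set \<Rightarrow> 'a set \<Rightarrow> bool" where
  "splits_at I V F J X \<longleftrightarrow> verts (union_on J F) = X \<and> connected_graph (union_on J F) \<and>
     verts (union_on (I - J) F) = V - X"

text \<open>Members with index outside J stay in V - X, so an edge that meets X cannot belong to one
  of them.\<close>

lemma splits_at_closed:
  assumes s: "splits_at I V F J X" and "j \<in> I" "e \<in> edges (F j)" "y \<in> e" "z \<in> e" "y \<in> X" "\<Union>(edges (F j)) \<subseteq> verts (F j)"
  shows "j \<in> J \<and> z \<in> X"
proof -
  have yz: "y \<in> verts (F j)" "z \<in> verts (F j)" using assms by auto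
  have "j \<in> J"
  proof (rule ccontr)
    assume "j \<notin> J"
    then have "y \<in> verts (union_on (I - J) F)" using assms(2) yz by auto
    then show False using s assms(6) unfolding splits_at_def by blast
  qed
  then show ?thesis using s yz unfolding splits_at_def by auto
qed

text \<open>Every vertex of X is reached from a vertex of the j0-th member along members in J, and
  no such step leaves X'. Used in both directions, this makes X unique.\<close>

lemma splits_at_subset:
  assumes s: "splits_at I V F J X" and s': "splits_at I V F J' X'"
    and J: "J \<subseteq> I" "j0 \<in> J" "j0 \<in> J'"
    and ne: "verts (F j0) \<noteq> {}" and wf: "\<And>j. j \<in> I \<Longrightarrow> \<Union>(edges (F j)) \<subseteq> verts (F j)"
  shows "X \<subseteq> X'"
proof
  fix y assume y: "y \<in> X"
  obtain r where r: "r \<in> verts (F j0)" using ne by blast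
  have "r \<in> verts (union_on J F)" "y \<in> verts (union_on J F)"
    using r J s y by (auto simp: splits_at_def)
  then have "(r, y) \<in> (adj (edges (union_on J F)))\<^sup>*"
    using s unfolding splits_at_def by (blast intro: connectedD)
  then show "y \<in> X'"
  proof (induction rule: rtrancl_induct)
    case base
    show ?case using r J s' by (auto simp: splits_at_def)
  next
    case (step y z)
    then obtain j where "j \<in> J" "{y, z} \<in> edges (F j)" by auto
    then show ?case using splits_at_closed[OF s', of j "{y, z}" y z] step J wf by auto
  qed
qed

text \<open>Members are nonempty, so none fits into both X and V - X. Hence X determines J.\<close>

lemma splits_at_indices:
  assumes s: "splits_at I V F J X" and J: "J \<subseteq> I" and ne: "\<And>j. j \<in> I \<Longrightarrow> verts (F j) \<noteq> {}"
  shows "J = {j \<in> I. verts (F j) \<subseteq> X}"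
proof (intro Set.set_eqI iffI)
  fix j assume "j \<in> {j \<in> I. verts (F j) \<subseteq> X}"
  then have j: "j \<in> I" "verts (F j) \<subseteq> X" by auto
  show "j \<in> J"
  proof (rule ccontr)
    assume "j \<notin> J"
    then have "verts (F j) \<subseteq> V - X" using s j unfolding splits_at_def by auto
    then show False using j ne[OF j(1)] by blast
  qed
qed (use s J in \<open>auto simp: splits_at_def\<close>)

text \<open>X is what can be reached from a vertex r of the j0-th member in the union of all
  members. Each member is connected, so it lies inside X or avoids it.\<close>

lemma splits_at_exists:
  assumes F: "verts (union_on I F) = V" and j0: "j0 \<in> I"
    and ne: "verts (F j0) \<noteq> {}" and wf: "\<And>j. j \<in> I \<Longrightarrow> \<Union>(edges (F j)) \<subseteq> verts (F j)"
    and conn: "\<And>j. j \<in> I \<Longrightarrow> connected_graph (F j)"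
  shows "\<exists>J X. J \<subseteq> I \<and> j0 \<in> J \<and> X \<subseteq> V \<and> splits_at I V F J X"
proof -
  obtain r where r: "r \<in> verts (F j0)" using ne by blast
  let ?E = "edges (union_on I F)"
  define X where "X = {y. (r, y) \<in> (adj ?E)\<^sup>*}"
  define J where "J = {j \<in> I. verts (F j) \<subseteq> X}"
  have J_I: "j \<in> J" if "j \<in> I" "y \<in> verts (F j)" "y \<in> X" for j y
  proof -
    have "z \<in> X" if z: "z \<in> verts (F j)" for z
    proof -
      have "(y, z) \<in> (adj (edges (F j)))\<^sup>*" using conn[OF \<open>j \<in> I\<close>] \<open>y \<in> verts (F j)\<close> z by (rule connectedD)
      then have "(y, z) \<in> (adj ?E)\<^sup>*" by (rule adj_rtrancl_mono) (use \<open>j \<in> I\<close> in auto)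
      with \<open>y \<in> X\<close> show ?thesis unfolding X_def by (simp add: rtrancl_trans[of r y _ z])
    qed
    then show ?thesis using that(1) by (auto simp: J_def)
  qed
  have r_X: "r \<in> X" by (simp add: X_def)
  have j0_J: "j0 \<in> J" using J_I[OF j0 r r_X] .
  \<comment> \<open>A path from r in the union of all members uses only members in J, because each
    of its edges starts at a vertex of X.\<close>
  have reach: "(r, y) \<in> (adj (edges (union_on J F)))\<^sup>* \<and> y \<in> verts (union_on J F)" if "y \<in> X" for y
  proof -
    from that have "(r, y) \<in> (adj ?E)\<^sup>*" by (simp add: X_def)
    then show ?thesis
    proof (induction rule: rtrancl_induct)
      case base
      then show ?case using r j0_J by auto
    next
      case (step y z)
      then obtain j where j: "j \<in> I" "{y, z} \<in> edges (F j)" by auto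
      have yz: "y \<in> verts (F j)" "z \<in> verts (F j)" using wf[OF j(1)] j(2) by auto
      have "y \<in> X" using step(1) by (simp add: X_def)
      then have "j \<in> J" using J_I[OF j(1) yz(1)] by simp
      then have "(y, z) \<in> adj (edges (union_on J F))" "z \<in> verts (union_on J F)" using j yz by auto
      with step(3) show ?case by (simp add: rtrancl_into_rtrancl[of r y])
    qed
  qed
  have vJ: "verts (union_on J F) = X"
  proof
    show "verts (union_on J F) \<subseteq> X" by (auto simp: J_def)
    show "X \<subseteq> verts (union_on J F)" using reach by blast
  qed
  have "connected_graph (union_on J F)"
  proof (rule connectedI[of r])
    show "r \<in> verts (union_on J F)" using r_X vJ by simp
    show "(r, y) \<in> (adj (edges (union_on J F)))\<^sup>*" if "y \<in> verts (union_on J F)" for y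
      using reach[of y] that vJ by blast
  qed
  moreover have "verts (union_on (I - J) F) = V - X"
  proof
    show "verts (union_on (I - J) F) \<subseteq> V - X" using J_I F by auto
    show "V - X \<subseteq> verts (union_on (I - J) F)" using F vJ by auto
  qed
  ultimately have "splits_at I V F J X" using vJ by (simp add: splits_at_def)
  moreover have J: "J \<subseteq> I" by (auto simp: J_def)
  moreover have "X \<subseteq> V" unfolding vJ[symmetric] F[symmetric] using J by auto
  ultimately show ?thesis using j0_J by blast
qed

text \<open>Restricting to J and to I - J is inverted by gluing, so the two parts are independent:
  the first has to connect X, the second only to cover the remaining vertices.\<close>

lemma card_splits_at:
  fixes I :: "'i set" and G :: "'a graph"
  assumes G: "simple_graph G" and J: "J \<subseteq> I" and X: "X \<subseteq> verts G"
  shows "card {F \<in> covering I a G. splits_at I (verts G) F J X} =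
    card (connecting J a (induced G X)) * card (covering (I - J) a (induced G (verts G - X)))"
proof -
  let ?V = "verts G"
  let ?A = "{F \<in> covering I a G. splits_at I ?V F J X}"
  let ?B1 = "{F \<in> cycle_tuples J a G. verts (union_on J F) = X \<and> connected_graph (union_on J F)}"
  let ?B2 = "{F \<in> cycle_tuples (I - J) a G. verts (union_on (I - J) F) = ?V - X}"
  let ?split = "\<lambda>F. (restrict F J, restrict F (I - J))"
  let ?merge = "\<lambda>(F, F'). \<lambda>j. if j \<in> J then F j else F' j"
  have "bij_betw ?split ?A (?B1 \<times> ?B2)"
  proof (rule bij_betw_byWitness[where f' = ?merge])
    show "\<forall>F\<in>?A. ?merge (?split F) = F"
    proof
      fix F assume "F \<in> ?A"
      then have "F \<in> extensional I" by (simp add: covering_def cycle_tuples_def PiE_def)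
      then show "?merge (?split F) = F" using J by (auto simp: extensional_def fun_eq_iff)
    qed
    show "\<forall>FF\<in>?B1 \<times> ?B2. ?split (?merge FF) = FF"
    proof clarify
      fix F F' assume "F \<in> cycle_tuples J a G" "F' \<in> cycle_tuples (I - J) a G"
      then have "F \<in> extensional J" "F' \<in> extensional (I - J)" by (simp_all add: cycle_tuples_def PiE_def)
      then show "restrict (\<lambda>j. if j \<in> J then F j else F' j) J = F \<and>
          restrict (\<lambda>j. if j \<in> J then F j else F' j) (I - J) = F'"
        by (auto simp: extensional_def fun_eq_iff)
    qed
    show "?split ` ?A \<subseteq> ?B1 \<times> ?B2"
    proof (rule image_subsetI)
      fix F assume F: "F \<in> ?A"
      then have "F \<in> cycle_tuples I a G" by (simp add: covering_def)
      then have "restrict F J \<in> cycle_tuples J a G" "restrict F (I - J) \<in> cycle_tuples (I - J) a G"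
        using J by (auto simp: cycle_tuples_def)
      then show "?split F \<in> ?B1 \<times> ?B2"
        using F unfolding splits_at_def by (simp only: union_on_restrict mem_Collect_eq mem_Times_iff fst_conv snd_conv)
    qed
    show "?merge ` (?B1 \<times> ?B2) \<subseteq> ?A"
    proof (rule image_subsetI)
      fix FF assume "FF \<in> ?B1 \<times> ?B2"
      then obtain F F' where FF: "FF = (F, F')" and F: "F \<in> ?B1" and F': "F' \<in> ?B2" by blast
      let ?H = "?merge (F, F')"
      have u: "union_on J ?H = union_on J F" "union_on (I - J) ?H = union_on (I - J) F'"
        by (auto intro: union_on_cong)
      have s: "splits_at I ?V ?H J X" unfolding splits_at_def u using F F' by blast
      have "verts (union_on I H) = verts (union_on J H) \<union> verts (union_on (I - J) H)" for H :: "'i \<Rightarrow> 'a graph"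
        using J by auto
      then have "verts (union_on I ?H) = verts (union_on J ?H) \<union> verts (union_on (I - J) ?H)" .
      also have "\<dots> = X \<union> (?V - X)" unfolding u using F F' by blast
      finally have "verts (union_on I ?H) = ?V" using X by blast
      moreover have "?H \<in> cycle_tuples I a G"
        using F F' J unfolding cycle_tuples_def PiE_iff extensional_def by auto
      ultimately show "?merge FF \<in> ?A" using s unfolding FF covering_def by blast
    qed
  qed
  from bij_betw_same_card[OF this] have "card ?A = card ?B1 * card ?B2"
    by (simp only: card_cartesian_product)
  moreover have "?B1 = connecting J a (induced G X)"
    unfolding connecting_def covering_induced[OF G X] by blast
  moreover have "?B2 = covering (I - J) a (induced G (?V - X))"
    by (rule covering_induced[OF G, symmetric]) blast
  ultimately show ?thesis by simp
qed

text \<open>Every covering tuple splits in exactly one way; pairs of a tuple and a split are counted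
  twice over.\<close>

lemma card_covering_split:
  assumes G: "simple_graph G" and I: "finite I" "j0 \<in> I" and a: "\<And>j. j \<in> I \<Longrightarrow> 2 \<le> a j"
  shows "card (covering I a G) = (\<Sum>J | J \<subseteq> I \<and> j0 \<in> J. \<Sum>X\<in>Pow (verts G).
    card (connecting J a (induced G X)) * card (covering (I - J) a (induced G (verts G - X))))"
proof -
  let ?V = "verts G"
  let ?S = "{J. J \<subseteq> I \<and> j0 \<in> J} \<times> Pow ?V"
  let ?R = "\<lambda>(J, X) F. splits_at I ?V F J X"
  have F_D: "F j \<in> cycle_subgraphs (a j) G" if "F \<in> covering I a G" "j \<in> I" for F j
    using that by (auto simp: covering_def cycle_tuples_def PiE_iff)
  have ne: "verts (F j) \<noteq> {}" if "F \<in> covering I a G" "j \<in> I" for F j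
    using card_verts_cycle[OF F_D[OF that]] a[OF that(2)] by auto
  have wf: "\<Union>(edges (F j)) \<subseteq> verts (F j)" if "F \<in> covering I a G" "j \<in> I" for F j
    using Union_edges_cycle[OF F_D[OF that] a[OF that(2)]] by simp
  have conn: "connected_graph (F j)" if "F \<in> covering I a G" "j \<in> I" for F j
    using connected_cycle[OF F_D[OF that]] a[OF that(2)] by simp
  have one: "card {JX \<in> ?S. ?R JX F} = 1" if F: "F \<in> covering I a G" for F
  proof -
    have "verts (union_on I F) = ?V" using F by (simp add: covering_def)
    from splits_at_exists[OF this I(2) ne[OF F I(2)] wf[OF F] conn[OF F]]
    obtain J X where JX: "J \<subseteq> I" "j0 \<in> J" "X \<subseteq> ?V" "splits_at I ?V F J X" by blast
    have "J' = J \<and> X' = X" if "J' \<subseteq> I" "j0 \<in> J'" "splits_at I ?V F J' X'" for J' X'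
    proof -
      have "X' = X"
        using splits_at_subset[OF that(3) JX(4) that(1,2) JX(2) ne[OF F I(2)] wf[OF F]]
          splits_at_subset[OF JX(4) that(3) JX(1,2) that(2) ne[OF F I(2)] wf[OF F]] by auto
      moreover have "J = {j \<in> I. verts (F j) \<subseteq> X}" by (rule splits_at_indices[OF JX(4,1) ne[OF F]])
      moreover have "J' = {j \<in> I. verts (F j) \<subseteq> X'}" by (rule splits_at_indices[OF that(3,1) ne[OF F]])
      ultimately show ?thesis by simp
    qed
    then have "{JX \<in> ?S. ?R JX F} = {(J, X)}" using JX by blast
    then show ?thesis by simp
  qed
  have fiber: "card {F \<in> covering I a G. splits_at I ?V F J X} =
      card (connecting J a (induced G X)) * card (covering (I - J) a (induced G (?V - X)))"
    if "J \<subseteq> I" "X \<subseteq> ?V" for J X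
    using G that by (rule card_splits_at)
  have fin: "finite ?S" "finite (covering I a G)" using I G by (auto simp: finite_covering)
  have "card (covering I a G) = (\<Sum>JX\<in>?S. card {F \<in> covering I a G. ?R JX F})"
    using sum_multicount[OF fin, of ?R 1] one by auto
  also have "\<dots> = (\<Sum>(J, X)\<in>?S. card (connecting J a (induced G X)) * card (covering (I - J) a (induced G (?V - X))))"
    by (intro sum.cong refl) (auto simp: fiber)
  finally show ?thesis by (simp add: sum.cartesian_product)
qed

lemma covering_empty: "card (covering {} a G) = (if verts G = {} then 1 else 0)"
  by (auto simp: covering_def cycle_tuples_def)

text \<open>This kills the terms in which the component takes up all vertices although indices are
  left over.\<close>

lemma covering_no_verts:
  assumes "I \<noteq> {}" "\<And>j. j \<in> I \<Longrightarrow> 2 \<le> a j" "verts G = {}"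
  shows "covering I a G = {}"
proof (rule ccontr)
  assume "covering I a G \<noteq> {}"
  then obtain F where F: "F \<in> covering I a G" by blast
  obtain j where j: "j \<in> I" using assms(1) by blast
  have "F j \<in> cycle_subgraphs (a j) G" using F j by (auto simp: covering_def cycle_tuples_def PiE_iff)
  from card_verts_cycle[OF this] have "verts (F j) \<noteq> {}" using assms(2)[OF j] by auto
  then show False using F j assms(3) by (auto simp: covering_def)
qed

subsection \<open>A cycle inside a connected spanning subgraph\<close>

text \<open>The number of ordered choices of k elements, repetition allowed, that together with b
  given elements exhaust a set of size m. For b = 0 these are the surjections. In the application
  the given elements are the edges of a cycle.\<close>

definition cover_count :: "nat \<Rightarrow> nat \<Rightarrow> nat \<Rightarrow> nat" where
  "cover_count k m b = card {h \<in> {..<k} \<rightarrow>\<^sub>E {..<m}. {..<b} \<union> h ` {..<k} = {..<m}}"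

lemma cover_count_eq:
  assumes E: "finite E" and B: "B \<subseteq> E"
  shows "card {h \<in> {..<k} \<rightarrow>\<^sub>E E. B \<union> h ` {..<k} = E} = cover_count k (card E) (card B)"
proof -
  let ?m = "card E" and ?b = "card B"
  have "card {..<?b} = ?b" "card {?b..<?m} = card (E - B)" "finite B"
    using E B by (auto simp: card_Diff_subset finite_subset)
  obtain f1 where f1': "bij_betw f1 {..<?b} B"
    using finite_same_card_bij[of "{..<?b}" B] \<open>finite B\<close> by auto
  obtain f2 where f2': "bij_betw f2 {?b..<?m} (E - B)"
    using finite_same_card_bij[of "{?b..<?m}" "E - B"] \<open>card {?b..<?m} = card (E - B)\<close> E by auto
  \<comment> \<open>This enumerates E with the elements of B first, so that B becomes an initial
    segment.\<close>
  define f where "f = (\<lambda>j. if j < ?b then f1 j else f2 j)"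
  have f1: "bij_betw f {..<?b} B"
    using f1' by (rule iffD1[OF bij_betw_cong, rotated]) (simp add: f_def)
  have f2: "bij_betw f {?b..<?m} (E - B)"
    using f2' by (rule iffD1[OF bij_betw_cong, rotated]) (simp add: f_def)
  have "?b \<le> ?m" using E B by (rule card_mono)
  then have "bij_betw f ({..<?b} \<union> {?b..<?m}) (B \<union> (E - B))"
    using f1 f2 by (intro bij_betw_combine) auto
  moreover have "{..<?b} \<union> {?b..<?m} = {..<?m}" using \<open>?b \<le> ?m\<close> by auto
  moreover have "B \<union> (E - B) = E" using B by auto
  ultimately have f: "bij_betw f {..<?m} E" by simp
  have fB: "f ` {..<?b} = B" using f1 by (simp add: bij_betw_def)
  define g where "g = inv_into {..<?m} f"
  have g: "bij_betw g E {..<?m}" using f by (simp add: g_def bij_betw_inv_into)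
  have gf: "g (f j) = j" if "j < ?m" for j using f that by (simp add: g_def bij_betw_inv_into_left)
  have fg: "f (g e) = e" if "e \<in> E" for e using f that by (simp add: g_def bij_betw_inv_into_right)
  have gB: "g ` B = {..<?b}"
  proof -
    have "g (f j) = j" if "j \<in> {..<?b}" for j using gf[of j] that \<open>?b \<le> ?m\<close> by simp
    then have "g ` f ` {..<?b} = {..<?b}" by (simp add: image_image)
    then show ?thesis by (simp add: fB)
  qed
  let ?A = "{h \<in> {..<k} \<rightarrow>\<^sub>E {..<?m}. {..<?b} \<union> h ` {..<k} = {..<?m}}"
  let ?D = "{h \<in> {..<k} \<rightarrow>\<^sub>E E. B \<union> h ` {..<k} = E}"
  have "bij_betw (\<lambda>h. restrict (\<lambda>j. f (h j)) {..<k}) ?A ?D"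
  proof (rule bij_betw_byWitness[where f' = "\<lambda>h. restrict (\<lambda>j. g (h j)) {..<k}"])
    show "\<forall>h\<in>?A. restrict (\<lambda>j. g (restrict (\<lambda>j. f (h j)) {..<k} j)) {..<k} = h"
      using gf by (auto simp: PiE_iff extensional_def fun_eq_iff)
    show "\<forall>h\<in>?D. restrict (\<lambda>j. f (restrict (\<lambda>j. g (h j)) {..<k} j)) {..<k} = h"
      using fg by (auto simp: PiE_iff extensional_def fun_eq_iff)
    show "(\<lambda>h. restrict (\<lambda>j. f (h j)) {..<k}) ` ?A \<subseteq> ?D"
    proof (rule image_subsetI)
      fix h assume h: "h \<in> ?A"
      let ?h = "restrict (\<lambda>j. f (h j)) {..<k}"
      have "B \<union> ?h ` {..<k} = f ` ({..<?b} \<union> h ` {..<k})" by (simp add: fB image_Un image_image)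
      also have "\<dots> = E" using h f by (simp add: bij_betw_def)
      finally show "?h \<in> ?D" using h f by (auto simp: bij_betw_def)
    qed
    show "(\<lambda>h. restrict (\<lambda>j. g (h j)) {..<k}) ` ?D \<subseteq> ?A"
    proof (rule image_subsetI)
      fix h assume h: "h \<in> ?D"
      let ?h = "restrict (\<lambda>j. g (h j)) {..<k}"
      have "{..<?b} \<union> ?h ` {..<k} = g ` (B \<union> h ` {..<k})" by (simp add: gB image_Un image_image)
      also have "\<dots> = {..<?m}" using h g by (simp add: bij_betw_def)
      finally have *: "{..<?b} \<union> ?h ` {..<k} = {..<?m}" .
      then have "?h \<in> {..<k} \<rightarrow>\<^sub>E {..<?m}" by (intro restrict_PiE_iff[THEN iffD2]) auto
      with * show "?h \<in> ?A" by blast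
    qed
  qed
  from bij_betw_same_card[OF this] show ?thesis by (simp add: cover_count_def)
qed

text \<open>Each of the k missing elements can be chosen exactly once. This is the diagonal
  coefficient of the triangular system, and its being nonzero makes the system solvable.\<close>

lemma cover_count_pos: "cover_count k (b + k) b \<noteq> 0"
proof -
  let ?h = "restrict (\<lambda>j. b + j) {..<k}"
  let ?A = "{h \<in> {..<k} \<rightarrow>\<^sub>E {..<b + k}. {..<b} \<union> h ` {..<k} = {..<b + k}}"
  have "?h ` {..<k} = (+) b ` {0..<k}" by (auto simp: image_def)
  also have "\<dots> = {b..<b + k}" by (simp add: image_add_atLeastLessThan add.commute)
  finally have img: "?h ` {..<k} = {b..<b + k}" .
  have "{..<b} \<union> {b..<b + k} = {..<b + k}" by (rule ivl_disj_un_one(2)) simp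
  moreover have "?h \<in> {..<k} \<rightarrow>\<^sub>E {..<b + k}" by (simp add: restrict_PiE_iff)
  ultimately have "?h \<in> ?A" unfolding mem_Collect_eq img by (rule conjI[rotated])
  moreover have "finite ?A"
    by (rule finite_subset[of _ "{..<k} \<rightarrow>\<^sub>E {..<b + k}"]) (blast, simp add: finite_PiE)
  ultimately show ?thesis unfolding cover_count_def card_eq_0_iff by blast
qed

definition cycle_pairs :: "nat \<Rightarrow> nat \<Rightarrow> 'a graph \<Rightarrow> ('a graph \<times> 'a graph) set" where
  "cycle_pairs i m G = {(F, H). is_subgraph H G \<and> verts H = verts G \<and> connected_graph H \<and>
     card (edges H) = m \<and> F \<in> cycle_subgraphs i H}"

lemma finite_cycle_pairs: "simple_graph G \<Longrightarrow> finite (cycle_pairs i m G)"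
  by (rule finite_subset[of _ "{F. is_subgraph F G} \<times> {F. is_subgraph F G}"])
    (auto simp: cycle_pairs_def cycle_subgraphs_def is_subgraph_def finite_subgraphs[unfolded is_subgraph_def])

text \<open>The index set \<open>insert None (Some ` {..<k})\<close> with this length function stands for the
  sequence consisting of \<open>i\<close> followed by \<open>k\<close> entries \<open>2\<close>.\<close>

definition with_edges :: "nat \<Rightarrow> nat option \<Rightarrow> nat" where
  "with_edges i = case_option i (\<lambda>_. 2)"

abbreviation edge_index :: "nat \<Rightarrow> nat option set" where
  "edge_index k \<equiv> insert None (Some ` {..<k})"

text \<open>Once the cycle F and the union H are fixed, what remains is to choose k edges of H that
  exhaust H together with F; covering and connectedness are properties of H.\<close>

lemma card_connecting_fiber:
  fixes G :: "'a graph"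
  assumes G: "simple_graph G" and i: "2 \<le> i" and P: "(F, H) \<in> cycle_pairs i m G"
  shows "card {T \<in> connecting (edge_index k) (with_edges i) G.
     (T None, union_on (edge_index k) T) = (F, H)} = cover_count k m (cycle_size i)"
proof -
  let ?I = "edge_index k"
  have H: "is_subgraph H G" "verts H = verts G" "connected_graph H" "card (edges H) = m"
    and F: "F \<in> cycle_subgraphs i H" using P by (auto simp: cycle_pairs_def)
  have sH: "simple_graph H" using H by (simp add: is_subgraph_def)
  have fin: "finite (edges H)" using sH by (rule simple_finite_edges)
  have FH: "edges F \<subseteq> edges H" "verts F \<subseteq> verts H" using F by (auto simp: cycle_subgraphs_def is_subgraph_def)
  have FG: "F \<in> cycle_subgraphs i G" using F H by (auto simp: cycle_subgraphs_def is_subgraph_def)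
  have "2 \<le> v H" using card_verts_cycle[OF F] i card_mono[OF simple_finite[OF sH] FH(2)] by (simp add: v_def)
  then have UH: "\<Union>(edges H) = verts H" using H sH by (intro connected_Union_edges) auto
  let ?eg = "\<lambda>e. \<lparr>verts = e, edges = {e}\<rparr> :: 'a graph"
  let ?A = "{h \<in> {..<k} \<rightarrow>\<^sub>E edges H. edges F \<union> h ` {..<k} = edges H}"
  let ?D = "{T \<in> connecting ?I (with_edges i) G. (T None, union_on ?I T) = (F, H)}"
  \<comment> \<open>Tuples are extensional, hence the value \<open>undefined\<close> off the index
    set.\<close>
  let ?to = "\<lambda>h x. case x of None \<Rightarrow> F | Some j \<Rightarrow> if j < k then ?eg (h j) else undefined"
  let ?from = "\<lambda>T. restrict (\<lambda>j. verts (T (Some j))) {..<k}"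
  have T_Some: "\<exists>e\<in>edges G. T (Some j) = ?eg e" if "T \<in> ?D" "j < k" for T j
  proof -
    have "T (Some j) \<in> cycle_subgraphs 2 G"
      using that unfolding connecting_def covering_def cycle_tuples_def PiE_iff
      by (force simp: with_edges_def)
    then show ?thesis unfolding cycle_subgraphs_2[OF G] by blast
  qed
  have "bij_betw ?to ?A ?D"
  proof (rule bij_betw_byWitness[where f' = ?from])
    show "\<forall>h\<in>?A. ?from (?to h) = h"
      by (auto simp: PiE_iff extensional_def fun_eq_iff)
    show "\<forall>T\<in>?D. ?to (?from T) = T"
    proof
      fix T assume T: "T \<in> ?D"
      have ext: "T \<in> extensional ?I" using T by (auto simp: connecting_def covering_def cycle_tuples_def PiE_def)
      show "?to (?from T) = T"
      proof
        fix x show "?to (?from T) x = T x"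
        proof (cases x)
          case None
          then show ?thesis using T by auto
        next
          case (Some j)
          show ?thesis
          proof (cases "j < k")
            case True
            then show ?thesis using T_Some[OF T True] Some by auto
          next
            case False
            then have "x \<notin> ?I" using Some by auto
            then show ?thesis using ext False Some by (simp add: extensional_def)
          qed
        qed
      qed
    qed
    show "?to ` ?A \<subseteq> ?D"
    proof (rule image_subsetI)
      fix h assume h: "h \<in> ?A"
      then have hH: "h j \<in> edges H" if "j < k" for j using that by auto
      have "(\<Union>x\<in>?I. edges (?to h x)) = edges F \<union> h ` {..<k}" by auto
      also have "\<dots> = edges H" using h by blast
      finally have e: "(\<Union>x\<in>?I. edges (?to h x)) = edges H" .
      have "(\<Union>x\<in>?I. verts (?to h x)) = verts F \<union> \<Union>(h ` {..<k})" by auto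
      also have "\<dots> = \<Union>(edges F \<union> h ` {..<k})" using Union_edges_cycle[OF F i] by auto
      also have "\<dots> = \<Union>(edges H)" using h by blast
      finally have vv: "(\<Union>x\<in>?I. verts (?to h x)) = verts H" using UH by simp
      have u: "union_on ?I (?to h) = H" unfolding union_on_def e vv by simp
      have "?to h x \<in> cycle_subgraphs (with_edges i x) G" if "x \<in> ?I" for x
      proof (cases x)
        case (Some j)
        then have "j < k" using that by auto
        then have "h j \<in> edges G" using hH[of j] H(1) by (auto simp: is_subgraph_def)
        then show ?thesis using Some \<open>j < k\<close> unfolding with_edges_def by (simp add: cycle_subgraphs_2[OF G])
      qed (simp add: FG with_edges_def)
      then have "?to h \<in> cycle_tuples ?I (with_edges i) G"
        unfolding cycle_tuples_def PiE_iff extensional_def by (auto split: option.splits)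
      moreover have "verts (union_on ?I (?to h)) = verts G" "connected_graph (union_on ?I (?to h))"
        unfolding u by (rule H(2), rule H(3))
      ultimately have "?to h \<in> connecting ?I (with_edges i) G"
        unfolding connecting_def covering_def by blast
      moreover have "(?to h None, union_on ?I (?to h)) = (F, H)" unfolding u by simp
      ultimately show "?to h \<in> ?D" by blast
    qed
    show "?from ` ?D \<subseteq> ?A"
    proof (rule image_subsetI)
      fix T assume T: "T \<in> ?D"
      then have u: "edges (union_on ?I T) = edges H" and TF: "T None = F" by auto
      have "edges (T (Some j)) = {?from T j}" if "j < k" for j using T_Some[OF T that] that by auto
      then have "edges H = edges F \<union> ?from T ` {..<k}" unfolding u[symmetric] using TF by auto
      then show "?from T \<in> ?A" by auto
    qed
  qed
  from bij_betw_same_card[OF this] have "card ?D = card ?A" by (rule sym)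
  also have "\<dots> = cover_count k (card (edges H)) (card (edges F))" by (rule cover_count_eq[OF fin FH(1)])
  finally show ?thesis using H card_edges_cycle[OF F i] by simp
qed

text \<open>Tuples are grouped by their cycle and their union. The union has at least the edges of
  the cycle and at most k more, whence the range of m, and all pairs with the same m have equally
  many tuples.\<close>

lemma card_connecting_with_edges:
  fixes G :: "'a graph"
  assumes G: "simple_graph G" and i: "2 \<le> i"
  shows "card (connecting (edge_index k) (with_edges i) G) =
    (\<Sum>m\<in>{cycle_size i..cycle_size i + k}. cover_count k m (cycle_size i) * card (cycle_pairs i m G))"
proof -
  let ?I = "edge_index k" and ?b = "cycle_size i"
  let ?M = "{?b..?b + k}"
  let ?K = "connecting ?I (with_edges i) G"
  let ?g = "\<lambda>T. (T None, union_on ?I T)"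
  let ?P = "\<Union>m\<in>?M. cycle_pairs i m G"
  have finP: "finite ?P" by (rule finite_UN_I) (simp_all add: finite_cycle_pairs[OF G])
  have finK: "finite ?K" by (rule finite_connecting[OF _ G]) simp
  have sub: "?g ` ?K \<subseteq> ?P"
  proof (rule image_subsetI)
    fix T assume T: "T \<in> ?K"
    let ?H = "union_on ?I T"
    have tup: "T x \<in> cycle_subgraphs (with_edges i x) G" if "x \<in> ?I" for x
    proof -
      have "T \<in> cycle_tuples ?I (with_edges i) G" using T by (simp add: connecting_def covering_def)
      then show ?thesis unfolding cycle_tuples_def using that by (rule PiE_mem)
    qed
    have vH: "verts ?H = verts G" and conn: "connected_graph ?H" using T by (auto simp: connecting_def covering_def)
    have sub: "edges ?H \<subseteq> edges G" using tup by (auto simp: cycle_subgraphs_def is_subgraph_def)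
    have sH: "simple_graph ?H" unfolding simple_graph_def vH
    proof (intro conjI ballI)
      show "finite (verts G)" using G by simp
      fix e assume "e \<in> edges ?H"
      then have "e \<in> edges G" using sub by (rule subsetD[rotated])
      then show "e \<subseteq> verts G" "card e = 2" using G by (auto simp: simple_graph_def)
    qed
    have "T None \<in> cycle_subgraphs i G" using tup[of None] by (simp add: with_edges_def)
    then have F: "T None \<in> cycle_subgraphs i ?H"
      by (auto simp: cycle_subgraphs_def is_subgraph_def)
    have "edges (T (Some j)) = {verts (T (Some j))}" if "j < k" for j
    proof -
      have "T (Some j) \<in> cycle_subgraphs 2 G" using tup[of "Some j"] that by (simp add: with_edges_def)
      then show ?thesis unfolding cycle_subgraphs_2[OF G] by auto
    qed
    then have e: "edges ?H = edges (T None) \<union> (\<lambda>j. verts (T (Some j))) ` {..<k}" by auto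
    have "card (edges ?H) \<le> card (edges (T None)) + card ((\<lambda>j. verts (T (Some j))) ` {..<k})"
      unfolding e by (rule card_Un_le)
    moreover have "card ((\<lambda>j. verts (T (Some j))) ` {..<k}) \<le> k"
      using card_image_le[of "{..<k}" "\<lambda>j. verts (T (Some j))"] by simp
    moreover have "card (edges (T None)) = ?b" by (rule card_edges_cycle[OF F i])
    moreover have "card (edges (T None)) \<le> card (edges ?H)"
      by (rule card_mono[OF simple_finite_edges[OF sH]]) (unfold e, rule Un_upper1)
    ultimately have "card (edges ?H) \<in> ?M" by simp
    moreover have "?g T \<in> cycle_pairs i (card (edges ?H)) G"
      using F conn vH sub sH by (simp add: cycle_pairs_def is_subgraph_def del: union_on_simps)
    ultimately show "?g T \<in> ?P" by blast
  qed
  have "card ?K = (\<Sum>T\<in>?K. 1)" by (rule card_eq_sum)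
  also have "\<dots> = (\<Sum>p\<in>?P. \<Sum>T\<in>{T \<in> ?K. ?g T = p}. 1)"
    by (rule sum.group[OF finK finP sub, symmetric])
  also have "\<dots> = (\<Sum>p\<in>?P. card {T \<in> ?K. ?g T = p})"
    by (rule sum.cong[OF refl card_eq_sum[symmetric]])
  also have "\<dots> = (\<Sum>m\<in>?M. \<Sum>p\<in>cycle_pairs i m G. card {T \<in> ?K. ?g T = p})"
  proof (rule sum.UNION_disjoint)
    show "\<forall>m\<in>?M. \<forall>m'\<in>?M. m \<noteq> m' \<longrightarrow> cycle_pairs i m G \<inter> cycle_pairs i m' G = {}"
      unfolding cycle_pairs_def by blast
  qed (simp_all add: finite_cycle_pairs[OF G])
  also have "\<dots> = (\<Sum>m\<in>?M. \<Sum>p\<in>cycle_pairs i m G. cover_count k m ?b)"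
  proof (intro sum.cong refl)
    fix m p assume "p \<in> cycle_pairs i m G"
    then show "card {T \<in> ?K. ?g T = p} = cover_count k m ?b"
      using card_connecting_fiber[OF G i, of "fst p" "snd p" m k] by simp
  qed
  finally show ?thesis by (simp add: mult.commute)
qed

section \<open>Connected spanning subgraphs by number of edges\<close>

definition spanning_connected :: "nat \<Rightarrow> 'a graph \<Rightarrow> 'a graph set" where
  "spanning_connected m G = {H. is_subgraph H G \<and> verts H = verts G \<and> connected_graph H \<and> card (edges H) = m}"

lemma finite_spanning_connected: "simple_graph G \<Longrightarrow> finite (spanning_connected m G)"
  by (rule finite_subset[OF _ finite_subgraphs]) (auto simp: spanning_connected_def)

lemma card_cycle_pairs:
  assumes "simple_graph G"
  shows "card (cycle_pairs i m G) = (\<Sum>H\<in>spanning_connected m G. card (cycle_subgraphs i H))"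
proof -
  have "cycle_pairs i m G = (\<lambda>(H, F). (F, H)) ` (SIGMA H:spanning_connected m G. cycle_subgraphs i H)"
    by (auto simp: cycle_pairs_def spanning_connected_def)
  moreover have "inj_on (\<lambda>(H, F). (F, H)) (SIGMA H:spanning_connected m G. cycle_subgraphs i H)"
    by (auto simp: inj_on_def)
  moreover have "finite (cycle_subgraphs i H)" if "H \<in> spanning_connected m G" for H
    using that by (intro finite_cycle_subgraphs) (auto simp: spanning_connected_def is_subgraph_def)
  ultimately show ?thesis
    using finite_spanning_connected[OF assms] by (simp add: card_image)
qed

text \<open>A cycle of length 2 is an edge, so each subgraph is counted once for each of its m
  edges. Dividing by m counts the subgraphs without any knowledge of longer cycles.\<close>

lemma card_cycle_pairs_2:
  assumes "simple_graph G"
  shows "card (cycle_pairs 2 m G) = m * card (spanning_connected m G)"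
proof -
  have "card (cycle_subgraphs 2 H) = m" if "H \<in> spanning_connected m G" for H
  proof -
    have H: "simple_graph H" "card (edges H) = m" using that by (simp_all add: spanning_connected_def is_subgraph_def)
    have "inj_on (\<lambda>e. \<lparr>verts = e, edges = {e}\<rparr>) (edges H)" by (simp add: inj_on_def)
    then show ?thesis unfolding cycle_subgraphs_2[OF H(1)] H(2)[symmetric] by (rule card_image)
  qed
  then show ?thesis unfolding card_cycle_pairs[OF assms] by simp
qed

lemma card_all_cycles:
  assumes "simple_graph H" "connected_graph H" "card (edges H) = v H"
  shows "(\<Sum>i = 3..v H. card (cycle_subgraphs i H)) = 1"
proof -
  have "unicyclic H" using unicyclic_iff assms by blast
  then obtain F i where F: "3 \<le> i" "F \<in> cycle_subgraphs i H"
    and uniq: "\<And>F' j. 3 \<le> j \<Longrightarrow> F' \<in> cycle_subgraphs j H \<Longrightarrow> F' = F"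
    unfolding unicyclic_def by blast
  have "i \<le> v H" using cycle_subgraphs_empty[OF assms(1), of i] F(2) by (metis empty_iff not_le)
  have "cycle_subgraphs j H = (if j = i then {F} else {})" if "3 \<le> j" for j
  proof -
    have "j = i" if "F \<in> cycle_subgraphs j H" using card_verts_cycle[OF that] card_verts_cycle[OF F(2)] by simp
    then have "F' \<in> cycle_subgraphs j H \<longleftrightarrow> j = i \<and> F' = F" for F' using uniq[OF that, of F'] F(2) by blast
    then show ?thesis by (cases "j = i") (simp_all add: Set.set_eq_iff)
  qed
  then have *: "card (cycle_subgraphs j H) = (if j = i then 1 else 0)" if "3 \<le> j" for j
    using that by simp
  have "(\<Sum>i = 3..v H. card (cycle_subgraphs i H)) = (\<Sum>j = 3..v H. if j = i then 1 else 0)"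
    by (rule sum.cong[OF refl]) (rule *, simp)
  also have "\<dots> = 1" using F \<open>i \<le> v H\<close> by simp
  finally show ?thesis .
qed

text \<open>With \<open>v G\<close> edges each subgraph is unicyclic, so it is counted once, under
  the length of its own cycle.\<close>

lemma card_spanning_connected_unicyclic:
  assumes "simple_graph G"
  shows "card (spanning_connected (v G) G) = (\<Sum>i = 3..v G. card (cycle_pairs i (v G) G))"
proof -
  have "(\<Sum>i = 3..v G. card (cycle_subgraphs i H)) = 1" if "H \<in> spanning_connected (v G) G" for H
    using card_all_cycles[of H] that by (auto simp: spanning_connected_def is_subgraph_def v_def)
  then have "card (spanning_connected (v G) G) =
      (\<Sum>H\<in>spanning_connected (v G) G. \<Sum>i = 3..v G. card (cycle_subgraphs i H))" by simp
  also have "\<dots> = (\<Sum>i = 3..v G. card (cycle_pairs i (v G) G))"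
    unfolding card_cycle_pairs[OF assms] by (rule sum.swap)
  finally show ?thesis .
qed

text \<open>F already has as many vertices and edges as H, so F = H.\<close>

lemma cycle_pairs_hamiltonian:
  assumes "simple_graph G" "3 \<le> v G"
  shows "card (cycle_pairs (v G) (v G) G) = num_cycles (v G) G"
proof -
  let ?n = "v G"
  have "cycle_pairs ?n ?n G = (\<lambda>F. (F, F)) ` cycle_subgraphs ?n G"
  proof (intro Set.set_eqI iffI)
    fix p assume "p \<in> cycle_pairs ?n ?n G"
    then obtain F H where p: "p = (F, H)" "is_subgraph H G" "verts H = verts G" "card (edges H) = ?n"
      and F: "F \<in> cycle_subgraphs ?n H" by (auto simp: cycle_pairs_def)
    have sub: "verts F \<subseteq> verts H" "edges F \<subseteq> edges H" using F by (auto simp: cycle_subgraphs_def is_subgraph_def)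
    have "simple_graph H" using p(2) by (simp add: is_subgraph_def)
    then have fin: "finite (verts H)" "finite (edges H)" by (simp_all add: simple_finite_edges)
    have "verts F = verts H"
      using card_verts_cycle[OF F] p by (intro card_subset_eq[OF fin(1) sub(1)]) (simp add: v_def)
    moreover have "edges F = edges H"
      using card_edges_cycle_ge_3[OF assms(2) F] p by (intro card_subset_eq[OF fin(2) sub(2)]) simp
    ultimately have "F = H" by simp
    then show "p \<in> (\<lambda>F. (F, F)) ` cycle_subgraphs ?n G"
      using p F by (auto simp: cycle_subgraphs_def is_subgraph_def)
  next
    fix p assume "p \<in> (\<lambda>F. (F, F)) ` cycle_subgraphs ?n G"
    then obtain F where p: "p = (F, F)" and F: "F \<in> cycle_subgraphs ?n G" by blast
    have sub: "is_subgraph F G" using F by (auto simp: cycle_subgraphs_def)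
    have "verts F = verts G"
      using card_verts_cycle[OF F] sub assms(1) by (intro card_subset_eq) (auto simp: v_def is_subgraph_def)
    moreover have "F \<in> cycle_subgraphs ?n F" using F by (auto simp: cycle_subgraphs_def is_subgraph_def)
    moreover have "connected_graph F" using connected_cycle[OF F] assms(2) by simp
    ultimately show "p \<in> cycle_pairs ?n ?n G"
      using sub card_edges_cycle_ge_3[OF assms(2) F] p by (simp add: cycle_pairs_def)
  qed
  moreover have "inj_on (\<lambda>F. (F, F)) (cycle_subgraphs ?n G)" by (auto simp: inj_on_def)
  ultimately show ?thesis by (simp add: card_image num_cycles_def)
qed

lemma num_spanning_trees_eq:
  assumes "simple_graph G" "v G \<noteq> 0"
  shows "num_spanning_trees G = card (spanning_connected (v G - 1) G)"
proof -
  have "tree H \<longleftrightarrow> connected_graph H \<and> card (edges H) = v G - 1" if "is_subgraph H G" "verts H = verts G" for H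
  proof -
    have "simple_graph H" "v H = Suc (v G - 1)" using that assms(2) by (simp_all add: is_subgraph_def v_def)
    then show ?thesis using tree_iff[of H] by simp
  qed
  then have "{H. is_subgraph H G \<and> verts H = verts G \<and> tree H} = spanning_connected (v G - 1) G"
    by (auto simp: spanning_connected_def)
  then show ?thesis by (simp add: num_spanning_trees_def)
qed

text \<open>Unicyclic subgraphs are grouped by their vertex set X. There the edge count singles them
  out among the connected spanning subgraphs, and a single cycle means a single pair.\<close>

lemma num_unicyclic_eq:
  assumes "simple_graph G" "3 \<le> i"
  shows "num_unicyclic i G = (\<Sum>X\<in>Pow (verts G). card (cycle_pairs i (card X) (induced G X)))"
proof -
  let ?U = "{U. is_subgraph U G \<and> unicyclic U \<and> cycle_subgraphs i U \<noteq> {}}"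
  have finU: "finite ?U" by (rule finite_subset[OF _ finite_subgraphs[OF assms(1)]]) auto
  have sub: "verts ` ?U \<subseteq> Pow (verts G)" by (auto simp: is_subgraph_def)
  have "card ?U = (\<Sum>X\<in>Pow (verts G). \<Sum>U\<in>{U \<in> ?U. verts U = X}. 1)"
    by (subst sum.group[OF finU _ sub]) (use assms in auto)
  also have "\<dots> = (\<Sum>X\<in>Pow (verts G). card {U \<in> ?U. verts U = X})" by simp
  also have "\<dots> = (\<Sum>X\<in>Pow (verts G). card (cycle_pairs i (card X) (induced G X)))"
  proof (intro sum.cong refl)
    fix X assume X: "X \<in> Pow (verts G)"
    let ?S = "spanning_connected (card X) (induced G X)"
    have sX: "simple_graph (induced G X)" using X assms(1) by (auto intro: simple_induced)
    have one: "card (cycle_subgraphs i H) = (if cycle_subgraphs i H = {} then 0 else 1)" if "H \<in> ?S" for H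
    proof -
      have "unicyclic H" using that unicyclic_iff[of H] by (auto simp: spanning_connected_def is_subgraph_def v_def)
      then obtain F where "\<And>F'. F' \<in> cycle_subgraphs i H \<Longrightarrow> F' = F"
        using assms(2) unfolding unicyclic_def by metis
      then have "cycle_subgraphs i H = {} \<or> cycle_subgraphs i H = {F}" by blast
      then show ?thesis by auto
    qed
    have "{U \<in> ?U. verts U = X} = {H \<in> ?S. cycle_subgraphs i H \<noteq> {}}"
    proof -
      have "is_subgraph U G \<and> verts U = X \<longleftrightarrow> is_subgraph U (induced G X) \<and> verts U = X" for U
        using X by (auto simp: is_subgraph_def edges_induced simple_graph_def)
      moreover have "unicyclic U \<longleftrightarrow> connected_graph U \<and> card (edges U) = card X"
        if "is_subgraph U (induced G X)" "verts U = X" for U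
        using that unicyclic_iff[of U] by (auto simp: is_subgraph_def v_def)
      ultimately show ?thesis unfolding spanning_connected_def by auto
    qed
    then have "card {U \<in> ?U. verts U = X} = (\<Sum>H\<in>{H \<in> ?S. cycle_subgraphs i H \<noteq> {}}. 1)" by simp
    also have "\<dots> = (\<Sum>H\<in>?S. card (cycle_subgraphs i H))"
      using one finite_spanning_connected[OF sX]
      by (intro sum.mono_neutral_cong_left) auto
    finally show "card {U \<in> ?U. verts U = X} = card (cycle_pairs i (card X) (induced G X))"
      unfolding card_cycle_pairs[OF sX] .
  qed
  finally show ?thesis by (simp add: num_unicyclic_def)
qed

subsection \<open>Graphs with matching induced subgraphs\<close>

lemma sum_induced_card:
  assumes "simple_graph K"
  shows "(\<Sum>X | X \<subseteq> verts K \<and> card X = b. f (induced K X)) =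
    (\<Sum>X\<in>Pow (verts K). if v (induced K X) = b then f (induced K X) else (0 :: 'c :: comm_monoid_add))"
proof -
  have "{X. X \<subseteq> verts K \<and> card X = b} = {X \<in> Pow (verts K). card X = b}" by auto
  then show ?thesis
    using assms by (simp only: v_induced sum.inter_filter[symmetric] finite_Pow_iff simple_finite)
qed

lemma sum_pairs_by_union:
  assumes "finite V"
  shows "(\<Sum>X\<in>Pow V. \<Sum>Y\<in>Pow V. h X Y) =
    (\<Sum>S\<in>Pow V. \<Sum>XY | XY \<in> Pow S \<times> Pow S \<and> fst XY \<union> snd XY = S. h (fst XY) (snd XY))"
proof -
  have "(\<Sum>X\<in>Pow V. \<Sum>Y\<in>Pow V. h X Y) = (\<Sum>XY\<in>Pow V \<times> Pow V. h (fst XY) (snd XY))"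
    by (simp add: sum.cartesian_product split_def)
  also have "\<dots> = (\<Sum>S\<in>Pow V. \<Sum>XY\<in>{XY \<in> Pow V \<times> Pow V. fst XY \<union> snd XY = S}. h (fst XY) (snd XY))"
    by (rule sum.group[symmetric]) (use assms in auto)
  also have "\<dots> = (\<Sum>S\<in>Pow V. \<Sum>XY | XY \<in> Pow S \<times> Pow S \<and> fst XY \<union> snd XY = S. h (fst XY) (snd XY))"
    by (intro sum.cong refl) auto
  finally show ?thesis .
qed

text \<open>The covering product of functions of vertex sets: summation over all induced subgraphs
  turns it into an ordinary product, as \<open>sum_union_sum\<close> shows.\<close>

definition union_sum :: "('a graph \<Rightarrow> 'c) \<Rightarrow> ('a graph \<Rightarrow> 'c) \<Rightarrow> 'a graph \<Rightarrow> 'c :: comm_semiring_1_cancel" where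
  "union_sum f g K = (\<Sum>XY | XY \<in> Pow (verts K) \<times> Pow (verts K) \<and> fst XY \<union> snd XY = verts K.
     f (induced K (fst XY)) * g (induced K (snd XY)))"

definition of_order :: "nat \<Rightarrow> ('a graph \<Rightarrow> 'c) \<Rightarrow> 'a graph \<Rightarrow> 'c :: zero" where
  "of_order b f K = (if v K = b then f K else 0)"

lemma sum_union_sum:
  assumes "simple_graph K"
  shows "(\<Sum>X\<in>Pow (verts K). f (induced K X)) * (\<Sum>Y\<in>Pow (verts K). g (induced K Y)) =
    (\<Sum>S\<in>Pow (verts K). union_sum f g (induced K S))"
proof -
  have "(\<Sum>X\<in>Pow (verts K). f (induced K X)) * (\<Sum>Y\<in>Pow (verts K). g (induced K Y)) =
      (\<Sum>X\<in>Pow (verts K). \<Sum>Y\<in>Pow (verts K). f (induced K X) * g (induced K Y))"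
    by (simp add: sum_product)
  also have "\<dots> = (\<Sum>S\<in>Pow (verts K). \<Sum>XY | XY \<in> Pow S \<times> Pow S \<and> fst XY \<union> snd XY = S.
      f (induced K (fst XY)) * g (induced K (snd XY)))"
    using assms by (intro sum_pairs_by_union) simp
  also have "\<dots> = (\<Sum>S\<in>Pow (verts K). union_sum f g (induced K S))"
    unfolding union_sum_def by (intro sum.cong refl) (auto simp: induced_induced)
  finally show ?thesis .
qed

text \<open>Sets \<open>X\<close> and \<open>Y\<close> with union \<open>V\<close> are complementary as soon as their sizes add up to that of \<open>V\<close>.\<close>

lemma sum_complement:
  assumes K: "simple_graph K"
  shows "(\<Sum>X\<in>Pow (verts K). f (induced K X) * g (induced K (verts K - X))) =
    (\<Sum>b\<le>v K. union_sum (of_order b f) (of_order (v K - b) g) K)"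
proof -
  let ?V = "verts K"
  have fin: "finite ?V" using K by simp
  have u: "union_sum (of_order b f) (of_order (v K - b) g) K =
      (\<Sum>X\<in>{X \<in> Pow ?V. card X = b}. f (induced K X) * g (induced K (?V - X)))" if b: "b \<le> v K" for b
  proof -
    let ?P = "{XY. XY \<in> Pow ?V \<times> Pow ?V \<and> fst XY \<union> snd XY = ?V}"
    have comp: "Y = ?V - X" if "X \<union> Y = ?V" "card X = b" "card Y = v K - b" for X Y
    proof -
      have "finite X" "finite Y" using fin that(1) by (metis finite_Un)+
      then have "card (X \<inter> Y) = 0" using card_Un_Int[of X Y] that b by (simp add: v_def)
      then have "X \<inter> Y = {}" using \<open>finite X\<close> by simp
      then show ?thesis using that(1) by auto
    qed
    have "union_sum (of_order b f) (of_order (v K - b) g) K =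
        (\<Sum>XY\<in>(\<lambda>X. (X, ?V - X)) ` {X \<in> Pow ?V. card X = b}.
          of_order b f (induced K (fst XY)) * of_order (v K - b) g (induced K (snd XY)))"
      unfolding union_sum_def
    proof (rule sum.mono_neutral_right)
      show "finite ?P" by (rule finite_subset[of _ "Pow ?V \<times> Pow ?V"]) (use fin in auto)
      show "(\<lambda>X. (X, ?V - X)) ` {X \<in> Pow ?V. card X = b} \<subseteq> ?P" by auto
      show "\<forall>XY\<in>?P - (\<lambda>X. (X, ?V - X)) ` {X \<in> Pow ?V. card X = b}.
          of_order b f (induced K (fst XY)) * of_order (v K - b) g (induced K (snd XY)) = 0"
      proof (intro ballI)
        fix XY assume XY: "XY \<in> ?P - (\<lambda>X. (X, ?V - X)) ` {X \<in> Pow ?V. card X = b}"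
        obtain X Y where p: "XY = (X, Y)" by (cases XY)
        have "\<not> (card X = b \<and> card Y = v K - b)"
        proof
          assume c: "card X = b \<and> card Y = v K - b"
          have "X \<subseteq> ?V" "X \<union> Y = ?V" using XY p by simp_all
          then have "Y = ?V - X" using comp c by blast
          then show False using XY p c \<open>X \<subseteq> ?V\<close> by blast
        qed
        then show "of_order b f (induced K (fst XY)) * of_order (v K - b) g (induced K (snd XY)) = 0"
          by (auto simp: p of_order_def)
      qed
    qed
    also have "\<dots> = (\<Sum>X\<in>{X \<in> Pow ?V. card X = b}. f (induced K X) * g (induced K (?V - X)))"
    proof (subst sum.reindex)
      show "inj_on (\<lambda>X. (X, ?V - X)) {X \<in> Pow ?V. card X = b}" by (auto simp: inj_on_def)
      have "card (?V - X) = v K - b" if "X \<subseteq> ?V" "card X = b" for X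
        using that fin by (simp add: v_def card_Diff_subset finite_subset)
      then show "sum ((\<lambda>XY. of_order b f (induced K (fst XY)) * of_order (v K - b) g (induced K (snd XY)))
          \<circ> (\<lambda>X. (X, ?V - X))) {X \<in> Pow ?V. card X = b} =
        (\<Sum>X\<in>{X \<in> Pow ?V. card X = b}. f (induced K X) * g (induced K (?V - X)))"
        by (intro sum.cong refl) (simp add: of_order_def)
    qed
    finally show ?thesis .
  qed
  have "(\<Sum>X\<in>Pow ?V. f (induced K X) * g (induced K (?V - X))) =
      (\<Sum>b\<in>{..v K}. \<Sum>X\<in>{X \<in> Pow ?V. card X = b}. f (induced K X) * g (induced K (?V - X)))"
    by (rule sum.group[symmetric]) (use fin in \<open>auto simp: v_def card_mono\<close>)
  also have "\<dots> = (\<Sum>b\<le>v K. union_sum (of_order b f) (of_order (v K - b) g) K)"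
    by (intro sum.cong refl) (simp add: u)
  finally show ?thesis .
qed

text \<open>The term of K itself is isolated for inductions on the order. The cut-off n is kept
  apart from \<open>v K\<close>, so that two graphs of equal order can use the same
  truncation.\<close>

lemma sum_Pow_top:
  assumes "simple_graph K" "n = v K"
  shows "(\<Sum>X\<in>Pow (verts K). f (induced K X)) =
    f K + (\<Sum>X\<in>Pow (verts K). if v (induced K X) < n then f (induced K X) else (0 :: 'c :: comm_monoid_add))"
proof -
  let ?P = "Pow (verts K)"
  have fin: "finite (verts K)" "finite ?P" using assms(1) by auto
  have less: "card X < n \<longleftrightarrow> X \<noteq> verts K" if "X \<subseteq> verts K" for X
    using that psubset_card_mono[OF fin(1), of X] assms(2) by (auto simp: v_def)
  have "(\<Sum>X\<in>?P. f (induced K X)) = f K + (\<Sum>X\<in>?P - {verts K}. f (induced K X))"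
    using sum.remove[OF fin(2), of "verts K" "\<lambda>X. f (induced K X)"] assms(1) by (simp add: induced_verts)
  also have "(\<Sum>X\<in>?P - {verts K}. f (induced K X)) =
      (\<Sum>X\<in>?P. if v (induced K X) < n then f (induced K X) else 0)"
    using fin less by (intro sum.mono_neutral_cong_left) auto
  finally show ?thesis .
qed

text \<open>A cycle of length a belongs to exactly one vertex set of size a. This reduces cycles
  shorter than the order to smaller graphs.\<close>

lemma num_cycles_sum:
  assumes "simple_graph K"
  shows "num_cycles a K = (\<Sum>X\<in>Pow (verts K). of_order a (num_cycles a) (induced K X))"
proof -
  have "num_cycles a K = (\<Sum>F\<in>cycle_subgraphs a K. 1)" by (simp add: num_cycles_def)
  also have "\<dots> = (\<Sum>X\<in>Pow (verts K). \<Sum>F\<in>{F \<in> cycle_subgraphs a K. verts F = X}. 1)"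
  proof (rule sum.group[symmetric])
    show "verts ` cycle_subgraphs a K \<subseteq> Pow (verts K)" by (auto simp: cycle_subgraphs_def is_subgraph_def)
  qed (use assms in \<open>simp_all add: finite_cycle_subgraphs\<close>)
  also have "\<dots> = (\<Sum>X\<in>Pow (verts K). of_order a (num_cycles a) (induced K X))"
  proof (rule sum.cong[OF refl])
    fix X assume "X \<in> Pow (verts K)"
    then have X: "X \<subseteq> verts K" "finite X" using assms by (auto intro: finite_subset)
    have "{F \<in> cycle_subgraphs a K. verts F = X} = (if card X = a then cycle_subgraphs a (induced K X) else {})"
    proof -
      have "verts F = X \<longleftrightarrow> card X = a \<and> verts F \<subseteq> X" if "F \<in> cycle_subgraphs a K" for F
        using card_verts_cycle[OF that] card_subset_eq[OF X(2), of "verts F"] by (metis subset_refl)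
      then have "{F \<in> cycle_subgraphs a K. verts F = X} = {F \<in> cycle_subgraphs a K. card X = a \<and> verts F \<subseteq> X}"
        by (intro Collect_cong conj_cong refl)
      then show ?thesis unfolding cycle_subgraphs_induced[OF assms X(1)] by (cases "card X = a") simp_all
    qed
    then show "(\<Sum>F\<in>{F \<in> cycle_subgraphs a K. verts F = X}. 1) = of_order a (num_cycles a) (induced K X)"
      by (simp add: of_order_def num_cycles_def)
  qed
  finally show ?thesis .
qed

text \<open>In the split, L = J leaves no index to cover the other vertices, so only X = V
  contributes, and this is the connecting term. For L distinct from J the leftover indices need
  vertices, so X is proper and the truncation at n changes nothing.\<close>

lemma card_covering_eq_connecting:
  assumes K: "simple_graph K" and J: "finite J" "j0 \<in> J" and a: "\<And>j. j \<in> J \<Longrightarrow> 2 \<le> a j" and n: "n = v K"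
  shows "card (covering J a K) = card (connecting J a K) +
    (\<Sum>L\<in>{L. L \<subseteq> J \<and> j0 \<in> L} - {J}. \<Sum>X\<in>Pow (verts K).
      (if v (induced K X) < n then card (connecting L a (induced K X)) else 0) *
      card (covering (J - L) a (induced K (verts K - X))))"
proof -
  let ?V = "verts K"
  let ?h = "\<lambda>L X. card (connecting L a (induced K X)) * card (covering (J - L) a (induced K (?V - X)))"
  have fin: "finite ?V" using K by simp
  have "card (covering J a K) = (\<Sum>L\<in>{L. L \<subseteq> J \<and> j0 \<in> L}. \<Sum>X\<in>Pow ?V. ?h L X)"
    by (rule card_covering_split[OF K J a])
  also have "\<dots> = (\<Sum>X\<in>Pow ?V. ?h J X) + (\<Sum>L\<in>{L. L \<subseteq> J \<and> j0 \<in> L} - {J}. \<Sum>X\<in>Pow ?V. ?h L X)"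
    using J by (intro sum.remove) auto
  also have "(\<Sum>X\<in>Pow ?V. ?h J X) = (\<Sum>X\<in>Pow ?V. if X = ?V then card (connecting J a K) else 0)"
  proof (rule sum.cong[OF refl])
    fix X assume "X \<in> Pow ?V"
    then have "?V - X = {} \<longleftrightarrow> X = ?V" by auto
    then show "?h J X = (if X = ?V then card (connecting J a K) else 0)"
      using K by (simp add: covering_empty induced_verts)
  qed
  also have "\<dots> = card (connecting J a K)" using fin by simp
  also have "(\<Sum>L\<in>{L. L \<subseteq> J \<and> j0 \<in> L} - {J}. \<Sum>X\<in>Pow ?V. ?h L X) =
      (\<Sum>L\<in>{L. L \<subseteq> J \<and> j0 \<in> L} - {J}. \<Sum>X\<in>Pow ?V.
        (if v (induced K X) < n then card (connecting L a (induced K X)) else 0) *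
        card (covering (J - L) a (induced K (?V - X))))"
  proof (intro sum.cong refl)
    fix L X assume L: "L \<in> {L. L \<subseteq> J \<and> j0 \<in> L} - {J}" and X: "X \<in> Pow ?V"
    show "?h L X = (if v (induced K X) < n then card (connecting L a (induced K X)) else 0) *
        card (covering (J - L) a (induced K (?V - X)))"
    proof (cases "X = ?V")
      case True
      then have "covering (J - L) a (induced K (?V - X)) = {}"
        using L a by (intro covering_no_verts) auto
      then show ?thesis by simp
    next
      case False
      then have "card X < n" using X psubset_card_mono[OF fin, of X] n by (auto simp: v_def)
      then show ?thesis by simp
    qed
  qed
  finally show ?thesis .
qed

lemma cycle_pairs_empty:
  assumes "2 \<le> i" "m < cycle_size i" shows "cycle_pairs i m G = {}"
proof (rule ccontr)
  assume "cycle_pairs i m G \<noteq> {}"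
  then obtain F H where "(F, H) \<in> cycle_pairs i m G" by auto
  then have H: "simple_graph H" "card (edges H) = m" and F: "F \<in> cycle_subgraphs i H"
    by (auto simp: cycle_pairs_def is_subgraph_def)
  have "edges F \<subseteq> edges H" using F by (simp add: cycle_subgraphs_def is_subgraph_def)
  from card_mono[OF simple_finite_edges[OF H(1)] this] show False
    using card_edges_cycle[OF F assms(1)] H(2) assms(2) by simp
qed

text \<open>The start of the induction on the order; \<open>R_edges\<close> decides this
  case.\<close>

lemma num_cycles_2_order_2:
  assumes "simple_graph K" "v K = 2"
  shows "num_cycles 2 K = (if edges K = {} then 0 else 1)"
proof -
  have "e = verts K" if "e \<in> edges K" for e
    using that assms card_subset_eq[of "verts K" e] by (auto simp: simple_graph_def v_def)
  then have "edges K = {} \<or> edges K = {verts K}" by blast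
  then show ?thesis unfolding num_cycles_def cycle_subgraphs_2[OF assms(1)] by auto
qed

lemma card_spanning_connected_split:
  assumes "simple_graph K" "3 \<le> v K"
  shows "card (spanning_connected (v K) K) =
    num_cycles (v K) K + (\<Sum>i\<in>{3..<v K}. card (cycle_pairs i (v K) K))"
proof -
  have "{3..v K} = insert (v K) {3..<v K}" using assms(2) by auto
  then show ?thesis
    unfolding card_spanning_connected_unicyclic[OF assms(1)]
    by (simp add: cycle_pairs_hamiltonian[OF assms])
qed

section \<open>Transfer of invariants along a matching\<close>

text \<open>The bijections for different pairs need not fit together, nor respect inclusion, union
  or complement: the matching provides counts only. \<open>R_edges\<close> is the only direct
  contact with edges.\<close>

locale matching =
  fixes R :: "'a graph \<Rightarrow> 'b graph \<Rightarrow> bool"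
  assumes R_simple: "R H H' \<Longrightarrow> simple_graph H \<and> simple_graph H'"
    and R_edges: "R H H' \<Longrightarrow> edges H = {} \<longleftrightarrow> edges H' = {}"
    and R_bij: "R H H' \<Longrightarrow> \<exists>\<phi>. bij_betw \<phi> (Pow (verts H)) (Pow (verts H')) \<and>
      (\<forall>X\<subseteq>verts H. card (\<phi> X) = card X \<and> R (induced H X) (induced H' (\<phi> X)))"
begin

lemma R_simpleD: "R H H' \<Longrightarrow> simple_graph H" "R H H' \<Longrightarrow> simple_graph H'"
  using R_simple by auto

lemma R_order: assumes "R H H'" shows "v H = v H'"
proof -
  obtain \<phi> where \<phi>: "bij_betw \<phi> (Pow (verts H)) (Pow (verts H'))" "\<And>X. X \<subseteq> verts H \<Longrightarrow> card (\<phi> X) = card X"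
    using R_bij[OF assms] by blast
  have fin: "finite (verts H)" "finite (verts H')" using R_simple[OF assms] by auto
  have "card (Pow (verts H)) = card (Pow (verts H'))" using \<phi>(1) by (rule bij_betw_same_card)
  then show ?thesis using fin by (simp add: card_Pow v_def)
qed

text \<open>Usually f and f' are one invariant at two vertex types. The bound n serves the
  inductions on the order.\<close>

definition agrees :: "nat \<Rightarrow> ('a graph \<Rightarrow> 'c) \<Rightarrow> ('b graph \<Rightarrow> 'c) \<Rightarrow> bool" where
  "agrees n f f' \<longleftrightarrow> (\<forall>K K'. R K K' \<longrightarrow> v K \<le> n \<longrightarrow> f K = f' K')"

lemma agreesI: "(\<And>K K'. R K K' \<Longrightarrow> v K \<le> n \<Longrightarrow> f K = f' K') \<Longrightarrow> agrees n f f'"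
  by (simp add: agrees_def)

lemma agreesD: "agrees n f f' \<Longrightarrow> R K K' \<Longrightarrow> v K \<le> n \<Longrightarrow> f K = f' K'"
  by (simp add: agrees_def)

lemma agrees_mono: "agrees n f f' \<Longrightarrow> m \<le> n \<Longrightarrow> agrees m f f'"
  by (simp add: agrees_def)

lemma agrees_of_order: "agrees n f f' \<Longrightarrow> agrees n (of_order b f) (of_order b f')"
  by (simp add: agrees_def of_order_def R_order)

lemma agrees_sum_Pow:
  assumes "agrees n f f'"
  shows "agrees n (\<lambda>K. \<Sum>X\<in>Pow (verts K). f (induced K X)) (\<lambda>K. \<Sum>X\<in>Pow (verts K). f' (induced K X))"
proof (rule agreesI)
  fix H H' assume R: "R H H'" and n: "v H \<le> n"
  obtain \<phi> where \<phi>: "bij_betw \<phi> (Pow (verts H)) (Pow (verts H'))"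
    "\<And>X. X \<subseteq> verts H \<Longrightarrow> card (\<phi> X) = card X \<and> R (induced H X) (induced H' (\<phi> X))"
    using R_bij[OF R] by blast
  have fin: "finite (verts H)" using R_simple[OF R] by simp
  have "(\<Sum>X\<in>Pow (verts H). f (induced H X)) = (\<Sum>X\<in>Pow (verts H). f' (induced H' (\<phi> X)))"
  proof (rule sum.cong[OF refl])
    fix X assume "X \<in> Pow (verts H)"
    then have "R (induced H X) (induced H' (\<phi> X))" "v (induced H X) \<le> n"
      using \<phi>(2)[of X] card_mono[OF fin, of X] n by (auto simp: v_def)
    then show "f (induced H X) = f' (induced H' (\<phi> X))" by (rule agreesD[OF assms])
  qed
  also have "\<dots> = (\<Sum>X\<in>Pow (verts H'). f' (induced H' X))" by (rule sum.reindex_bij_betw[OF \<phi>(1)])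
  finally show "(\<Sum>X\<in>Pow (verts H). f (induced H X)) = (\<Sum>X\<in>Pow (verts H'). f' (induced H' X))" .
qed

lemma agrees_sum_card:
  assumes "agrees n f f'"
  shows "agrees n (\<lambda>K. \<Sum>X | X \<subseteq> verts K \<and> card X = b. f (induced K X))
    (\<lambda>K. \<Sum>X | X \<subseteq> verts K \<and> card X = b. f' (induced K X))"
  using agrees_sum_Pow[OF agrees_of_order[OF assms, of b]] R_simple
  by (simp add: agrees_def sum_induced_card of_order_def)

text \<open>Moebius inversion without signs: by induction on the order the proper induced subgraphs
  contribute equally, and cancelling them leaves the value at the graph itself. This works over the
  natural numbers.\<close>

lemma agrees_if_sum_Pow:
  fixes f :: "'a graph \<Rightarrow> 'c :: cancel_comm_monoid_add" and f' :: "'b graph \<Rightarrow> 'c"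
  assumes "agrees n (\<lambda>K. \<Sum>X\<in>Pow (verts K). f (induced K X)) (\<lambda>K. \<Sum>X\<in>Pow (verts K). f' (induced K X))"
  shows "agrees n f f'"
proof -
  have "agrees m f f'" if "m \<le> n" for m
    using that
  proof (induction m rule: less_induct)
    case (less m)
    show ?case
    proof (rule agreesI)
      fix H H' assume R: "R H H'" and m: "v H \<le> m"
      have s: "simple_graph H" "simple_graph H'" using R_simple[OF R] by auto
      define g where "g = (\<lambda>K. if v K < v H then f K else 0)"
      define g' where "g' = (\<lambda>K. if v K < v H then f' K else 0)"
      have "agrees m g g'"
      proof (rule agreesI)
        fix K K' assume K: "R K K'"
        show "g K = g' K'"
        proof (cases "v K < v H")
          case True
          then have "agrees (v K) f f'" using less m by auto
          then show ?thesis using K True by (simp add: g_def g'_def R_order agrees_def)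
        qed (use K in \<open>simp add: g_def g'_def R_order\<close>)
      qed
      from agreesD[OF agrees_sum_Pow[OF this] R m]
      have "(\<Sum>X\<in>Pow (verts H). g (induced H X)) = (\<Sum>X\<in>Pow (verts H'). g' (induced H' X))" .
      moreover have "(\<Sum>X\<in>Pow (verts H). f (induced H X)) = f H + (\<Sum>X\<in>Pow (verts H). g (induced H X))"
        unfolding g_def using s by (intro sum_Pow_top) simp_all
      moreover have "(\<Sum>X\<in>Pow (verts H'). f' (induced H' X)) = f' H' + (\<Sum>X\<in>Pow (verts H'). g' (induced H' X))"
        unfolding g'_def using s R_order[OF R] by (intro sum_Pow_top) simp_all
      ultimately show "f H = f' H'" using agreesD[OF assms R] m less.prems by simp
    qed
  qed
  then show ?thesis by simp
qed

text \<open>Summed over all induced subgraphs, the covering product is a product of two sums that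
  agree; inversion does the rest.\<close>

lemma agrees_union_sum:
  assumes "agrees n f f'" "agrees n g g'"
  shows "agrees n (union_sum f g) (union_sum f' g')"
proof (rule agrees_if_sum_Pow, rule agreesI)
  fix K K' assume K: "R K K'" "v K \<le> n"
  show "(\<Sum>X\<in>Pow (verts K). union_sum f g (induced K X)) = (\<Sum>X\<in>Pow (verts K'). union_sum f' g' (induced K' X))"
    using agreesD[OF agrees_sum_Pow[OF assms(1)] K] agreesD[OF agrees_sum_Pow[OF assms(2)] K]
    by (simp add: sum_union_sum[symmetric] R_simpleD[OF K(1)])
qed

text \<open>The bijection of subsets need not send complements to complements, so the terms cannot
  be compared one by one. Rewritten by \<open>sum_complement\<close>, the sum consists of covering
  products, which transfer.\<close>

lemma agrees_sum_complement:
  fixes f g :: "'a graph \<Rightarrow> 'c :: comm_semiring_1_cancel" and f' g' :: "'b graph \<Rightarrow> 'c"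
  assumes "agrees n f f'" "agrees n g g'"
  shows "agrees n (\<lambda>K. \<Sum>X\<in>Pow (verts K). f (induced K X) * g (induced K (verts K - X)))
    (\<lambda>K. \<Sum>X\<in>Pow (verts K). f' (induced K X) * g' (induced K (verts K - X)))"
proof (rule agreesI)
  fix K K' assume K: "R K K'" "v K \<le> n"
  show "(\<Sum>X\<in>Pow (verts K). f (induced K X) * g (induced K (verts K - X))) =
      (\<Sum>X\<in>Pow (verts K'). f' (induced K' X) * g' (induced K' (verts K' - X)))"
    unfolding sum_complement[OF R_simpleD(1)[OF K(1)]] sum_complement[OF R_simpleD(2)[OF K(1)]] R_order[OF K(1)]
    using agreesD[OF agrees_union_sum[OF agrees_of_order[OF assms(1)] agrees_of_order[OF assms(2)]] K]
    by (intro sum.cong refl)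
qed

text \<open>Kocay's lemma followed by inversion.\<close>

lemma agrees_covering:
  assumes "finite I" "\<And>j. j \<in> I \<Longrightarrow> agrees n (num_cycles (a j)) (num_cycles (a j))"
  shows "agrees n (\<lambda>K. card (covering I a K)) (\<lambda>K. card (covering I a K))"
proof (rule agrees_if_sum_Pow, rule agreesI)
  fix K K' assume K: "R K K'" "v K \<le> n"
  show "(\<Sum>X\<in>Pow (verts K). card (covering I a (induced K X))) =
      (\<Sum>X\<in>Pow (verts K'). card (covering I a (induced K' X)))"
    unfolding prod_num_cycles[OF R_simpleD(1)[OF K(1)] assms(1), symmetric]
      prod_num_cycles[OF R_simpleD(2)[OF K(1)] assms(1), symmetric]
    using agreesD[OF assms(2) K] by (rule prod.cong[OF refl])
qed

text \<open>Induction on the order: apart from the wanted term, the split involves covering tuples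
  and connecting tuples of smaller graphs. The latter occur for various index sets, hence J is
  arbitrary in the induction.\<close>

lemma agrees_connecting:
  assumes I: "finite I" and a: "\<And>j. j \<in> I \<Longrightarrow> 2 \<le> a j"
    and c: "\<And>j. j \<in> I \<Longrightarrow> agrees n (num_cycles (a j)) (num_cycles (a j))"
  shows "agrees n (\<lambda>K. card (connecting I a K)) (\<lambda>K. card (connecting I a K))"
proof -
  have "agrees m (\<lambda>K. card (connecting J a K)) (\<lambda>K. card (connecting J a K))"
    if "m \<le> n" "J \<subseteq> I" for m J
    using that
  proof (induction m arbitrary: J rule: less_induct)
    case (less m)
    have finJ: "finite J" using less.prems I by (auto intro: finite_subset)
    show ?case
    proof (cases "J = {}")
      case True
      then show ?thesis
        using True by (simp add: agrees_def connecting_def connected_graph_def)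
    next
      case False
      then obtain j0 where j0: "j0 \<in> J" by blast
      show ?thesis
      proof (rule agreesI)
        fix H H' assume R: "R H H'" and m: "v H \<le> m"
        note s = R_simpleD[OF R]
        have aJ: "\<And>j. j \<in> J \<Longrightarrow> 2 \<le> a j" using a less.prems by auto
        let ?Js = "{L. L \<subseteq> J \<and> j0 \<in> L} - {J}"
        \<comment> \<open>Agreement up to m is needed for the complement sums but known for smaller
          orders only; truncating below \<open>v H\<close> reconciles the two.\<close>
        let ?f = "\<lambda>L K. if v K < v H then card (connecting L a K) else 0"
        let ?f' = "\<lambda>L K. if v K < v H then card (connecting L a K) else 0"
        have "agrees m (?f L) (?f' L)" if "L \<in> ?Js" for L
        proof (rule agreesI)
          fix K K' assume K: "R K K'"
          show "?f L K = ?f' L K'"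
          proof (cases "v K < v H")
            case True
            then have "agrees (v K) (\<lambda>K. card (connecting L a K)) (\<lambda>K. card (connecting L a K))"
              using less m that by auto
            from agreesD[OF this K] show ?thesis using R_order[OF K] by simp
          qed (simp add: R_order[OF K])
        qed
        moreover have "agrees m (\<lambda>K. card (covering (J - L) a K)) (\<lambda>K. card (covering (J - L) a K))" for L
          using finJ less.prems by (intro agrees_mono[OF agrees_covering]) (auto intro: c)
        ultimately have rest: "(\<Sum>L\<in>?Js. \<Sum>X\<in>Pow (verts H). ?f L (induced H X) * card (covering (J - L) a (induced H (verts H - X)))) =
            (\<Sum>L\<in>?Js. \<Sum>X\<in>Pow (verts H'). ?f' L (induced H' X) * card (covering (J - L) a (induced H' (verts H' - X))))"
          by (intro sum.cong refl agreesD[OF agrees_sum_complement R m])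
        have "card (covering J a H) = card (covering J a H')"
          using finJ less.prems by (intro agreesD[OF agrees_covering R]) (use m in \<open>auto intro: agrees_mono c\<close>)
        moreover have "card (covering J a H) = card (connecting J a H) +
            (\<Sum>L\<in>?Js. \<Sum>X\<in>Pow (verts H). ?f L (induced H X) * card (covering (J - L) a (induced H (verts H - X))))"
          by (rule card_covering_eq_connecting[OF s(1) finJ j0 aJ refl])
        moreover have "card (covering J a H') = card (connecting J a H') +
            (\<Sum>L\<in>?Js. \<Sum>X\<in>Pow (verts H'). ?f' L (induced H' X) * card (covering (J - L) a (induced H' (verts H' - X))))"
          by (rule card_covering_eq_connecting[OF s(2) finJ j0 aJ R_order[OF R]])
        ultimately show "card (connecting J a H) = card (connecting J a H')" using rest by simp
      qed
    qed
  qed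
  then show ?thesis by simp
qed

text \<open>Taking k = m - \<open>cycle_size i\<close> further edges makes m the largest number of
  edges that occurs. The terms for fewer edges are known by induction, and the coefficient of the
  last one is nonzero.\<close>

lemma agrees_cycle_pairs:
  assumes i: "2 \<le> i" and c: "agrees n (num_cycles i) (num_cycles i)" "agrees n (num_cycles 2) (num_cycles 2)"
  shows "agrees n (\<lambda>K. card (cycle_pairs i m K)) (\<lambda>K. card (cycle_pairs i m K))"
proof (induction m rule: less_induct)
  case (less m)
  let ?b = "cycle_size i"
  show ?case
  proof (rule agreesI)
    fix H H' assume R: "R H H'" and n: "v H \<le> n"
    note s = R_simpleD[OF R]
    show "card (cycle_pairs i m H) = card (cycle_pairs i m H')"
    proof (cases "m < ?b")
      case True
      then show ?thesis by (simp add: cycle_pairs_empty[OF i])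
    next
      case False
      define k where "k = m - ?b"
      have m: "m = ?b + k" using False by (simp add: k_def)
      let ?I = "edge_index k"
      have "agrees n (num_cycles (with_edges i j)) (num_cycles (with_edges i j))" for j
        using c by (cases j) (simp_all add: with_edges_def)
      moreover have "2 \<le> with_edges i j" for j using i by (cases j) (simp_all add: with_edges_def)
      ultimately have "card (connecting ?I (with_edges i) H) = card (connecting ?I (with_edges i) H')"
        by (intro agreesD[OF agrees_connecting R n]) auto
      then have "(\<Sum>l\<in>{?b..m}. cover_count k l ?b * card (cycle_pairs i l H)) =
          (\<Sum>l\<in>{?b..m}. cover_count k l ?b * card (cycle_pairs i l H'))"
        unfolding card_connecting_with_edges[OF s(1) i] card_connecting_with_edges[OF s(2) i] m .
      moreover have "{?b..m} = insert m {?b..<m}" using m by auto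
      moreover have "(\<Sum>l\<in>{?b..<m}. cover_count k l ?b * card (cycle_pairs i l H)) =
          (\<Sum>l\<in>{?b..<m}. cover_count k l ?b * card (cycle_pairs i l H'))"
      proof (rule sum.cong[OF refl])
        fix l assume "l \<in> {?b..<m}"
        then show "cover_count k l ?b * card (cycle_pairs i l H) = cover_count k l ?b * card (cycle_pairs i l H')"
          using agreesD[OF less.IH R n, of l] by simp
      qed
      ultimately show ?thesis using cover_count_pos[of k ?b] by (simp add: m)
    qed
  qed
qed

text \<open>Each subgraph occurs in m pairs with an edge, and m > 0 can be cancelled.\<close>

lemma agrees_spanning_connected:
  assumes "agrees n (num_cycles 2) (num_cycles 2)" "0 < m"
  shows "agrees n (\<lambda>K. card (spanning_connected m K)) (\<lambda>K. card (spanning_connected m K))"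
proof (rule agreesI)
  fix H H' assume R: "R H H'" and n: "v H \<le> n"
  show "card (spanning_connected m H) = card (spanning_connected m H')"
    using agreesD[OF agrees_cycle_pairs[OF _ assms(1,1), of m] R n] R_simpleD[OF R] assms(2)
    by (simp add: card_cycle_pairs_2)
qed

text \<open>Induction on the order. At order \<open>Suc n\<close>, cycles of length at most n live
  in smaller induced subgraphs and longer ones than \<open>Suc n\<close> do not exist, so only the
  hamiltonian ones need the count of unicyclic spanning subgraphs.\<close>

lemma agrees_num_cycles: "2 \<le> a \<Longrightarrow> agrees n (num_cycles a) (num_cycles a)"
proof (induction n arbitrary: a)
  case 0
  then show ?case
    by (intro agreesI) (simp add: num_cycles_def cycle_subgraphs_empty R_simpleD R_order[symmetric])
next
  case (Suc n)
  have small: "agrees (Suc n) (num_cycles a) (num_cycles a)" if a: "2 \<le> a" "a \<noteq> Suc n" for a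
  proof (cases "a \<le> n")
    case True
    have "agrees (Suc n) (of_order a (num_cycles a)) (of_order a (num_cycles a))"
    proof (rule agreesI)
      fix K K' assume K: "R K K'"
      show "of_order a (num_cycles a) K = of_order a (num_cycles a) K'"
        using agreesD[OF Suc.IH[OF a(1)] K] True R_order[OF K] by (simp add: of_order_def)
    qed
    from agrees_sum_Pow[OF this] show ?thesis
      by (simp add: agrees_def num_cycles_sum[symmetric] R_simpleD)
  next
    case False
    then show ?thesis
      using a by (intro agreesI) (simp add: num_cycles_def cycle_subgraphs_empty R_simpleD R_order[symmetric])
  qed
  show ?case
  proof (cases "a = Suc n")
    case False
    then show ?thesis using small Suc.prems by simp
  next
    case a: True
    show ?thesis
    proof (rule agreesI)
      fix H H' assume R: "R H H'" and n: "v H \<le> Suc n"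
      note s = R_simpleD[OF R]
      show "num_cycles a H = num_cycles a H'"
      proof (cases "v H = a")
        case False
        then show ?thesis
          using n a s R_order[OF R] by (simp add: num_cycles_def cycle_subgraphs_empty)
      next
        case vH: True
        have vH': "v H' = a" using vH R_order[OF R] by simp
        show ?thesis
        proof (cases "a = 2")
          case True
          show ?thesis using True vH vH' s R_edges[OF R] by (simp add: num_cycles_2_order_2)
        next
          case False
          then have a3: "3 \<le> a" using Suc.prems by simp
          \<comment> \<open>Edges belong to the lengths already settled, because a is at least 3
            here.\<close>
          have c2: "agrees (Suc n) (num_cycles 2) (num_cycles 2)" using small a False by simp
          have "card (cycle_pairs i a H) = card (cycle_pairs i a H')" if "i \<in> {3..<a}" for i
            using that a small[of i] by (intro agreesD[OF agrees_cycle_pairs[OF _ _ c2] R n]) auto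
          then have eq: "(\<Sum>i\<in>{3..<a}. card (cycle_pairs i a H)) = (\<Sum>i\<in>{3..<a}. card (cycle_pairs i a H'))"
            by (rule sum.cong[OF refl])
          have "card (spanning_connected a H) = card (spanning_connected a H')"
            using a3 by (intro agreesD[OF agrees_spanning_connected[OF c2] R n]) simp
          then show ?thesis
            using card_spanning_connected_split[OF s(1)] card_spanning_connected_split[OF s(2)] eq vH vH' a3 by simp
        qed
      qed
    qed
  qed
qed

end

subsection \<open>The invariants\<close>

lemma ham_eq_num_cycles: "simple_graph G \<Longrightarrow> ham G = num_cycles (v G) G"
proof -
  assume G: "simple_graph G"
  have "verts F = verts G" if "F \<in> cycle_subgraphs (v G) G" for F
    using card_verts_cycle[OF that] that G
    by (intro card_subset_eq) (simp_all add: v_def cycle_subgraphs_def is_subgraph_def)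
  then have "{F \<in> cycle_subgraphs (v G) G. verts F = verts G} = cycle_subgraphs (v G) G" by blast
  then show ?thesis by (simp add: ham_def num_cycles_def)
qed

section \<open>Tuples of vertex sets and the quantities Q and T\<close>

definition set_tuples :: "nat list \<Rightarrow> 'a set \<Rightarrow> 'a set list set" where
  "set_tuples B V = {Xs. length Xs = length B \<and> (\<forall>j<length B. Xs ! j \<subseteq> V \<and> card (Xs ! j) = B ! j)}"

lemma set_tuples_Union: "Xs \<in> set_tuples B V \<Longrightarrow> \<Union>(set Xs) \<subseteq> V"
  unfolding set_tuples_def by (simp add: Sup_le_iff all_set_conv_all_nth)

lemma set_tuples_subset_iff:
  "Xs \<in> set_tuples B V \<Longrightarrow> Xs \<in> set_tuples B S \<longleftrightarrow> \<Union>(set Xs) \<subseteq> S"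
  unfolding set_tuples_def by (simp add: Sup_le_iff all_set_conv_all_nth)

lemma set_tuples_mono:
  assumes "S \<subseteq> V" shows "set_tuples B S \<subseteq> set_tuples B V"
proof
  fix Xs assume "Xs \<in> set_tuples B S"
  then show "Xs \<in> set_tuples B V"
    unfolding set_tuples_def mem_Collect_eq using subset_trans[OF _ assms] by metis
qed

lemma finite_set_tuples:
  assumes "finite V" shows "finite (set_tuples B V)"
proof (rule finite_subset)
  show "finite {Xs. set Xs \<subseteq> Pow V \<and> length Xs = length B}"
    using assms by (intro finite_lists_length_eq) simp
  show "set_tuples B V \<subseteq> {Xs. set Xs \<subseteq> Pow V \<and> length Xs = length B}"
    using set_tuples_Union[of _ B V] by (auto simp: set_tuples_def Sup_le_iff)
qed

lemma set_tuples_with_union: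
  assumes "S \<subseteq> V" "finite V"
  shows "{Xs \<in> set_tuples B V. \<Union>(set Xs) = S} = {Xs \<in> set_tuples B S. card (\<Union>(set Xs)) = card S}"
proof (intro Set.set_eqI iffI)
  fix Xs assume "Xs \<in> {Xs \<in> set_tuples B V. \<Union>(set Xs) = S}"
  then show "Xs \<in> {Xs \<in> set_tuples B S. card (\<Union>(set Xs)) = card S}"
    using set_tuples_subset_iff[of Xs B V S] by simp
next
  fix Xs assume "Xs \<in> {Xs \<in> set_tuples B S. card (\<Union>(set Xs)) = card S}"
  then have Xs: "Xs \<in> set_tuples B S" "card (\<Union>(set Xs)) = card S" by auto
  have "\<Union>(set Xs) = S"
    using finite_subset[OF assms] set_tuples_Union[OF Xs(1)] Xs(2) by (rule card_subset_eq)
  moreover have "Xs \<in> set_tuples B V" using set_tuples_mono[OF assms(1)] Xs(1) by (rule subsetD)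
  ultimately show "Xs \<in> {Xs \<in> set_tuples B V. \<Union>(set Xs) = S}" by simp
qed

lemma prod_sum_set_tuples:
  fixes f :: "nat \<Rightarrow> 'a set \<Rightarrow> 'c :: comm_semiring_1"
  assumes "finite V"
  shows "(\<Prod>i<length B. \<Sum>X | X \<subseteq> V \<and> card X = B ! i. f i X) = (\<Sum>Xs\<in>set_tuples B V. \<Prod>i<length B. f i (Xs ! i))"
proof -
  let ?l = "length B"
  let ?D = "\<lambda>i. {X. X \<subseteq> V \<and> card X = B ! i}"
  have "(\<Prod>i<?l. \<Sum>X\<in>?D i. f i X) = (\<Sum>g\<in>(\<Pi>\<^sub>E i\<in>{..<?l}. ?D i). \<Prod>i<?l. f i (g i))"
    using assms by (intro prod_sum_PiE) auto
  also have "\<dots> = (\<Sum>Xs\<in>set_tuples B V. \<Prod>i<?l. f i (restrict (\<lambda>j. Xs ! j) {..<?l} i))"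
  proof (rule sum.reindex_bij_betw[symmetric])
    show "bij_betw (\<lambda>Xs. restrict (\<lambda>j. Xs ! j) {..<?l}) (set_tuples B V) (\<Pi>\<^sub>E i\<in>{..<?l}. ?D i)"
    proof (rule bij_betw_byWitness[where f' = "\<lambda>g. map g [0..<?l]"])
      show "\<forall>Xs\<in>set_tuples B V. map (restrict (\<lambda>j. Xs ! j) {..<?l}) [0..<?l] = Xs"
        by (auto simp: set_tuples_def intro!: nth_equalityI)
      show "\<forall>g\<in>(\<Pi>\<^sub>E i\<in>{..<?l}. ?D i). restrict (\<lambda>j. map g [0..<?l] ! j) {..<?l} = g"
        by (auto simp: PiE_def extensional_def fun_eq_iff)
      show "(\<lambda>Xs. restrict (\<lambda>j. Xs ! j) {..<?l}) ` set_tuples B V \<subseteq> (\<Pi>\<^sub>E i\<in>{..<?l}. ?D i)"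
        unfolding set_tuples_def by (intro image_subsetI restrict_PiE_iff[THEN iffD2] ballI) simp
      show "(\<lambda>g. map g [0..<?l]) ` (\<Pi>\<^sub>E i\<in>{..<?l}. ?D i) \<subseteq> set_tuples B V"
      proof (rule image_subsetI)
        fix g assume "g \<in> (\<Pi>\<^sub>E i\<in>{..<?l}. ?D i)"
        from PiE_mem[OF this] have "g j \<in> ?D j" if "j < ?l" for j using that by simp
        then show "map g [0..<?l] \<in> set_tuples B V" by (simp add: set_tuples_def)
      qed
    qed
  qed
  finally show ?thesis by simp
qed

text \<open>Tuples are grouped by their union S; inside S they are those with full union, so only T
  at m equal to the order occurs. The second equation gives the sums of that case as products, ready
  for inversion.\<close>

lemma T_eq_sum_T:
  assumes "simple_graph G" "length A = length B"
  shows "T m A B G = (\<Sum>S | S \<subseteq> verts G \<and> card S = m. T (v (induced G S)) A B (induced G S))"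
    and "(\<Prod>i<length A. \<Sum>X | X \<subseteq> verts G \<and> card X = B ! i. con (A ! i) (induced G X)) =
      (\<Sum>S\<in>Pow (verts G). T (v (induced G S)) A B (induced G S))"
proof -
  let ?V = "verts G"
  let ?w = "\<lambda>Xs. \<Prod>i<length A. con (A ! i) (induced G (Xs ! i))"
  have fin: "finite ?V" using assms(1) by simp
  have T: "T m A B K = (\<Sum>Xs\<in>{Xs \<in> set_tuples B (verts K). card (\<Union>(set Xs)) = m}.
      \<Prod>i<length A. con (A ! i) (induced K (Xs ! i)))" for m and K :: "'a graph"
    unfolding T_def set_tuples_def by (simp add: conj_assoc)
  have U: "(\<Sum>Xs\<in>{Xs \<in> set_tuples B ?V. \<Union>(set Xs) = S}. ?w Xs) = T (v (induced G S)) A B (induced G S)"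
    if "S \<subseteq> ?V" for S
    unfolding T set_tuples_with_union[OF that fin] verts_induced v_induced
  proof (intro sum.cong prod.cong refl)
    fix Xs i assume "Xs \<in> {Xs \<in> set_tuples B S. card (\<Union>(set Xs)) = card S}" "i \<in> {..<length A}"
    then have "Xs ! i \<subseteq> S" using assms(2) by (simp add: set_tuples_def)
    then show "con (A ! i) (induced G (Xs ! i)) = con (A ! i) (induced (induced G S) (Xs ! i))"
      by (simp add: induced_induced)
  qed
  have fm: "finite {Xs \<in> set_tuples B ?V. card (\<Union>(set Xs)) = m}" using finite_set_tuples[OF fin] by simp
  have fS: "finite {S. S \<subseteq> ?V \<and> card S = m}" using fin by simp
  have im: "(\<lambda>Xs. \<Union>(set Xs)) ` {Xs \<in> set_tuples B ?V. card (\<Union>(set Xs)) = m} \<subseteq> {S. S \<subseteq> ?V \<and> card S = m}"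
    using set_tuples_Union by blast
  have "T m A B G = (\<Sum>S | S \<subseteq> ?V \<and> card S = m. \<Sum>Xs\<in>{Xs \<in> {Xs \<in> set_tuples B ?V. card (\<Union>(set Xs)) = m}. \<Union>(set Xs) = S}. ?w Xs)"
    unfolding T by (rule sum.group[OF fm fS im, symmetric])
  also have "\<dots> = (\<Sum>S | S \<subseteq> ?V \<and> card S = m. T (v (induced G S)) A B (induced G S))"
  proof (rule sum.cong[OF refl])
    fix S assume S: "S \<in> {S. S \<subseteq> ?V \<and> card S = m}"
    then have "{Xs \<in> {Xs \<in> set_tuples B ?V. card (\<Union>(set Xs)) = m}. \<Union>(set Xs) = S} = {Xs \<in> set_tuples B ?V. \<Union>(set Xs) = S}"
      by auto
    then show "(\<Sum>Xs\<in>{Xs \<in> {Xs \<in> set_tuples B ?V. card (\<Union>(set Xs)) = m}. \<Union>(set Xs) = S}. ?w Xs) =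
        T (v (induced G S)) A B (induced G S)" using U S by simp
  qed
  finally show "T m A B G = (\<Sum>S | S \<subseteq> ?V \<and> card S = m. T (v (induced G S)) A B (induced G S))" .
  have "(\<Prod>i<length A. \<Sum>X | X \<subseteq> ?V \<and> card X = B ! i. con (A ! i) (induced G X)) =
      (\<Sum>Xs\<in>set_tuples B ?V. ?w Xs)"
    unfolding assms(2) by (rule prod_sum_set_tuples[OF fin])
  also have "\<dots> = (\<Sum>S\<in>Pow ?V. \<Sum>Xs\<in>{Xs \<in> set_tuples B ?V. \<Union>(set Xs) = S}. ?w Xs)"
  proof (rule sum.group[symmetric])
    show "(\<lambda>Xs. \<Union>(set Xs)) ` set_tuples B ?V \<subseteq> Pow ?V" using set_tuples_Union by blast
  qed (use fin in \<open>simp_all add: finite_set_tuples\<close>)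
  also have "\<dots> = (\<Sum>S\<in>Pow ?V. T (v (induced G S)) A B (induced G S))"
    using U by (intro sum.cong refl) blast
  finally show "(\<Prod>i<length A. \<Sum>X | X \<subseteq> ?V \<and> card X = B ! i. con (A ! i) (induced G X)) =
      (\<Sum>S\<in>Pow ?V. T (v (induced G S)) A B (induced G S))" .
qed

text \<open>In this form each summand is a function of the induced subgraph on S.\<close>

lemma Q_eq_sum:
  "Q m A B K = (\<Sum>S | S \<subseteq> verts K \<and> card S = m.
    \<Prod>i<length A. \<Sum>X | X \<subseteq> verts (induced K S) \<and> card X = B ! i. con (A ! i) (induced (induced K S) X))"
  unfolding Q_def by (intro sum.cong prod.cong refl) (simp_all add: induced_induced)

context matching
begin

lemma agrees_con: "set A \<subseteq> {2..} \<Longrightarrow> agrees n (con A) (con A)"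
  unfolding con_eq_card_connecting
proof (rule agrees_connecting)
  assume "set A \<subseteq> {2..}"
  then show "2 \<le> A ! j" if "j \<in> {..<length A}" for j
    using that subsetD[OF \<open>set A \<subseteq> {2..}\<close> nth_mem[of j A]] by simp
  then show "agrees n (num_cycles (A ! j)) (num_cycles (A ! j))" if "j \<in> {..<length A}" for j
    using that by (intro agrees_num_cycles)
qed simp

lemma agrees_prod_con:
  assumes "\<forall>a\<in>set A. set a \<subseteq> {2..}"
  shows "agrees n (\<lambda>K. \<Prod>i<length A. \<Sum>X | X \<subseteq> verts K \<and> card X = B ! i. con (A ! i) (induced K X))
    (\<lambda>K. \<Prod>i<length A. \<Sum>X | X \<subseteq> verts K \<and> card X = B ! i. con (A ! i) (induced K X))"
proof (rule agreesI)
  fix K K' assume K: "R K K'" "v K \<le> n"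
  show "(\<Prod>i<length A. \<Sum>X | X \<subseteq> verts K \<and> card X = B ! i. con (A ! i) (induced K X)) =
      (\<Prod>i<length A. \<Sum>X | X \<subseteq> verts K' \<and> card X = B ! i. con (A ! i) (induced K' X))"
    using assms by (intro prod.cong refl agreesD[OF agrees_sum_card K] agrees_con) simp
qed

lemma agrees_Q:
  assumes "\<forall>a\<in>set A. set a \<subseteq> {2..}" shows "agrees n (Q m A B) (Q m A B)"
proof -
  note agr = agrees_sum_card[OF agrees_prod_con[OF assms, of n B], of m]
  show ?thesis
  proof (rule agreesI)
    fix K K' assume K: "R K K'" "v K \<le> n"
    show "Q m A B K = Q m A B K'" unfolding Q_eq_sum by (rule agreesD[OF agr K])
  qed
qed

text \<open>Inversion gives the case where m is the order; the general case sums it over the subsets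
  of size m.\<close>

lemma agrees_T:
  assumes "\<forall>a\<in>set A. set a \<subseteq> {2..}" "length A = length B" shows "agrees n (T m A B) (T m A B)"
proof -
  have "agrees n (\<lambda>K. T (v K) A B K) (\<lambda>K. T (v K) A B K)"
  proof (rule agrees_if_sum_Pow, rule agreesI)
    fix K K' assume K: "R K K'" "v K \<le> n"
    show "(\<Sum>S\<in>Pow (verts K). T (v (induced K S)) A B (induced K S)) =
        (\<Sum>S\<in>Pow (verts K'). T (v (induced K' S)) A B (induced K' S))"
      unfolding T_eq_sum_T(2)[OF R_simpleD(1)[OF K(1)] assms(2), symmetric]
        T_eq_sum_T(2)[OF R_simpleD(2)[OF K(1)] assms(2), symmetric]
      by (rule agreesD[OF agrees_prod_con[OF assms(1)] K])
  qed
  note agr = agrees_sum_card[OF this, of m]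
  show ?thesis
  proof (rule agreesI)
    fix K K' assume K: "R K K'" "v K \<le> n"
    show "T m A B K = T m A B K'"
      using agreesD[OF agr K] T_eq_sum_T(1)[OF R_simpleD(1)[OF K(1)] assms(2), of m]
        T_eq_sum_T(1)[OF R_simpleD(2)[OF K(1)] assms(2), of m] by (simp only:)
  qed
qed

lemma agrees_num_unicyclic:
  assumes "3 \<le> i" shows "agrees n (num_unicyclic i) (num_unicyclic i)"
proof -
  have "agrees n (\<lambda>K. card (cycle_pairs i (v K) K)) (\<lambda>K. card (cycle_pairs i (v K) K))"
  proof (rule agreesI)
    fix K K' assume K: "R K K'" "v K \<le> n"
    show "card (cycle_pairs i (v K) K) = card (cycle_pairs i (v K') K')"
      unfolding R_order[OF K(1), symmetric]
      using assms by (intro agreesD[OF agrees_cycle_pairs K] agrees_num_cycles) simp_all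
  qed
  note agr = agrees_sum_Pow[OF this, unfolded v_induced]
  show ?thesis
  proof (rule agreesI)
    fix K K' assume K: "R K K'" "v K \<le> n"
    show "num_unicyclic i K = num_unicyclic i K'"
      unfolding num_unicyclic_eq[OF R_simpleD(1)[OF K(1)] assms] num_unicyclic_eq[OF R_simpleD(2)[OF K(1)] assms]
      by (rule agreesD[OF agr K])
  qed
qed

end

subsection \<open>The matrix determines the matching\<close>

lemma iso_sym:
  assumes "A \<simeq> B" "\<Union>(edges A) \<subseteq> verts A"
  shows "B \<simeq> A"
proof -
  obtain f where f: "bij_betw f (verts A) (verts B)" "(\<lambda>e. f ` e) ` edges A = edges B"
    using assms(1) by (auto simp: isomorphic_def)
  define g where "g = inv_into (verts A) f"
  have g: "bij_betw g (verts B) (verts A)" using f(1) by (simp add: g_def bij_betw_inv_into)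
  have gf: "g (f x) = x" if "x \<in> verts A" for x
    using f(1) that by (simp add: g_def bij_betw_inv_into_left)
  have "g ` (f ` e) = e" if "e \<in> edges A" for e
  proof -
    have "g (f x) = x" if "x \<in> e" for x using gf that \<open>e \<in> edges A\<close> assms(2) by blast
    then show ?thesis by (simp add: image_image)
  qed
  then have "(\<lambda>e. g ` e) ` edges B = edges A" unfolding f(2)[symmetric] image_image by simp
  with g show ?thesis by (auto simp: isomorphic_def)
qed

lemma iso_trans:
  assumes "A \<simeq> B" "B \<simeq> D" shows "A \<simeq> D"
proof -
  obtain f where f: "bij_betw f (verts A) (verts B)" "(\<lambda>e. f ` e) ` edges A = edges B"
    using assms(1) by (auto simp: isomorphic_def)
  obtain g where g: "bij_betw g (verts B) (verts D)" "(\<lambda>e. g ` e) ` edges B = edges D"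
    using assms(2) by (auto simp: isomorphic_def)
  have "bij_betw (g \<circ> f) (verts A) (verts D)" using f(1) g(1) by (rule bij_betw_trans)
  moreover have "(\<lambda>e. (g \<circ> f) ` e) ` edges A = edges D"
    unfolding g(2)[symmetric] f(2)[symmetric] by (simp add: image_image image_comp)
  ultimately show ?thesis unfolding isomorphic_def by blast
qed

lemma iso_order: "A \<simeq> B \<Longrightarrow> v A = v B"
  by (auto simp: isomorphic_def v_def bij_betw_same_card)

lemma iso_edges_empty: "A \<simeq> B \<Longrightarrow> edges A = {} \<longleftrightarrow> edges B = {}"
  by (auto simp: isomorphic_def)

lemma Union_edges_induced: "\<Union>(edges (induced G X)) \<subseteq> verts (induced G X)"
  by (auto simp: edges_induced)

lemma induced_iso_image:
  assumes f: "bij_betw f (verts A) (verts B)" "(\<lambda>e. f ` e) ` edges A = edges B"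
    and A: "\<Union>(edges A) \<subseteq> verts A" and X: "X \<subseteq> verts A"
  shows "induced A X \<simeq> induced B (f ` X)"
proof -
  have inj: "inj_on f (verts A)" using f(1) by (simp add: bij_betw_def)
  have iff: "f ` e \<subseteq> f ` X \<longleftrightarrow> e \<subseteq> X" if "e \<in> edges A" for e
  proof -
    have "f x \<in> f ` X \<longleftrightarrow> x \<in> X" if "x \<in> e" for x
      using that \<open>e \<in> edges A\<close> A by (intro inj_on_image_mem_iff[OF inj _ X]) blast
    then show ?thesis by blast
  qed
  have "(\<lambda>e. f ` e) ` {e \<in> edges A. e \<subseteq> X} = {e \<in> (\<lambda>e. f ` e) ` edges A. e \<subseteq> f ` X}"
    using iff by blast
  moreover have "bij_betw f X (f ` X)" using inj X by (auto simp: bij_betw_def inj_on_subset)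
  ultimately show ?thesis unfolding isomorphic_def edges_induced verts_induced f(2) by blast
qed

lemma induced_count_cong:
  assumes iso: "A \<simeq> B" and A: "\<Union>(edges A) \<subseteq> verts A"
  shows "induced_count A F = induced_count B F"
proof -
  obtain f where f: "bij_betw f (verts A) (verts B)" "(\<lambda>e. f ` e) ` edges A = edges B"
    using iso by (auto simp: isomorphic_def)
  have "induced A X \<simeq> F \<longleftrightarrow> induced B (f ` X) \<simeq> F" if "X \<subseteq> verts A" for X
    using induced_iso_image[OF f A that] iso_sym[OF _ Union_edges_induced] iso_trans by metis
  then have "bij_betw (\<lambda>X. f ` X) {X \<in> Pow (verts A). induced A X \<simeq> F} {Y \<in> Pow (verts B). induced B Y \<simeq> F}"
    by (intro bij_betw_Collect[OF bij_betw_Pow[OF f(1)]]) blast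
  then show ?thesis unfolding induced_count_def by (simp add: bij_betw_same_card)
qed

section \<open>Types of induced subgraphs with an edge\<close>

text \<open>These are the vertex sets that the matrix records.\<close>

definition edged :: "'a graph \<Rightarrow> 'a set \<Rightarrow> bool" where
  "edged G X \<longleftrightarrow> X \<subseteq> verts G \<and> edges (induced G X) \<noteq> {}"

definition type_index :: "'a graph list \<Rightarrow> 'a graph \<Rightarrow> 'a set \<Rightarrow> nat" where
  "type_index L G X = (THE i. i < length L \<and> induced G X \<simeq> L ! i)"

lemma edged_mono: "edged G Y \<Longrightarrow> Y \<subseteq> X \<Longrightarrow> X \<subseteq> verts G \<Longrightarrow> edged G X"
  unfolding edged_def edges_induced by blast

lemma type_index:
  assumes "enumerates_types L G" "edged G X"
  shows "type_index L G X < length L" "induced G X \<simeq> L ! type_index L G X"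
    and "\<And>i. i < length L \<Longrightarrow> induced G X \<simeq> L ! i \<longleftrightarrow> type_index L G X = i"
proof -
  have ex: "\<exists>!i. i < length L \<and> induced G X \<simeq> L ! i"
    using assms by (simp add: enumerates_types_def edged_def)
  show *: "type_index L G X < length L" "induced G X \<simeq> L ! type_index L G X"
    using theI'[OF ex] unfolding type_index_def by auto
  show "induced G X \<simeq> L ! i \<longleftrightarrow> type_index L G X = i" if "i < length L" for i
    using ex * that by blast
qed

lemma type_index_surj:
  assumes "enumerates_types L G" "j < length L"
  obtains X where "edged G X" "type_index L G X = j"
proof -
  obtain X where X: "X \<subseteq> verts G" "L ! j = induced G X" "edges (L ! j) \<noteq> {}"
    using assms nth_mem unfolding enumerates_types_def by metis
  then have e: "edged G X" by (simp add: edged_def)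
  have "induced G X \<simeq> L ! j" unfolding X(2) isomorphic_def by (intro exI[of _ id]) simp
  then show thesis using that[OF e] type_index(3)[OF assms(1) e assms(2)] by blast
qed

text \<open>Isomorphic induced subgraphs have equal order, so neither vertex set can be a proper
  subset of the other.\<close>

lemma edged_subset_eq:
  assumes L: "enumerates_types L G" and G: "simple_graph G"
    and X: "edged G X" "edged G Y" "Y \<subseteq> X" "type_index L G X = type_index L G Y"
  shows "Y = X"
proof -
  have "v (induced G X) = v (induced G Y)"
    using type_index(2)[OF L X(1)] type_index(2)[OF L X(2)] X(4) iso_order by metis
  moreover have "finite X" using G X(1) by (auto simp: edged_def intro: finite_subset)
  ultimately show ?thesis using X(3) by (simp add: card_subset_eq)
qed

text \<open>The number of subsets of X of type j depends only on the type of X, and it is a matrix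
  entry; this is all that the proof takes from the matrix.\<close>

lemma card_type_index:
  assumes L: "enumerates_types L G" and X: "edged G X" and j: "j < length L"
  shows "card {Y. Y \<subseteq> X \<and> edged G Y \<and> type_index L G Y = j} = N_matrix L $$ (type_index L G X, j)"
proof -
  let ?i = "type_index L G X"
  have XV: "X \<subseteq> verts G" using X by (simp add: edged_def)
  have "edges (L ! j) \<noteq> {}" using L j by (auto simp: enumerates_types_def)
  then have ed: "edged G Y" if "Y \<subseteq> X" "induced G Y \<simeq> L ! j" for Y
    using that XV iso_edges_empty by (force simp: edged_def)
  have "{Y. Y \<subseteq> X \<and> edged G Y \<and> type_index L G Y = j} = {Y. Y \<subseteq> X \<and> induced G Y \<simeq> L ! j}"
    using type_index(3)[OF L _ j] ed by blast
  also have "card \<dots> = induced_count (induced G X) (L ! j)"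
    unfolding induced_count_def verts_induced
    by (rule arg_cong[where f = card]) (auto simp: induced_induced)
  also have "\<dots> = induced_count (L ! ?i) (L ! j)"
    by (rule induced_count_cong[OF type_index(2)[OF L X] Union_edges_induced])
  also have "\<dots> = N_matrix L $$ (?i, j)" using type_index(1)[OF L X] j by (simp add: N_matrix_def)
  finally show ?thesis .
qed

text \<open>The order of an induced subgraph is read off from chains of induced subgraphs: unless it is a
  single edge, an induced subgraph with an edge keeps an edge after deleting some vertex.\<close>

lemma card_le_if_matching_counts:
  fixes key :: "'a set \<Rightarrow> 'k" and key' :: "'b set \<Rightarrow> 'k"
  assumes G: "simple_graph G" "simple_graph G'"
    and key: "\<And>X Y. edged G X \<Longrightarrow> edged G Y \<Longrightarrow> Y \<subseteq> X \<Longrightarrow> key X = key Y \<Longrightarrow> Y = X"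
    and count: "\<And>X X' Y. edged G X \<Longrightarrow> edged G' X' \<Longrightarrow> key X = key' X' \<Longrightarrow> edged G Y \<Longrightarrow> Y \<subseteq> X \<Longrightarrow>
      \<exists>Y'. edged G' Y' \<and> Y' \<subseteq> X' \<and> key' Y' = key Y"
  shows "edged G X \<Longrightarrow> edged G' X' \<Longrightarrow> key X = key' X' \<Longrightarrow> card X \<le> card X'"
proof (induction "card X" arbitrary: X X' rule: less_induct)
  case less
  have fin: "finite X" "finite X'" using less.prems G by (auto simp: edged_def intro: finite_subset)
  obtain e where e: "e \<in> edges G" "e \<subseteq> X" using less.prems(1) by (auto simp: edged_def edges_induced)
  then have e2: "card e = 2" using G by (simp add: simple_graph_def)
  obtain e' where "e' \<in> edges G'" "e' \<subseteq> X'" using less.prems(2) by (auto simp: edged_def edges_induced)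
  then have X'2: "2 \<le> card X'" using G card_mono[OF fin(2), of e'] by (simp add: simple_graph_def)
  show ?case
  proof (cases "X = e")
    case True
    then show ?thesis using e2 X'2 by simp
  next
    case False
    then obtain z where z: "z \<in> X" "z \<notin> e" using e by blast
    define Y where "Y = X - {z}"
    have "e \<subseteq> Y" using e z by (auto simp: Y_def)
    moreover have "Suc (card Y) = card X" unfolding Y_def using fin(1) z(1) by (rule card_Suc_Diff1)
    ultimately have Y: "edged G Y" "Y \<subseteq> X" "Suc (card Y) = card X" "Y \<noteq> X"
      using less.prems(1) e z by (auto simp: Y_def edged_def edges_induced)
    obtain Y' where Y': "edged G' Y'" "Y' \<subseteq> X'" "key' Y' = key Y"
      using count[OF less.prems Y(1,2)] by blast
    \<comment> \<open>Different keys force Y' to be a proper subset of X', so each step down in G is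
      matched by a drop in size in G'.\<close>
    have "key X \<noteq> key Y" using key[OF less.prems(1) Y(1,2)] Y(4) by blast
    then have "Y' \<noteq> X'" using Y'(3) less.prems(3) by metis
    then have "card Y' < card X'" using Y'(2) fin(2) by (intro psubset_card_mono) auto
    moreover have "card Y \<le> card Y'" using less.hyps[OF _ Y(1) Y'(1)] Y(3) Y'(3) by simp
    ultimately show ?thesis using Y(3) by simp
  qed
qed

lemma bij_betw_if_card_fibers:
  assumes "finite A" "finite B" "\<And>k. card {a \<in> A. f a = k} = card {b \<in> B. g b = k}"
  shows "\<exists>h. bij_betw h A B \<and> (\<forall>a\<in>A. g (h a) = f a)"
proof -
  have "\<exists>h. bij_betw h {a \<in> A. f a = k} {b \<in> B. g b = k}" for k
    using assms by (intro finite_same_card_bij) auto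
  then obtain h where h: "\<And>k. bij_betw (h k) {a \<in> A. f a = k} {b \<in> B. g b = k}" by metis
  let ?h = "\<lambda>a. h (f a) a"
  have hB: "?h a \<in> B" "g (?h a) = f a" if "a \<in> A" for a
    using bij_betwE[OF h[of "f a"]] that by auto
  have "inj_on ?h A"
  proof (rule inj_onI)
    fix a a' assume a: "a \<in> A" "a' \<in> A" "?h a = ?h a'"
    then have "f a = f a'" using hB by metis
    then show "a = a'" using a h[of "f a"] by (auto simp: bij_betw_def inj_on_def)
  qed
  moreover have "?h ` A = B"
  proof
    show "?h ` A \<subseteq> B" using hB by blast
    show "B \<subseteq> ?h ` A"
    proof
      fix b assume "b \<in> B"
      then have "b \<in> h (g b) ` {a \<in> A. f a = g b}" using h[of "g b"] by (simp add: bij_betw_def)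
      then obtain a where "a \<in> A" "f a = g b" "b = h (g b) a" by blast
      then show "b \<in> ?h ` A" by (intro image_eqI[of _ _ a]) simp_all
    qed
  qed
  ultimately show ?thesis using hB by (auto simp: bij_betw_def)
qed

text \<open>Edgeless induced subgraphs are not recorded by the matrix, but those of a given order are
  counted by a binomial coefficient minus the number of the others.\<close>

lemma matching_if_matching_counts:
  fixes key :: "'a set \<Rightarrow> 'k" and key' :: "'b set \<Rightarrow> 'k"
  assumes G: "simple_graph G" "simple_graph G'"
    and cards: "\<And>X X'. edged G X \<Longrightarrow> edged G' X' \<Longrightarrow> key X = key' X' \<Longrightarrow> card X = card X'"
    and count: "\<And>X X' k. edged G X \<Longrightarrow> edged G' X' \<Longrightarrow> key X = key' X' \<Longrightarrow>
      card {Y. Y \<subseteq> X \<and> edged G Y \<and> key Y = k} = card {Y. Y \<subseteq> X' \<and> edged G' Y \<and> key' Y = k}"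
    and "edged G (verts G)" "edged G' (verts G')" "key (verts G) = key' (verts G')"
  shows "\<exists>R. matching R \<and> R G G'"
proof -
  \<comment> \<open>Sets with an edge are labelled by their type, edgeless ones by their size; the
    sum type keeps the two kinds of labels apart.\<close>
  define K where "K X = (if edged G X then Inl (key X) else Inr (card X))" for X
  define K' where "K' X = (if edged G' X then Inl (key' X) else Inr (card X))" for X
  define R where "R H H' \<longleftrightarrow> (\<exists>X X'. X \<subseteq> verts G \<and> X' \<subseteq> verts G' \<and> K X = K' X' \<and>
    H = induced G X \<and> H' = induced G' X')" for H H'
  have fin: "finite X" "finite X'" if "X \<subseteq> verts G" "X' \<subseteq> verts G'" for X X'
    using that G by (auto intro: finite_subset)
  have K_cases: "edged G X \<and> edged G' X' \<and> key X = key' X' \<or> \<not> edged G X \<and> \<not> edged G' X' \<and> card X = card X'"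
    if "K X = K' X'" for X X'
    using that by (auto simp: K_def K'_def split: if_splits)
  have K_card: "card X = card X'" if "K X = K' X'" for X X' using K_cases[OF that] cards by blast
  have fibers: "card {Y \<in> Pow X. K Y = k} = card {Y \<in> Pow X'. K' Y = k}"
    if X: "X \<subseteq> verts G" "X' \<subseteq> verts G'" "K X = K' X'" for X X' k
  proof -
    have cnt: "card {Y \<in> {Y \<in> Pow X. edged G Y}. key Y = k} = card {Y \<in> {Y \<in> Pow X'. edged G' Y}. key' Y = k}" for k
    proof -
      have "{Y \<in> {Y \<in> Pow X. edged G Y}. key Y = k} = {Y. Y \<subseteq> X \<and> edged G Y \<and> key Y = k}"
        "{Y \<in> {Y \<in> Pow X'. edged G' Y}. key' Y = k} = {Y. Y \<subseteq> X' \<and> edged G' Y \<and> key' Y = k}" by auto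
      moreover have "{Y. Y \<subseteq> X \<and> edged G Y \<and> key Y = k} = {}" if "\<not> edged G X"
        using edged_mono[OF _ _ X(1)] that by blast
      moreover have "{Y. Y \<subseteq> X' \<and> edged G' Y \<and> key' Y = k} = {}" if "\<not> edged G' X'"
        using edged_mono[OF _ _ X(2)] that by blast
      ultimately show ?thesis using K_cases[OF X(3)] count[of X X' k] by (metis (no_types, lifting) card.empty)
    qed
    show ?thesis
    proof (cases k)
      case (Inl q)
      have "{Y \<in> Pow X. K Y = k} = {Y \<in> {Y \<in> Pow X. edged G Y}. key Y = q}"
        "{Y \<in> Pow X'. K' Y = k} = {Y \<in> {Y \<in> Pow X'. edged G' Y}. key' Y = q}"
        using Inl by (auto simp: K_def K'_def split: if_splits)
      then show ?thesis using cnt by simp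
    next
      case (Inr m)
      have finP: "finite {Y \<in> Pow X. edged G Y}" "finite {Y \<in> Pow X'. edged G' Y}" using fin X by auto
      \<comment> \<open>A key-preserving bijection also preserves sizes. So both sides have equally
        many m-subsets with an edge, and the same remains for the edgeless ones.\<close>
      obtain h where h: "bij_betw h {Y \<in> Pow X. edged G Y} {Y \<in> Pow X'. edged G' Y}"
        "\<And>Y. Y \<in> {Y \<in> Pow X. edged G Y} \<Longrightarrow> key' (h Y) = key Y"
        using bij_betw_if_card_fibers[OF finP cnt] by blast
      have hc: "card (h Y) = card Y" if "Y \<in> {Y \<in> Pow X. edged G Y}" for Y
        using cards[of Y "h Y"] h(2)[OF that] bij_betwE[OF h(1)] that by auto
      have "bij_betw h {Y \<in> {Y \<in> Pow X. edged G Y}. card Y = m} {Y \<in> {Y \<in> Pow X'. edged G' Y}. card Y = m}"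
        by (rule bij_betw_Collect[OF h(1)]) (simp add: hc)
      then have eq: "card {Y \<in> {Y \<in> Pow X. edged G Y}. card Y = m} = card {Y \<in> {Y \<in> Pow X'. edged G' Y}. card Y = m}"
        by (rule bij_betw_same_card)
      have "{Y \<in> Pow X. K Y = k} = {Y. Y \<subseteq> X \<and> card Y = m} - {Y \<in> {Y \<in> Pow X. edged G Y}. card Y = m}"
        "{Y \<in> Pow X'. K' Y = k} = {Y. Y \<subseteq> X' \<and> card Y = m} - {Y \<in> {Y \<in> Pow X'. edged G' Y}. card Y = m}"
        using Inr by (auto simp: K_def K'_def split: if_splits)
      moreover have "card ({Y. Y \<subseteq> X \<and> card Y = m} - {Y \<in> {Y \<in> Pow X. edged G Y}. card Y = m}) =
          (card X choose m) - card {Y \<in> {Y \<in> Pow X. edged G Y}. card Y = m}"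
        using finP fin X n_subsets[of X m] by (subst card_Diff_subset) auto
      moreover have "card ({Y. Y \<subseteq> X' \<and> card Y = m} - {Y \<in> {Y \<in> Pow X'. edged G' Y}. card Y = m}) =
          (card X' choose m) - card {Y \<in> {Y \<in> Pow X'. edged G' Y}. card Y = m}"
        using finP fin X n_subsets[of X' m] by (subst card_Diff_subset) auto
      ultimately show ?thesis using eq K_card[OF X(3)] by simp
    qed
  qed
  have "matching R"
  proof
    fix H H' assume "R H H'"
    then obtain X X' where X: "X \<subseteq> verts G" "X' \<subseteq> verts G'" "K X = K' X'"
      and H: "H = induced G X" "H' = induced G' X'" unfolding R_def by blast
    show "simple_graph H \<and> simple_graph H'" using X H G by (simp add: simple_induced)
    show "(edges H = {}) = (edges H' = {})" using K_cases[OF X(3)] X(1,2) unfolding H edged_def by blast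
    obtain \<phi> where \<phi>: "bij_betw \<phi> (Pow X) (Pow X')" "\<And>Y. Y \<in> Pow X \<Longrightarrow> K' (\<phi> Y) = K Y"
      using bij_betw_if_card_fibers[OF _ _ fibers[OF X]] fin[OF X(1,2)] by (meson finite_Pow_iff)
    have "card (\<phi> Y) = card Y \<and> R (induced H Y) (induced H' (\<phi> Y))" if "Y \<subseteq> verts H" for Y
    proof -
      have "Y \<in> Pow X" using that H by simp
      then have Y: "Y \<subseteq> X" "\<phi> Y \<subseteq> X'" "K Y = K' (\<phi> Y)"
        using \<phi>(2)[of Y] bij_betwE[OF \<phi>(1)] by auto
      have "R (induced G Y) (induced G' (\<phi> Y))" unfolding R_def
        by (intro exI[of _ Y] exI[of _ "\<phi> Y"] conjI refl Y(3) subset_trans[OF Y(1) X(1)] subset_trans[OF Y(2) X(2)])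
      then show ?thesis
        unfolding H induced_induced[OF Y(1)] induced_induced[OF Y(2)] by (rule conjI[OF K_card[OF Y(3), symmetric]])
    qed
    then show "\<exists>\<phi>. bij_betw \<phi> (Pow (verts H)) (Pow (verts H')) \<and>
        (\<forall>X\<subseteq>verts H. card (\<phi> X) = card X \<and> R (induced H X) (induced H' (\<phi> X)))"
      using \<phi>(1) unfolding H verts_induced by blast
  qed
  moreover have "R G G'" unfolding R_def
    using assms(5-7) G by (intro exI[of _ "verts G"] exI[of _ "verts G'"]) (simp add: K_def K'_def induced_verts)
  ultimately show ?thesis by blast
qed

lemma finite_edged: "simple_graph G \<Longrightarrow> finite {Y. Y \<subseteq> X \<and> edged G Y \<and> P Y}"
  by (rule finite_subset[of _ "Pow (verts G)"]) (auto simp: edged_def)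

lemma Collect_ex_if_card_eq:
  assumes "finite {x. A x}" "A a" "card {x. A x} = card {x. B x}"
  shows "\<exists>x. B x"
proof -
  have "card {x. A x} \<noteq> 0" using assms(1,2) by auto
  then have "{x. B x} \<noteq> {}" unfolding assms(3) by (rule contrapos_nn) (simp only: card.empty)
  then show ?thesis by simp
qed

lemma matching_if_same_N:
  assumes G: "simple_graph G" "edges G \<noteq> {}" "simple_graph G'" "edges G' \<noteq> {}"
    and N: "same_N G G'"
  shows "\<exists>R. matching R \<and> R G G'"
proof -
  obtain L L' where L: "enumerates_types L G" and L': "enumerates_types L' G'"
    and eq: "equal_up_to_permutation (N_matrix L) (N_matrix L')" using N by (auto simp: same_N_def)
  define n where "n = length L"
  have n': "length L' = n" using eq by (simp add: equal_up_to_permutation_def N_matrix_def n_def)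
  obtain p where p: "p permutes {..<n}"
    and pN: "\<And>i j. i < n \<Longrightarrow> j < n \<Longrightarrow> N_matrix L $$ (i, j) = N_matrix L' $$ (p i, p j)"
    using eq by (auto simp: equal_up_to_permutation_def N_matrix_def n_def)
  have p_lt: "p i < n \<longleftrightarrow> i < n" for i using permutes_in_image[OF p, of i] by simp
  have p_inj: "p i = p j \<longleftrightarrow> i = j" for i j using permutes_inj[OF p] by (auto dest: injD)
  \<comment> \<open>The permutation is built into \<open>key\<close>, so that both graphs are
    labelled by the rows of the second matrix.\<close>
  define key where "key X = p (type_index L G X)" for X
  define key' where "key' X = type_index L' G' X" for X
  have key_lt: "key X < n" if "edged G X" for X
    using type_index(1)[OF L that] p_lt by (simp add: key_def n_def)
  have key'_lt: "key' X < n" if "edged G' X" for X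
    using type_index(1)[OF L' that] by (simp add: key'_def n')
  have count: "card {Y. Y \<subseteq> X \<and> edged G Y \<and> key Y = k} = card {Y. Y \<subseteq> X' \<and> edged G' Y \<and> key' Y = k}"
    if X: "edged G X" "edged G' X'" "key X = key' X'" for X X' k
  proof (cases "k < n")
    case True
    obtain j where j: "p j = k" using permutes_surj[OF p] by (metis surjD)
    then have jn: "j < n" using True p_lt by blast
    have "{Y. Y \<subseteq> X \<and> edged G Y \<and> key Y = k} = {Y. Y \<subseteq> X \<and> edged G Y \<and> type_index L G Y = j}"
      unfolding key_def j[symmetric] p_inj ..
    also have "card \<dots> = N_matrix L $$ (type_index L G X, j)"
      using card_type_index[OF L X(1), of j] jn n_def by simp
    also have "\<dots> = N_matrix L' $$ (type_index L' G' X', k)"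
      using pN[OF type_index(1)[OF L X(1), folded n_def] jn] j X(3) by (simp add: key_def key'_def)
    also have "\<dots> = card {Y. Y \<subseteq> X' \<and> edged G' Y \<and> key' Y = k}"
      using card_type_index[OF L' X(2), of k] True n' by (simp add: key'_def)
    finally show ?thesis .
  next
    case False
    then have "{Y. Y \<subseteq> X \<and> edged G Y \<and> key Y = k} = {}" "{Y. Y \<subseteq> X' \<and> edged G' Y \<and> key' Y = k} = {}"
      using key_lt key'_lt by auto
    then show ?thesis by (simp only: card.empty)
  qed
  have ex': "\<exists>Y'. edged G' Y' \<and> Y' \<subseteq> X' \<and> key' Y' = key Y"
    if X: "edged G X" "edged G' X'" "key X = key' X'" and Y: "edged G Y" "Y \<subseteq> X" for X X' Y
    using Collect_ex_if_card_eq[OF _ _ count[OF X, of "key Y"], of Y] finite_edged[OF G(1), of X] Y by auto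
  have ex: "\<exists>Z. edged G Z \<and> Z \<subseteq> X \<and> key Z = key' Y"
    if X: "edged G' X'" "edged G X" "key' X' = key X" and Y: "edged G' Y" "Y \<subseteq> X'" for X X' Y
    using Collect_ex_if_card_eq[OF _ _ count[OF X(2,1) X(3)[symmetric], of "key' Y", symmetric], of Y]
      finite_edged[OF G(3), of X'] Y by auto
  have key_sub: "Y = X" if "edged G X" "edged G Y" "Y \<subseteq> X" "key X = key Y" for X Y
    using edged_subset_eq[OF L G(1) that(1-3)] that(4) by (simp add: key_def p_inj)
  have key'_sub: "Y = X" if "edged G' X" "edged G' Y" "Y \<subseteq> X" "key' X = key' Y" for X Y
    using edged_subset_eq[OF L' G(3) that(1-3)] that(4) by (simp add: key'_def)
  have cards: "card X = card X'" if X: "edged G X" "edged G' X'" "key X = key' X'" for X X'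
  proof (rule antisym)
    show "card X \<le> card X'"
    proof (rule card_le_if_matching_counts[where key = key and key' = key'])
      show "Y = X" if "edged G X" "edged G Y" "Y \<subseteq> X" "key X = key Y" for X Y
        using that by (rule key_sub)
      show "\<exists>Y'. edged G' Y' \<and> Y' \<subseteq> X' \<and> key' Y' = key Y"
        if "edged G X" "edged G' X'" "key X = key' X'" "edged G Y" "Y \<subseteq> X" for X X' Y
        using that by (rule ex')
    qed (rule G X)+
    show "card X' \<le> card X"
    proof (rule card_le_if_matching_counts[where key = key' and key' = key])
      show "Y = X" if "edged G' X" "edged G' Y" "Y \<subseteq> X" "key' X = key' Y" for X Y
        using that by (rule key'_sub)
      show "\<exists>Z. edged G Z \<and> Z \<subseteq> X \<and> key Z = key' Y"
        if "edged G' X'" "edged G X" "key' X' = key X" "edged G' Y" "Y \<subseteq> X'" for X X' Y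
        using that by (rule ex)
    qed (rule G X X(3)[symmetric])+
  qed
  have top: "edged G (verts G)" "edged G' (verts G')" using G by (simp_all add: edged_def induced_verts)
  text \<open>The type of \<open>G\<close> itself is the only one that contains all others.\<close>
  have "key (verts G) = key' (verts G')"
  proof -
    obtain X' where X': "edged G' X'" "key' X' = key (verts G)"
      using type_index_surj[OF L', of "key (verts G)"] key_lt[OF top(1)] n' by (auto simp: key'_def)
    obtain j where j: "p j = key' (verts G')" using permutes_surj[OF p] by (metis surjD)
    then have "j < n" using key'_lt[OF top(2)] p_lt by metis
    then obtain Y where Y: "edged G Y" "key Y = key' (verts G')"
      using type_index_surj[OF L, of j] j by (auto simp: key_def n_def)
    then have "Y \<subseteq> verts G" by (simp add: edged_def)
    from ex'[OF top(1) X'(1) X'(2)[symmetric] Y(1) this]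
    obtain Y' where Y': "edged G' Y'" "Y' \<subseteq> X'" "key' Y' = key' (verts G')" using Y(2) by auto
    have "Y' = verts G'"
      using Y' by (intro key'_sub[OF top(2)]) (simp_all add: edged_def)
    then have "X' = verts G'" using Y'(2) X'(1) by (auto simp: edged_def)
    then show ?thesis using X'(2) by simp
  qed
  note top = top this
  show ?thesis
  proof (rule matching_if_matching_counts[where key = key and key' = key'])
    show "card X = card X'" if "edged G X" "edged G' X'" "key X = key' X'" for X X'
      using that by (rule cards)
    show "card {Y. Y \<subseteq> X \<and> edged G Y \<and> key Y = k} = card {Y. Y \<subseteq> X' \<and> edged G' Y \<and> key' Y = k}"
      if "edged G X" "edged G' X'" "key X = key' X'" for X X' k
      using that by (rule count)
  qed (rule G top)+
qed

subsection \<open>The characteristic polynomial\<close>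

text \<open>The determinant for rows and columns indexed by a finite set; it needs no order of the
  vertices.\<close>

definition leibniz :: "'a set \<Rightarrow> ('a \<Rightarrow> 'a \<Rightarrow> 'c :: comm_ring_1) \<Rightarrow> 'c" where
  "leibniz V B = (\<Sum>p | p permutes V. of_int (sign p) * (\<Prod>x\<in>V. B x (p x)))"

text \<open>On a one-element set the identity is cyclic, so diagonal entries count as cycles of
  length 1. On the empty set no permutation is cyclic and the sum is 0.\<close>

definition cyclic_leibniz :: "'a set \<Rightarrow> ('a \<Rightarrow> 'a \<Rightarrow> 'c :: comm_ring_1) \<Rightarrow> 'c" where
  "cyclic_leibniz V B = (\<Sum>p | p permutes V \<and> cyclic_on p V. of_int (sign p) * (\<Prod>x\<in>V. B x (p x)))"

lemma leibniz_cong: "(\<And>x y. x \<in> V \<Longrightarrow> y \<in> V \<Longrightarrow> B x y = B' x y) \<Longrightarrow> leibniz V B = leibniz V B'"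
  unfolding leibniz_def by (intro sum.cong refl arg_cong2[where f = "(*)"] prod.cong) (simp add: permutes_in_image)

lemma cyclic_leibniz_cong:
  "(\<And>x y. x \<in> V \<Longrightarrow> y \<in> V \<Longrightarrow> B x y = B' x y) \<Longrightarrow> cyclic_leibniz V B = cyclic_leibniz V B'"
  unfolding cyclic_leibniz_def by (intro sum.cong refl arg_cong2[where f = "(*)"] prod.cong) (simp add: permutes_in_image)

lemma bij_betw_map_permutation:
  assumes f: "bij_betw f A A'"
  shows "bij_betw (map_permutation A f) {p. p permutes A} {p. p permutes A'}"
proof -
  define g where "g = inv_into A f"
  have g: "bij_betw g A' A" using f by (simp add: g_def bij_betw_inv_into)
  have gf: "\<And>x. x \<in> A \<Longrightarrow> g (f x) = x" and fg: "\<And>x. x \<in> A' \<Longrightarrow> f (g x) = x"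
    using f by (simp_all add: g_def bij_betw_inv_into_left bij_betw_inv_into_right)
  show ?thesis
  proof (rule bij_betw_byWitness[where f' = "map_permutation A' g"])
    show "\<forall>p\<in>{p. p permutes A}. map_permutation A' g (map_permutation A f p) = p"
      using map_permutation_compose_inv[OF f _ gf] by blast
    show "\<forall>p\<in>{p. p permutes A'}. map_permutation A f (map_permutation A' g p) = p"
      using map_permutation_compose_inv[OF g _ fg] by blast
    show "map_permutation A f ` {p. p permutes A} \<subseteq> {p. p permutes A'}"
      using map_permutation_permutes[OF f] by blast
    show "map_permutation A' g ` {p. p permutes A'} \<subseteq> {p. p permutes A}"
      using map_permutation_permutes[OF g] by blast
  qed
qed

lemma leibniz_reindex:
  assumes f: "bij_betw f A A'" and fin: "finite A"
  shows "leibniz A' B = leibniz A (\<lambda>x y. B (f x) (f y))"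
proof -
  have inj: "inj_on f A" using f by (simp add: bij_betw_def)
  have "leibniz A' B = (\<Sum>p\<in>{p. p permutes A}. of_int (sign (map_permutation A f p)) *
      (\<Prod>x\<in>A'. B x (map_permutation A f p x)))"
    unfolding leibniz_def by (rule sum.reindex_bij_betw[OF bij_betw_map_permutation[OF f], symmetric])
  also have "\<dots> = leibniz A (\<lambda>x y. B (f x) (f y))"
    unfolding leibniz_def
  proof (rule sum.cong[OF refl])
    fix p assume "p \<in> {p. p permutes A}"
    then have p: "p permutes A" by simp
    have "(\<Prod>x\<in>A'. B x (map_permutation A f p x)) = (\<Prod>x\<in>A. B (f x) (map_permutation A f p (f x)))"
      by (rule prod.reindex_bij_betw[OF f, symmetric])
    also have "\<dots> = (\<Prod>x\<in>A. B (f x) (f (p x)))"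
      by (intro prod.cong refl) (simp add: map_permutation_apply[OF inj])
    finally show "of_int (sign (map_permutation A f p)) * (\<Prod>x\<in>A'. B x (map_permutation A f p x)) =
        of_int (sign p) * (\<Prod>x\<in>A. B (f x) (f (p x)))"
      by (simp only: sign_map_permutation[OF inj p fin])
  qed
  finally show ?thesis .
qed

text \<open>The cycle through r is split off. Since q and s move points of disjoint sets only, their
  composition acts as q on X and as s on V - X.\<close>

lemma bij_betw_permutation_split:
  assumes V: "finite V" and X: "X \<subseteq> V" and r: "r \<in> X"
  shows "bij_betw (\<lambda>(q, s). q \<circ> s) ({q. q permutes X \<and> cyclic_on q X} \<times> {s. s permutes V - X})
    {p. p permutes V \<and> orbit p r = X}"
proof (rule bij_betw_byWitness[where f' = "\<lambda>p. (perm_restrict p X, perm_restrict p (V - X))"])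
  let ?A = "{q. q permutes X \<and> cyclic_on q X} \<times> {s. s permutes V - X}"
  let ?P = "{p. p permutes V \<and> orbit p r = X}"
  show "\<forall>qs\<in>?A. (perm_restrict ((\<lambda>(q, s). q \<circ> s) qs) X, perm_restrict ((\<lambda>(q, s). q \<circ> s) qs) (V - X)) = qs"
  proof clarify
    fix q s assume q: "q permutes X" and s: "s permutes V - X"
    have "perm_restrict (q \<circ> s) X x = q x" for x
      using permutes_not_in[OF s, of x] permutes_not_in[OF q, of x] by (simp add: perm_restrict_def)
    moreover have "perm_restrict (q \<circ> s) (V - X) x = s x" for x
    proof (cases "x \<in> V - X")
      case True
      then have "s x \<in> V - X" using permutes_in_image[OF s] by blast
      then show ?thesis using True permutes_not_in[OF q, of "s x"] by (simp add: perm_restrict_def)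
    next
      case False
      then show ?thesis by (simp only: perm_restrict_simps(2)[OF False] permutes_not_in[OF s False])
    qed
    ultimately show "perm_restrict (q \<circ> s) X = q \<and> perm_restrict (q \<circ> s) (V - X) = s"
      by (simp add: fun_eq_iff)
  qed
  have p_facts: "perm_restrict p X permutes X" "cyclic_on (perm_restrict p X) X"
      "perm_restrict p (V - X) permutes V - X" "perm_restrict p X \<circ> perm_restrict p (V - X) = p"
    if p: "p permutes V" "orbit p r = X" for p
  proof -
    have perm: "permutation p" using p V by (auto simp: permutation_permutes)
    have cyc: "cyclic_on p X" using cyclic_on_orbit[OF p(1) V, of r] p(2) by simp
    have "p ` X = X"
      using orbit_inverse[OF permutation_self_in_orbit[OF perm, of r], of p p]
        permutation_orbit_step[OF perm, of r] p(2) by simp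
    then have "bij_betw p X X" using permutes_inj_on[OF p(1)] by (simp add: bij_betw_def)
    then have "bij_betw (perm_restrict p X) X X"
      by (simp add: perm_restrict_simps(1) cong: bij_betw_cong)
    then show pX: "perm_restrict p X permutes X"
      by (rule bij_imp_permutes) (simp add: perm_restrict_def)
    show "cyclic_on (perm_restrict p X) X" using cyc by (simp add: cyclic_on_perm_restrict)
    show pY: "perm_restrict p (V - X) permutes V - X" by (rule perm_restrict_diff_cyclic[OF p(1) cyc])
    have "X \<union> (V - X) = V" using X by blast
    then show "perm_restrict p X \<circ> perm_restrict p (V - X) = p"
      using perm_restrict_union[OF pX pY] perm_restrict_id[OF p(1)] by simp
  qed
  show "\<forall>p\<in>?P. (\<lambda>(q, s). q \<circ> s) (perm_restrict p X, perm_restrict p (V - X)) = p"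
    using p_facts(4) by simp
  show "(\<lambda>p. (perm_restrict p X, perm_restrict p (V - X))) ` ?P \<subseteq> ?A"
    using p_facts(1-3) by blast
  show "(\<lambda>(q, s). q \<circ> s) ` ?A \<subseteq> ?P"
  proof clarify
    fix q s assume q: "q permutes X" "cyclic_on q X" and s: "s permutes V - X"
    have "q permutes V" "s permutes V" using q(1) s X by (auto intro: permutes_subset)
    then have "q \<circ> s permutes V" by (intro permutes_compose)
    moreover have "cyclic_on (q \<circ> s) X"
      by (rule permutes_comp_preserves_cyclic1[OF s q(2), of X]) auto
    then have "orbit (q \<circ> s) r = X" using r by (rule orbit_cyclic_eq3)
    ultimately show "q \<circ> s permutes V \<and> orbit (q \<circ> s) r = X" ..
  qed
qed

text \<open>Permutations are sorted by the orbit X of r; sign and product factor along X and V -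
  X.\<close>

lemma leibniz_expand:
  assumes V: "finite V" and r: "r \<in> V"
  shows "leibniz V B = (\<Sum>X\<in>{X \<in> Pow V. r \<in> X}. cyclic_leibniz X B * leibniz (V - X) B)"
proof -
  let ?h = "\<lambda>p. of_int (sign p) * (\<Prod>x\<in>V. B x (p x))"
  have finP: "finite {p. p permutes V}" using V by (rule finite_permutations)
  have im: "(\<lambda>p. orbit p r) ` {p. p permutes V} \<subseteq> {X \<in> Pow V. r \<in> X}"
  proof (rule image_subsetI)
    fix p assume "p \<in> {p. p permutes V}"
    then have p: "p permutes V" by simp
    then have "permutation p" using V by (auto simp: permutation_permutes)
    then show "orbit p r \<in> {X \<in> Pow V. r \<in> X}"
      using permutes_orbit_subset[OF p r] permutation_self_in_orbit by auto
  qed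
  have "leibniz V B = (\<Sum>X\<in>{X \<in> Pow V. r \<in> X}. \<Sum>p\<in>{p \<in> {p. p permutes V}. orbit p r = X}. ?h p)"
    unfolding leibniz_def using V by (intro sum.group[OF finP _ im, symmetric]) simp
  also have "\<dots> = (\<Sum>X\<in>{X \<in> Pow V. r \<in> X}. cyclic_leibniz X B * leibniz (V - X) B)"
  proof (rule sum.cong[OF refl])
    fix X assume "X \<in> {X \<in> Pow V. r \<in> X}"
    then have X: "X \<subseteq> V" "r \<in> X" by auto
    have finX: "finite X" "finite (V - X)" using V X by (auto intro: finite_subset)
    have "(\<Sum>p\<in>{p \<in> {p. p permutes V}. orbit p r = X}. ?h p) = (\<Sum>p\<in>{p. p permutes V \<and> orbit p r = X}. ?h p)"
      by (rule sum.cong) simp_all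
    also have "\<dots> = (\<Sum>qs\<in>{q. q permutes X \<and> cyclic_on q X} \<times> {s. s permutes V - X}. ?h ((\<lambda>(q, s). q \<circ> s) qs))"
      by (rule sum.reindex_bij_betw[OF bij_betw_permutation_split[OF V X], symmetric])
    also have "\<dots> = (\<Sum>(q, s)\<in>{q. q permutes X \<and> cyclic_on q X} \<times> {s. s permutes V - X}.
        (of_int (sign q) * (\<Prod>x\<in>X. B x (q x))) * (of_int (sign s) * (\<Prod>x\<in>V - X. B x (s x))))"
    proof (rule sum.cong[OF refl], clarify)
      fix q s assume q: "q permutes X" and s: "s permutes V - X"
      have "permutation q" "permutation s" using q s finX by (auto simp: permutation_permutes)
      then have "sign (q \<circ> s) = sign q * sign s" by (rule sign_compose)
      moreover have "(\<Prod>x\<in>V. B x ((q \<circ> s) x)) =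
          (\<Prod>x\<in>V - X. B x ((q \<circ> s) x)) * (\<Prod>x\<in>X. B x ((q \<circ> s) x))"
        by (rule prod.subset_diff[OF X(1) V])
      moreover have "(\<Prod>x\<in>X. B x ((q \<circ> s) x)) = (\<Prod>x\<in>X. B x (q x))"
        using permutes_not_in[OF s] by (intro prod.cong refl) simp
      moreover have "(\<Prod>x\<in>V - X. B x ((q \<circ> s) x)) = (\<Prod>x\<in>V - X. B x (s x))"
      proof (rule prod.cong[OF refl])
        fix x assume "x \<in> V - X"
        then have "s x \<in> V - X" using permutes_in_image[OF s] by blast
        then show "B x ((q \<circ> s) x) = B x (s x)" using permutes_not_in[OF q] by simp
      qed
      ultimately show "of_int (sign (q \<circ> s)) * (\<Prod>x\<in>V. B x ((q \<circ> s) x)) =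
          (of_int (sign q) * (\<Prod>x\<in>X. B x (q x))) * (of_int (sign s) * (\<Prod>x\<in>V - X. B x (s x)))"
        by (simp only: of_int_mult mult_ac)
    qed
    also have "\<dots> = cyclic_leibniz X B * leibniz (V - X) B"
      unfolding cyclic_leibniz_def leibniz_def by (simp add: sum_product sum.cartesian_product)
    finally show "(\<Sum>p\<in>{p \<in> {p. p permutes V}. orbit p r = X}. ?h p) = cyclic_leibniz X B * leibniz (V - X) B" .
  qed
  finally show ?thesis .
qed

text \<open>Summing the expansions over all roots removes the dependence on the root.\<close>

lemma card_mult_leibniz:
  assumes V: "finite V"
  shows "of_nat (card V) * leibniz V B =
    (\<Sum>X\<in>Pow V. (of_nat (card X) * cyclic_leibniz X B) * leibniz (V - X) B)"
proof -
  let ?t = "\<lambda>X. cyclic_leibniz X B * leibniz (V - X) B"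
  have "of_nat (card V) * leibniz V B = (\<Sum>r\<in>V. leibniz V B)" by simp
  also have "\<dots> = (\<Sum>r\<in>V. \<Sum>X\<in>{X \<in> Pow V. r \<in> X}. ?t X)"
    by (rule sum.cong[OF refl leibniz_expand[OF V]])
  also have "\<dots> = (\<Sum>X\<in>Pow V. \<Sum>r\<in>{r \<in> V. r \<in> X}. ?t X)"
    using V by (intro sum.swap_restrict) simp_all
  also have "\<dots> = (\<Sum>X\<in>Pow V. (of_nat (card X) * cyclic_leibniz X B) * leibniz (V - X) B)"
  proof (rule sum.cong[OF refl])
    fix X assume "X \<in> Pow V"
    then have "{r \<in> V. r \<in> X} = X" by auto
    then show "(\<Sum>r\<in>{r \<in> V. r \<in> X}. ?t X) = (of_nat (card X) * cyclic_leibniz X B) * leibniz (V - X) B"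
      by (simp add: mult.assoc)
  qed
  finally show ?thesis .
qed

section \<open>The characteristic polynomial as a Leibniz sum\<close>

text \<open>The entries of \<lambda> I - M, with \<open>[:0, 1:]\<close> for the indeterminate
  \<lambda>.\<close>

definition char_entry :: "'a graph \<Rightarrow> 'a \<Rightarrow> 'a \<Rightarrow> int poly" where
  "char_entry G x y = (if x = y then [:0, 1:] else 0) - (if {x, y} \<in> edges G then 1 else 0)"

lemma characteristic_polynomial_eq_leibniz:
  assumes G: "simple_graph G"
  shows "characteristic_polynomial G = leibniz (verts G) (char_entry G)"
proof -
  obtain vs where vs: "set vs = verts G" "distinct vs"
    using finite_distinct_list[OF simple_finite[OF G]] by blast
  define n where "n = length vs"
  let ?M = "char_poly_matrix (adjacency_matrix G vs)"
  have M: "?M \<in> carrier_mat n n" by (auto simp: adjacency_matrix_def n_def)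
  have f: "bij_betw (\<lambda>i. vs ! i) {0..<n} (verts G)"
    using bij_betw_nth[OF vs(2), of "{0..<n}" "verts G"] vs(1) by (simp add: n_def lessThan_atLeast0)
  have "characteristic_polynomial G = det ?M"
    by (simp add: characteristic_polynomial_eq[OF vs(2,1)] char_poly_def)
  also have "\<dots> = leibniz {0..<n} (\<lambda>i j. char_entry G (vs ! i) (vs ! j))"
    unfolding det_def'[OF M] leibniz_def
  proof (intro sum.cong refl arg_cong2[where f = "(*)"] prod.cong)
    fix p i assume "p \<in> {p. p permutes {0..<n}}" "i \<in> {0..<n}"
    then have i: "i < n" "p i < n" using permutes_in_image[of p "{0..<n}" i] by auto
    then have "vs ! i = vs ! p i \<longleftrightarrow> i = p i" using vs(2) by (simp add: nth_eq_iff_index_eq n_def)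
    then show "?M $$ (i, p i) = char_entry G (vs ! i) (vs ! p i)"
      using i by (simp add: char_poly_matrix_def adjacency_matrix_def char_entry_def n_def one_pCons)
  qed
  also have "\<dots> = leibniz (verts G) (char_entry G)"
    by (rule leibniz_reindex[OF f, symmetric]) simp
  finally show ?thesis .
qed

text \<open>Iterating q from r lists V in cyclic order; \<open>funpow_dist1 q r r\<close> is the
  time of the first return to r.\<close>

lemma cyclic_permutation_cycle:
  assumes q: "q permutes V" "cyclic_on q V" and V: "finite V" and r: "r \<in> V"
  defines "g \<equiv> \<lambda>j. (q ^^ j) r"
  shows "inj_on g {..<card V}" "g ` {..<card V} = V" "cycle_edges (card V) g = (\<lambda>x. {x, q x}) ` V"
proof -
  let ?n = "funpow_dist1 q r r"
  have perm: "permutation q" using q V by (auto simp: permutation_permutes)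
  have self: "r \<in> orbit q r" by (rule permutation_self_in_orbit[OF perm])
  have orb: "orbit q r = V" by (rule orbit_cyclic_eq3[OF q(2) r])
  have inj: "inj_on g {..<?n}"
    using inj_on_funpow_dist1[OF self] by (simp only: g_def lessThan_atLeast0)
  have img: "g ` {..<?n} = V"
    using orbit_conv_funpow_dist1[OF self] by (simp only: g_def lessThan_atLeast0 orb)
  have n: "card V = ?n" using card_image[OF inj] unfolding img by simp
  show "inj_on g {..<card V}" "g ` {..<card V} = V" using inj img unfolding n by this
  have "(q ^^ ?n) r = r" by (rule funpow_dist1_prop[OF self])
  then have "g (Suc j mod ?n) = q (g j)" if "j < ?n" for j
    using that by (cases "Suc j = ?n") (auto simp: g_def)
  then have "cycle_edges ?n g = (\<lambda>j. {g j, q (g j)}) ` {..<?n}"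
    unfolding cycle_edges_image by (intro image_cong refl) (simp only: lessThan_iff)
  also have "\<dots> = (\<lambda>x. {x, q x}) ` g ` {..<?n}" by (simp only: image_image)
  finally show "cycle_edges (card V) g = (\<lambda>x. {x, q x}) ` V" unfolding n img .
qed

text \<open>The contribution of one hamiltonian cycle. Its value is 2 (-1)^(n-1) for n >= 3, from
  the two orientations, and -1 for n = 2; the proof uses only that it does not depend on the
  graph.\<close>

definition cycle_sign_sum :: "nat \<Rightarrow> int" where
  "cycle_sign_sum n = (\<Sum>q | q permutes {..<n} \<and> cyclic_on q {..<n} \<and> (\<lambda>x. {x, q x}) ` {..<n} = cycle_edges n id. sign q)"

text \<open>By transport along an isomorphism with \<open>C n\<close>, the cyclic permutations following a given
  hamiltonian cycle have a sum of signs that depends on \<open>n\<close> only.\<close>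

lemma sum_sign_along_cycle:
  assumes g: "inj_on g {..<n}" "g ` {..<n} = V"
  shows "(\<Sum>q | q permutes V \<and> cyclic_on q V \<and> (\<lambda>x. {x, q x}) ` V = cycle_edges n g. sign q) = cycle_sign_sum n"
proof -
  let ?A = "{..<n}"
  have bij: "bij_betw g ?A V" using g by (simp add: bij_betw_def)
  define g' where "g' = inv_into ?A g"
  have g'g: "g' (g x) = x" if "x \<in> ?A" for x using g that by (simp add: g'_def)
  have app: "map_permutation ?A g p (g x) = g (p x)" if "x \<in> ?A" for p x
    using map_permutation_apply[OF g(1) that] .
  have cyc: "cyclic_on (map_permutation ?A g p) V \<longleftrightarrow> cyclic_on p ?A" if p: "p permutes ?A" for p
  proof
    assume "cyclic_on p ?A"
    from cyclic_on_image[OF this, of "map_permutation ?A g p" g] show "cyclic_on (map_permutation ?A g p) V"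
      using app g(2) by simp
  next
    assume "cyclic_on (map_permutation ?A g p) V"
    moreover have "p (g' y) = g' (map_permutation ?A g p y)" if "y \<in> V" for y
    proof -
      have "y \<in> g ` ?A" using that by (simp only: g(2))
      then obtain x where x: "x \<in> ?A" "y = g x" by blast
      then show ?thesis using app[OF x(1), of p] g'g[OF x(1)] g'g[of "p x"] permutes_in_image[OF p, of x] by simp
    qed
    ultimately have "cyclic_on p (g' ` V)" by (rule cyclic_on_image)
    moreover have "g' ` V = ?A" unfolding g(2)[symmetric] image_image using g'g by simp
    ultimately show "cyclic_on p ?A" by simp
  qed
  have edg: "(\<lambda>x. {x, map_permutation ?A g p x}) ` V = cycle_edges n g \<longleftrightarrow>
      (\<lambda>x. {x, p x}) ` ?A = cycle_edges n id" if p: "p permutes ?A" for p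
  proof -
    have 1: "(\<lambda>x. {x, map_permutation ?A g p x}) ` V = (\<lambda>e. g ` e) ` ((\<lambda>x. {x, p x}) ` ?A)"
      unfolding g(2)[symmetric] image_image by (intro image_cong refl) (simp add: app)
    have 2: "cycle_edges n g = (\<lambda>e. g ` e) ` cycle_edges n id"
      unfolding cycle_edges_image image_image by simp
    have 3: "(\<lambda>x. {x, p x}) ` ?A \<subseteq> Pow ?A"
      by (rule image_subsetI) (simp add: permutes_in_image[OF p, simplified])
    have 4: "cycle_edges n id \<subseteq> Pow ?A" by (auto simp: cycle_edges_def)
    show ?thesis unfolding 1 2 by (rule inj_on_image_eq_iff[OF inj_on_image_Pow[OF g(1)] 3 4])
  qed
  have "cycle_sign_sum n = (\<Sum>p\<in>{p \<in> {p. p permutes ?A}. cyclic_on p ?A \<and> (\<lambda>x. {x, p x}) ` ?A = cycle_edges n id}.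
      sign (map_permutation ?A g p))"
    unfolding cycle_sign_sum_def by (rule sum.cong) (simp_all add: sign_map_permutation[OF g(1)])
  also have "\<dots> = (\<Sum>q\<in>{q \<in> {q. q permutes V}. cyclic_on q V \<and> (\<lambda>x. {x, q x}) ` V = cycle_edges n g}. sign q)"
  proof (rule sum.reindex_bij_betw, rule bij_betw_Collect[OF bij_betw_map_permutation[OF bij]])
    fix p assume "p \<in> {p. p permutes ?A}"
    then show "(cyclic_on (map_permutation ?A g p) V \<and> (\<lambda>x. {x, map_permutation ?A g p x}) ` V = cycle_edges n g) \<longleftrightarrow>
        (cyclic_on p ?A \<and> (\<lambda>x. {x, p x}) ` ?A = cycle_edges n id)"
      using cyc edg by simp
  qed
  finally show ?thesis by simp
qed

text \<open>A cyclic permutation of at least two points has no fixed point, so the indeterminate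
  does not occur and every factor is -1 or 0. The permutations that survive are grouped by the
  hamiltonian cycle that they follow.\<close>

lemma cyclic_leibniz_char_entry:
  assumes K: "simple_graph K" and n: "2 \<le> v K"
  shows "cyclic_leibniz (verts K) (char_entry K) =
    (- 1) ^ v K * of_nat (num_cycles (v K) K) * of_int (cycle_sign_sum (v K))"
proof -
  let ?V = "verts K" and ?n = "v K"
  let ?S = "{q. q permutes ?V \<and> cyclic_on q ?V}"
  let ?E = "\<lambda>q. (\<lambda>x. {x, q x}) ` ?V"
  let ?c = "\<lambda>q. \<lparr>verts = ?V, edges = ?E q\<rparr>"
  have V: "finite ?V" using K by simp
  have finS: "finite ?S" by (rule finite_subset[OF _ finite_permutations[OF V]]) blast
  have "?V \<noteq> {}"
  proof
    assume "?V = {}"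
    then show False using n by (simp add: v_def)
  qed
  then obtain r where r: "r \<in> ?V" by blast
  have nofix: "x \<noteq> q x" if "q \<in> ?S" "x \<in> ?V" for q x
  proof -
    have "cyclic_on q ?V" using that(1) by simp
    then have "q x = x \<longleftrightarrow> card ?V = 1" using that(2) by (rule eq_on_cyclic_on_iff1)
    then show ?thesis using n by (auto simp: v_def)
  qed
  have weight: "(\<Prod>x\<in>?V. char_entry K x (q x)) = (if ?E q \<subseteq> edges K then (- 1) ^ ?n else 0)" if q: "q \<in> ?S" for q
  proof -
    have "(\<Prod>x\<in>?V. char_entry K x (q x)) = (\<Prod>x\<in>?V. if {x, q x} \<in> edges K then - 1 else 0)"
      using nofix[OF q] by (intro prod.cong refl) (auto simp: char_entry_def)
    also have "\<dots> = (if ?E q \<subseteq> edges K then (- 1) ^ ?n else 0)"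
    proof (cases "?E q \<subseteq> edges K")
      case True
      then have "(\<Prod>x\<in>?V. if {x, q x} \<in> edges K then - 1 else 0) = (\<Prod>x\<in>?V. - 1 :: int poly)"
        by (intro prod.cong refl) auto
      then show ?thesis using True by (simp add: v_def)
    next
      case False
      then obtain x where "x \<in> ?V" "{x, q x} \<notin> edges K" by blast
      then have "(\<Prod>x\<in>?V. if {x, q x} \<in> edges K then - 1 else 0 :: int poly) = 0"
        using V by (intro prod_zero) auto
      then show ?thesis using False by simp
    qed
    finally show ?thesis .
  qed
  have to_cycle: "?c q \<in> cycle_subgraphs ?n K" if "q \<in> ?S" "?E q \<subseteq> edges K" for q
  proof -
    have q: "q permutes ?V" "cyclic_on q ?V" using that(1) by simp_all
    note cyc = cyclic_permutation_cycle[OF q V r, folded v_def]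
    show ?thesis unfolding cycle_subgraphs_iff[OF K] graph.select_convs
      by (intro conjI exI[of _ "\<lambda>j. (q ^^ j) r"] order.refl that(2) cyc(1) cyc(2,3)[symmetric])
  qed
  have fiber: "(\<Sum>q\<in>{q \<in> {q \<in> ?S. ?E q \<subseteq> edges K}. ?c q = F}. sign q) = cycle_sign_sum ?n"
    if F: "F \<in> cycle_subgraphs ?n K" for F
  proof -
    obtain g where g: "inj_on g {..<?n}" "verts F = g ` {..<?n}" "edges F = cycle_edges ?n g"
      "verts F \<subseteq> ?V" "edges F \<subseteq> edges K"
      using F by (elim cycle_subgraphsE)
    have vF: "verts F = ?V" using card_verts_cycle[OF F] g(4) V by (intro card_subset_eq) (simp_all add: v_def)
    have "F = \<lparr>verts = ?V, edges = cycle_edges ?n g\<rparr>" using vF g(3) by simp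
    then have cF: "?c q = F \<longleftrightarrow> ?E q = cycle_edges ?n g" for q by simp
    have sub: "cycle_edges ?n g \<subseteq> edges K" using g(3,5) by simp
    have "{q \<in> {q \<in> ?S. ?E q \<subseteq> edges K}. ?c q = F} =
        {q. q permutes ?V \<and> cyclic_on q ?V \<and> ?E q = cycle_edges ?n g}"
      unfolding cF mem_Collect_eq
      by (intro Collect_cong iffI; elim conjE; intro conjI; (assumption | simp only: sub))
    then show ?thesis using sum_sign_along_cycle[OF g(1) g(2)[symmetric, unfolded vF]] by (simp only:)
  qed
  have "cyclic_leibniz ?V (char_entry K) = (\<Sum>q\<in>?S. if ?E q \<subseteq> edges K then of_int (sign q) * (- 1) ^ ?n else 0)"
    unfolding cyclic_leibniz_def by (rule sum.cong[OF refl]) (simp add: weight)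
  also have "\<dots> = (\<Sum>q\<in>{q \<in> ?S. ?E q \<subseteq> edges K}. of_int (sign q) * (- 1) ^ ?n)"
    by (rule sum.inter_filter[OF finS, symmetric])
  also have "\<dots> = of_int (\<Sum>q\<in>{q \<in> ?S. ?E q \<subseteq> edges K}. sign q) * (- 1) ^ ?n"
    by (simp add: sum_distrib_right)
  also have "(\<Sum>q\<in>{q \<in> ?S. ?E q \<subseteq> edges K}. sign q) =
      (\<Sum>F\<in>cycle_subgraphs ?n K. \<Sum>q\<in>{q \<in> {q \<in> ?S. ?E q \<subseteq> edges K}. ?c q = F}. sign q)"
  proof (rule sum.group[symmetric])
    show "finite {q \<in> ?S. ?E q \<subseteq> edges K}" by (rule finite_subset[OF _ finS]) blast
    show "finite (cycle_subgraphs ?n K)" by (rule finite_cycle_subgraphs[OF K])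
    show "?c ` {q \<in> ?S. ?E q \<subseteq> edges K} \<subseteq> cycle_subgraphs ?n K" using to_cycle by blast
  qed
  also have "\<dots> = (\<Sum>F\<in>cycle_subgraphs ?n K. cycle_sign_sum ?n)"
    by (rule sum.cong[OF refl fiber])
  also have "\<dots> = int (num_cycles ?n K) * cycle_sign_sum ?n"
    by (simp add: num_cycles_def)
  finally show ?thesis by (simp add: mult_ac)
qed

lemma cyclic_leibniz_order_1:
  assumes K: "simple_graph K" and n: "v K = 1"
  shows "cyclic_leibniz (verts K) (char_entry K) = [:0, 1:]"
proof -
  obtain x where x: "verts K = {x}" using n by (auto simp: v_def card_1_singleton_iff)
  have "{x} \<notin> edges K" using K by (auto simp: simple_graph_def)
  moreover have "{q. q permutes {x} \<and> cyclic_on q {x}} = {id}"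
    by (auto simp: cyclic_on_def orbit_eq_singleton_iff eq_commute[of "{x}"])
  ultimately show ?thesis unfolding cyclic_leibniz_def x by (simp add: char_entry_def)
qed

text \<open>The complement has full order only for X = {}, where the factor
  \<open>v (induced K X)\<close> is 0. So the truncation changes nothing, and only graphs of order
  below m enter through \<open>leibniz\<close>.\<close>

lemma card_mult_leibniz_char_entry:
  assumes "simple_graph K" "m = v K"
  shows "of_nat m * leibniz (verts K) (char_entry K) = (\<Sum>X\<in>Pow (verts K).
    (of_nat (v (induced K X)) * cyclic_leibniz (verts (induced K X)) (char_entry (induced K X))) *
    (if v (induced K (verts K - X)) < m
     then leibniz (verts (induced K (verts K - X))) (char_entry (induced K (verts K - X))) else 0))"
proof -
  let ?V = "verts K" and ?B = "char_entry K"
  have V: "finite ?V" using assms(1) by simp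
  have entry: "char_entry (induced K X) x y = ?B x y" if "x \<in> X" "y \<in> X" for X x y
    using that by (simp add: char_entry_def edges_induced)
  have "of_nat m * leibniz ?V ?B = (\<Sum>X\<in>Pow ?V. (of_nat (card X) * cyclic_leibniz X ?B) * leibniz (?V - X) ?B)"
    unfolding assms(2) v_def by (rule card_mult_leibniz[OF V])
  also have "\<dots> = (\<Sum>X\<in>Pow ?V. (of_nat (card X) * cyclic_leibniz X (char_entry (induced K X))) *
      (if card (?V - X) < m then leibniz (?V - X) (char_entry (induced K (?V - X))) else 0))"
  proof (rule sum.cong[OF refl])
    fix X assume X: "X \<in> Pow ?V"
    have "cyclic_leibniz X (char_entry (induced K X)) = cyclic_leibniz X ?B"
      by (rule cyclic_leibniz_cong) (rule entry)
    moreover have "leibniz (?V - X) (char_entry (induced K (?V - X))) = leibniz (?V - X) ?B"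
      by (rule leibniz_cong) (rule entry)
    moreover have "card (?V - X) < m" if "X \<noteq> {}"
      unfolding assms(2) v_def using that X V by (intro psubset_card_mono) auto
    ultimately show "(of_nat (card X) * cyclic_leibniz X ?B) * leibniz (?V - X) ?B =
        (of_nat (card X) * cyclic_leibniz X (char_entry (induced K X))) *
        (if card (?V - X) < m then leibniz (?V - X) (char_entry (induced K (?V - X))) else 0)"
      by (cases "X = {}") simp_all
  qed
  finally show ?thesis by (simp only: verts_induced v_induced)
qed

context matching
begin

text \<open>Induction on the order: \<open>v K\<close> times the polynomial is a complement sum over
  cyclic parts and polynomials of smaller graphs, and a nonzero \<open>v K\<close> cancels among
  integer polynomials.\<close>

lemma agrees_characteristic_polynomial: "agrees n characteristic_polynomial characteristic_polynomial"
proof -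
  let ?f = "\<lambda>K. of_nat (v K) * cyclic_leibniz (verts K) (char_entry K)"
  let ?P = "\<lambda>K. leibniz (verts K) (char_entry K)"
  have f: "agrees n ?f ?f" for n
  proof (rule agreesI)
    fix K K' assume K: "R K K'"
    note s = R_simpleD[OF K] and ord = R_order[OF K]
    \<comment> \<open>Order 0 vanishes through the factor \<open>v K\<close>, order 1 gives the
      indeterminate, and from order 2 on the number of hamiltonian cycles decides.\<close>
    consider "v K = 0" | "v K = 1" | "2 \<le> v K" by linarith
    then show "?f K = ?f K'"
    proof cases
      case 2
      then show ?thesis using s ord by (simp add: cyclic_leibniz_order_1)
    next
      case 3
      have "num_cycles (v K) K = num_cycles (v K) K'" by (rule agreesD[OF agrees_num_cycles[OF 3] K order.refl])
      then show ?thesis using 3 s ord by (simp add: cyclic_leibniz_char_entry)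
    qed (use ord in simp)
  qed
  have P: "agrees n ?P ?P"
  proof (induction n rule: less_induct)
    case (less n)
    show ?case
    proof (rule agreesI)
      fix K K' assume K: "R K K'" and n: "v K \<le> n"
      note s = R_simpleD[OF K]
      show "?P K = ?P K'"
      proof (cases "v K = 0")
        case True
        then have "verts K = {}" "verts K' = {}" using s R_order[OF K] by (simp_all add: v_def)
        then show ?thesis by (simp add: leibniz_def)
      next
        case False
        let ?g = "\<lambda>H. if v H < v K then ?P H else 0"
        have g: "agrees n ?g ?g"
        proof (rule agreesI)
          fix H H' assume H: "R H H'"
          show "?g H = ?g H'"
          proof (cases "v H < v K")
            case True
            then have "agrees (v H) ?P ?P" using less.IH[of "v H"] n by simp
            from agreesD[OF this H order.refl] show ?thesis using R_order[OF H] by simp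
          qed (simp add: R_order[OF H])
        qed
        have "of_nat (v K) * ?P K = of_nat (v K) * ?P K'"
          unfolding card_mult_leibniz_char_entry[OF s(1) refl] card_mult_leibniz_char_entry[OF s(2) R_order[OF K]]
          by (rule agreesD[OF agrees_sum_complement[OF f g] K n])
        then show ?thesis using False by simp
      qed
    qed
  qed
  show ?thesis
  proof (rule agreesI)
    fix K K' assume K: "R K K'" "v K \<le> n"
    show "characteristic_polynomial K = characteristic_polynomial K'"
      unfolding characteristic_polynomial_eq_leibniz[OF R_simpleD(1)[OF K(1)]]
        characteristic_polynomial_eq_leibniz[OF R_simpleD(2)[OF K(1)]]
      by (rule agreesD[OF P K])
  qed
qed

end

theorem theorem3p12:
  fixes G :: "'a graph" and G' :: "'b graph"
  assumes "simple_graph G" and "edges G \<noteq> {}"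
    and "simple_graph G'" and "edges G' \<noteq> {}"
    and "same_N G G'"
  shows
    "((\<forall>A. set A \<subseteq> {2..v G} \<longrightarrow> con A G = con A G') \<and> ham G = ham G') \<and>
     (\<forall>A B m. length A = length B \<and> (\<forall>a\<in>set A. set a \<subseteq> {2..v G}) \<and> set B \<subseteq> {2..v G} \<and> m \<le> v G \<longrightarrow>
        Q m A B G = Q m A B G' \<and> T m A B G = T m A B G') \<and>
     (num_spanning_trees G = num_spanning_trees G' \<and>
      (\<forall>i\<in>{3..v G}. num_cycles i G = num_cycles i G') \<and>
      (\<forall>i\<in>{3..v G}. num_unicyclic i G = num_unicyclic i G') \<and>
      characteristic_polynomial G = characteristic_polynomial G')"
proof -
  obtain R where "matching R" and R: "R G G'" using matching_if_same_N[OF assms] by blast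
  then interpret matching R by simp
  note agree = agreesD[OF _ R order.refl]
  have n: "v G = v G'" by (rule R_order[OF R])
  have n2: "2 \<le> v G"
  proof -
    obtain e where "e \<in> edges G" using assms(2) by blast
    then have "e \<subseteq> verts G" "card e = 2" using assms(1) by (auto simp: simple_graph_def)
    then show ?thesis using card_mono[OF simple_finite[OF assms(1)], of e] by (simp add: v_def)
  qed
  have con: "con A G = con A G'" if "set A \<subseteq> {2..v G}" for A
    using that by (intro agree agrees_con) auto
  have ham: "ham G = ham G'"
    unfolding ham_eq_num_cycles[OF assms(1)] ham_eq_num_cycles[OF assms(3)] n[symmetric]
    by (rule agree[OF agrees_num_cycles[OF n2]])
  have QT: "Q m A B G = Q m A B G' \<and> T m A B G = T m A B G'"
    if "length A = length B" "\<forall>a\<in>set A. set a \<subseteq> {2..v G}" for A B m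
  proof -
    have A: "\<forall>a\<in>set A. set a \<subseteq> {2..}" using that(2) by fastforce
    show ?thesis using agree[OF agrees_Q[OF A]] agree[OF agrees_T[OF A that(1)]] by simp
  qed
  have trees: "num_spanning_trees G = num_spanning_trees G'"
  proof -
    \<comment> \<open>Spanning trees are counted through pairs with an edge, so m =
      \<open>v G - 1\<close> has to be positive; the order is at least 2 since G has an
      edge.\<close>
    have "v G \<noteq> 0" "v G' \<noteq> 0" "0 < v G - 1" using n2 n by simp_all
    then show ?thesis
      using agree[OF agrees_spanning_connected[OF agrees_num_cycles[OF order.refl], of "v G - 1"]] n
      by (simp add: num_spanning_trees_eq assms(1,3))
  qed
  have cycles: "num_cycles i G = num_cycles i G'" if "i \<in> {3..v G}" for i
    using that by (intro agree agrees_num_cycles) simp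
  have unicyclic: "num_unicyclic i G = num_unicyclic i G'" if "i \<in> {3..v G}" for i
    using that by (intro agree agrees_num_unicyclic) simp
  show ?thesis
    using con ham QT trees cycles unicyclic agree[OF agrees_characteristic_polynomial] by blast
qed

end
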